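(* Fix $\eta>0$. For the Erlang A ($M/M/m+M$) process $N(t)$ with first passage time $\tau(n_* )=\min\{t:N(t)=n_*\}$, $n_*>m$, let $\widehat Q_n(\theta)=E\left[e^{-\theta\tau(n_* )}\mid N(0)=n\right]$. For $m\to\infty$ with the scaling $$\rho=m-\sqrt m\,\beta,\qquad n=m+\sqrt m\,x,\qquad n_*=m+\sqrt m\,b,\quad 0<b<\infty,$$ where $x$, $\beta$ and $b$ are $O(1)$, $\widehat Q_n(\theta)$ has the limit $\widehat{\mathcal P}(x,\theta)$, where $$\widehat{\mathcal P}(x,\theta)=\frac{e^{\beta(x-b)/2}\,e^{(x^2-\eta b^2)/4}\,\sqrt{2\pi}\;D_{-\theta}(-\beta-x)}{\Gamma\!\left(\frac\theta\eta\right)\left[D_{-\theta/\eta}\!\left(\frac{\beta+\eta b}{\sqrt\eta}\right)\Lambda_1+D_{-\theta/\eta}\!\left(\frac{-\beta-\eta b}{\sqrt\eta}\right)\Lambda_2\right]},\qquad -\infty<x\le0,$$ with $$\Lambda_1=-\sqrt\eta\,D'_{-\theta/\eta}\!\left(\frac{-\beta}{\sqrt\eta}\right)D_{-\theta}(-\beta)+D_{-\theta/\eta}\!\left(\frac{-\beta}{\sqrt\eta}\right)D'_{-\theta}(-\beta),$$ $$\Lambda_2=-\sqrt\eta\,D'_{-\theta/\eta}\!\left(\frac{\beta}{\sqrt\eta}\right)D_{-\theta}(-\beta)-D_{-\theta/\eta}\!\left(\frac{\beta}{\sqrt\eta}\right)D'_{-\theta}(-\beta),$$ and $$\widehat{\mathcal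 P}(x,\theta)=e^{\beta(x-b)/2}\,e^{\eta(x^2-b^2)/4}\,\frac{D_{-\theta/\eta}\!\left(\frac{\beta+\eta x}{\sqrt\eta}\right)\Lambda_1+D_{-\theta/\eta}\!\left(\frac{-\beta-\eta x}{\sqrt\eta}\right)\Lambda_2}{D_{-\theta/\eta}\!\left(\frac{\beta+\eta b}{\sqrt\eta}\right)\Lambda_1+D_{-\theta/\eta}\!\left(\frac{-\beta-\eta b}{\sqrt\eta}\right)\Lambda_2},\qquad 0\le x<b.$$
   Context: Erlang A model ($M/M/m+M$ queue) with service rate $\mu=1$: $N(t)$ is the birth–death process on $\{0,1,2,\dots\}$ with birth rate $\rho$ in every state, and death rate $n$ in state $n$ for $0\le n\le m$ and $m+(n-m)\eta$ in state $n$ for $n\ge m$. Here $m$ is the number of servers, $\eta$ is the abandonment rate of each waiting customer, and $\theta$ is the Laplace transform variable. $D_p(z)$ is the parabolic cylinder function of index $p$ and argument $z$, i.e. the solution of $D_p''(z)+\left(p+\frac12-\frac{z^2}{4}\right)D_p(z)=0$ with $D_p(z)\sim z^pe^{-z^2/4}$ as $z\to+\infty$; $D_p'$ denotes its derivative with respect to the argument $z$. $\Gamma$ is the Gamma function.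
   Formalization: In the formula for x ≤ 0 the constant √(2π) is corrected to √(2πη); as printed, the two formulas disagree at x = 0 unless η = 1. The Laplace variable θ is complex with Re θ > 0. *)

theory Defs
  imports "HOL-Probability.Probability" "HOL-Complex_Analysis.Complex_Analysis"
begin

section \<open>Parabolic cylinder functions\<close>

text \<open>
  The index is an arbitrary complex number and the function is taken on the whole complex plane.
  The normalisation is imposed along the positive real axis; it excludes any contribution of
  the second solution, which grows like \<open>exp (x\<^sup>2 / 4)\<close>, so the solution is unique.
\<close>

definition is_parabolic_cylinder :: "complex \<Rightarrow> (complex \<Rightarrow> complex) \<Rightarrow> bool" where
  "is_parabolic_cylinder p f \<longleftrightarrow>
     f holomorphic_on UNIV \<and>
     (\<forall>z. deriv (deriv f) z + (p + 1 / 2 - z\<^sup>2 / 4) * f z = 0) \<and>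
     (\<lambda>x::real. f (of_real x)) \<sim>[at_top]
       (\<lambda>x. of_real x powr p * exp (- (of_real x)\<^sup>2 / 4))"

definition parabolic_cylinder :: "complex \<Rightarrow> complex \<Rightarrow> complex" where
  "parabolic_cylinder p = (THE f. is_parabolic_cylinder p f)"


section \<open>Birth-death processes\<close>

text \<open>\<open>p t i j\<close> is the probability of moving from \<open>i\<close> to \<open>j\<close> during a time span \<open>t\<close>.\<close>

definition transition_function :: "(real \<Rightarrow> nat \<Rightarrow> nat \<Rightarrow> real) \<Rightarrow> bool" where
  "transition_function p \<longleftrightarrow>
     (\<forall>t\<ge>0. \<forall>i j. 0 \<le> p t i j) \<and>
     (\<forall>t\<ge>0. \<forall>i. (\<lambda>j. p t i j) sums 1) \<and>
     (\<forall>i j. p 0 i j = of_bool (i = j)) \<and>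
     (\<forall>s\<ge>0. \<forall>t\<ge>0. \<forall>i k. (\<lambda>j. p s i j * p t j k) sums p (s + t) i k)"

definition has_birth_death_rates ::
    "(real \<Rightarrow> nat \<Rightarrow> nat \<Rightarrow> real) \<Rightarrow> (nat \<Rightarrow> real) \<Rightarrow> (nat \<Rightarrow> real) \<Rightarrow> bool" where
  "has_birth_death_rates p birth death \<longleftrightarrow>
     (\<forall>i. ((\<lambda>h. p h i (Suc i) / h) \<longlongrightarrow> birth i) (at_right 0)) \<and>
     (\<forall>i. ((\<lambda>h. p h (Suc i) i / h) \<longlongrightarrow> death (Suc i)) (at_right 0)) \<and>
     death 0 = 0 \<and>
     (\<forall>i. ((\<lambda>h. (1 - p h i i) / h) \<longlongrightarrow> birth i + death i) (at_right 0))"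

text \<open>
  Time-homogeneous Markov property with respect to the whole (finitely sampled) past.
  The initial distribution is left unspecified.
\<close>

definition markov_with_transitions ::
    "'a measure \<Rightarrow> (real \<Rightarrow> 'a \<Rightarrow> nat) \<Rightarrow> (real \<Rightarrow> nat \<Rightarrow> nat \<Rightarrow> real) \<Rightarrow> bool" where
  "markov_with_transitions M N p \<longleftrightarrow>
     (\<forall>(k::nat) (t::nat \<Rightarrow> real) (s::nat \<Rightarrow> nat).
        0 \<le> t 0 \<longrightarrow> (\<forall>i\<le>k. t i < t (Suc i)) \<longrightarrow>
        measure M {\<omega> \<in> space M. \<forall>i\<le>k. N (t i) \<omega> = s i} > 0 \<longrightarrow>
        \<P>(\<omega> in M. N (t (Suc k)) \<omega> = s (Suc k) \<bar> \<forall>i\<le>k. N (t i) \<omega> = s i)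
          = p (t (Suc k) - t k) (s k) (s (Suc k)))"

definition birth_death_process ::
    "'a measure \<Rightarrow> (real \<Rightarrow> 'a \<Rightarrow> nat) \<Rightarrow> (nat \<Rightarrow> real) \<Rightarrow> (nat \<Rightarrow> real) \<Rightarrow> bool" where
  "birth_death_process M N birth death \<longleftrightarrow>
     prob_space M \<and>
     (\<forall>t\<ge>0. N t \<in> measurable M (count_space UNIV)) \<and>
     (\<forall>\<omega>\<in>space M. \<forall>t\<ge>0. \<forall>\<^sub>F s in at_right t. N s \<omega> = N t \<omega>) \<and>
     (\<exists>p. transition_function p \<and> has_birth_death_rates p birth death \<and>
          markov_with_transitions M N p)"

text \<open>The service rate is normalised to 1.\<close>

definition erlang_a_death_rate :: "nat \<Rightarrow> real \<Rightarrow> nat \<Rightarrow> real" where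
  "erlang_a_death_rate m \<eta> n =
     (if n \<le> m then real n else real m + (real n - real m) * \<eta>)"

definition erlang_a_process ::
    "'a measure \<Rightarrow> (real \<Rightarrow> 'a \<Rightarrow> nat) \<Rightarrow> nat \<Rightarrow> real \<Rightarrow> real \<Rightarrow> bool" where
  "erlang_a_process M N m \<rho> \<eta> \<longleftrightarrow>
     birth_death_process M N (\<lambda>_. \<rho>) (erlang_a_death_rate m \<eta>)"


section \<open>First passage times\<close>

text \<open>
  By right-continuity of the paths the infimum is attained whenever the level is reached;
  otherwise it is \<open>\<infinity>\<close>, and \<open>exp (-\<theta> \<tau>)\<close> is then read as 0.
\<close>

definition first_passage_time :: "(real \<Rightarrow> 'a \<Rightarrow> nat) \<Rightarrow> nat \<Rightarrow> 'a \<Rightarrow> ereal" where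
  "first_passage_time N k \<omega> = Inf {ereal t |t. 0 \<le> t \<and> N t \<omega> = k}"

definition laplace_kernel :: "complex \<Rightarrow> ereal \<Rightarrow> complex" where
  "laplace_kernel \<theta> t = (if t = \<infinity> then 0 else exp (- \<theta> * of_real (real_of_ereal t)))"

text \<open>
  \<open>uniform_measure M A\<close> is the measure \<open>M\<close> conditioned on the event \<open>A\<close>.
\<close>

definition first_passage_laplace ::
    "'a measure \<Rightarrow> (real \<Rightarrow> 'a \<Rightarrow> nat) \<Rightarrow> nat \<Rightarrow> nat \<Rightarrow> complex \<Rightarrow> complex" where
  "first_passage_laplace M N k n \<theta> =
     (LINT \<omega>|uniform_measure M {\<omega> \<in> space M. N 0 \<omega> = n}.
        laplace_kernel \<theta> (first_passage_time N k \<omega>))"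


section \<open>The limiting transform\<close>

definition Lambda1 :: "real \<Rightarrow> real \<Rightarrow> complex \<Rightarrow> complex" where
  "Lambda1 \<eta> \<beta> \<theta> =
     - of_real (sqrt \<eta>) * deriv (parabolic_cylinder (- \<theta> / of_real \<eta>)) (of_real (- \<beta> / sqrt \<eta>))
         * parabolic_cylinder (- \<theta>) (of_real (- \<beta>))
     + parabolic_cylinder (- \<theta> / of_real \<eta>) (of_real (- \<beta> / sqrt \<eta>))
         * deriv (parabolic_cylinder (- \<theta>)) (of_real (- \<beta>))"

definition Lambda2 :: "real \<Rightarrow> real \<Rightarrow> complex \<Rightarrow> complex" where
  "Lambda2 \<eta> \<beta> \<theta> =
     - of_real (sqrt \<eta>) * deriv (parabolic_cylinder (- \<theta> / of_real \<eta>)) (of_real (\<beta> / sqrt \<eta>))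
         * parabolic_cylinder (- \<theta>) (of_real (- \<beta>))
     - parabolic_cylinder (- \<theta> / of_real \<eta>) (of_real (\<beta> / sqrt \<eta>))
         * deriv (parabolic_cylinder (- \<theta>)) (of_real (- \<beta>))"

definition Lambda_comb :: "real \<Rightarrow> real \<Rightarrow> complex \<Rightarrow> real \<Rightarrow> complex" where
  "Lambda_comb \<eta> \<beta> \<theta> y =
     parabolic_cylinder (- \<theta> / of_real \<eta>) (of_real ((\<beta> + \<eta> * y) / sqrt \<eta>)) * Lambda1 \<eta> \<beta> \<theta>
     + parabolic_cylinder (- \<theta> / of_real \<eta>) (of_real ((- \<beta> - \<eta> * y) / sqrt \<eta>)) * Lambda2 \<eta> \<beta> \<theta>"

text \<open>
  The two branches below are meant for \<open>x \<le> 0\<close> and \<open>0 \<le> x < b\<close>.  The constant in the left branch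
  is \<open>sqrt (2 * pi * \<eta>)\<close>, where the published formula has \<open>sqrt (2 * pi)\<close>.  The factor
  \<open>sqrt \<eta>\<close> is forced by agreement of the two branches at \<open>x = 0\<close>: with \<open>q = -\<theta>/\<eta>\<close> and
  \<open>a = \<beta> / sqrt \<eta>\<close>, the Wronskian identity
  \<open>D\<^sub>q(a) D\<^sub>q'(-a) + D\<^sub>q'(a) D\<^sub>q(-a) = - sqrt (2 * pi) / \<Gamma>(-q)\<close> gives
  \<open>Lambda_comb \<eta> \<beta> \<theta> 0 = sqrt \<eta> * sqrt (2 * pi) * D\<^sub>-\<^sub>\<theta>(-\<beta>) / \<Gamma>(\<theta>/\<eta>)\<close>.
  The two constants coincide only for \<open>\<eta> = 1\<close>.
\<close>

definition limit_transform_left ::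
    "real \<Rightarrow> real \<Rightarrow> real \<Rightarrow> complex \<Rightarrow> real \<Rightarrow> complex" where
  "limit_transform_left \<eta> \<beta> b \<theta> x =
     of_real (exp (\<beta> * (x - b) / 2) * exp ((x\<^sup>2 - \<eta> * b\<^sup>2) / 4) * sqrt (2 * pi * \<eta>))
       * parabolic_cylinder (- \<theta>) (of_real (- \<beta> - x))
     / (Gamma (\<theta> / of_real \<eta>) * Lambda_comb \<eta> \<beta> \<theta> b)"

definition limit_transform_right ::
    "real \<Rightarrow> real \<Rightarrow> real \<Rightarrow> complex \<Rightarrow> real \<Rightarrow> complex" where
  "limit_transform_right \<eta> \<beta> b \<theta> x =
     of_real (exp (\<beta> * (x - b) / 2) * exp (\<eta> * (x\<^sup>2 - b\<^sup>2) / 4))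
       * (Lambda_comb \<eta> \<beta> \<theta> x / Lambda_comb \<eta> \<beta> \<theta> b)"

end

theory Submission
  imports Defs "HOL-Real_Asymp.Real_Asymp"
begin

text \<open>
  Let \<open>U\<close> solve \<open>(\<theta> + \<rho> + \<mu>\<^sub>n) U n = \<rho> U (n + 1) + \<mu>\<^sub>n U (n - 1)\<close>, where \<open>\<mu>\<^sub>n\<close> is the death rate in state \<open>n\<close>
  and \<open>\<mu>\<^sub>0 = 0\<close>. Then \<open>e\<^bsup>-\<theta> t\<^esup> U (N t)\<close> is a martingale up to the first passage time of \<open>n\<^sub>*\<close>, and the
  Laplace transform started from \<open>n < n\<^sub>*\<close> is \<open>U n / U n\<^sub>*\<close>; this is proved by sampling the process at the
  times \<open>k h\<close> and letting \<open>h\<close> tend to 0.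

  For \<open>n \<le> m\<close> one has \<open>U n = \<integral> s powr (\<theta> - 1) e\<^bsup>-\<rho> s\<^esup> (1 + s)\<^bsup>n\<^esup> ds\<close> over \<open>(0, \<infinity>)\<close>, and for \<open>n \<ge> m\<close> the solution is
  a combination of two integrals of the same kind with \<open>\<theta> / \<eta>\<close> in place of \<open>\<theta>\<close>. With \<open>s\<close> of order \<open>1 / sqrt m\<close>,
  dominated convergence turns the integrands into
  \<open>t powr (\<kappa> - 1) e\<^bsup>-t\<^sup>2/2 - z t\<^esup>\<close>, whose integral is \<open>\<Gamma>(\<kappa>) e\<^bsup>z\<^sup>2/4\<^esup> D\<^sub>-\<^sub>\<kappa>(z)\<close>; the Wronskian of
  \<open>D\<^sub>q(z)\<close> and \<open>D\<^sub>q(-z)\<close> then produces the constants of the theorem.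
\<close>

section \<open>Gaussian Mellin integrals\<close>

text \<open>No hypothesis says that paths move by single steps, so a sampled chain may skip the
  target. Such an overshoot has probability o(h) per step, because the total exit rate of a state
  equals the sum of its two neighbour rates. Discounting with Re \<theta> > 0 leaves about 1 / (h Re
  \<theta>) effective steps, so the accumulated overshoot and generator errors both vanish. Only the
  finitely many states up to the target enter, and \<open>U\<close> is bounded on them. Each
  integral formula solves the recurrence on its own side of \<open>m\<close>. Agreement at the two
  states \<open>m\<close> and \<open>m + 1\<close> makes the glued function a solution everywhere;
  in the limit this becomes continuity of value and slope at 0. The integrals are scaled with steps
  1 / sqrt m below \<open>m\<close> and sqrt \<eta> / sqrt m above it, and the ratio of the steps is
  the origin of the factors sqrt \<eta> in \<open>Lambda1\<close>, \<open>Lambda2\<close> and in the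
  constant sqrt (2 pi \<eta>). The limit of the quotient requires a nonzero limit at
  \<open>b\<close>. For complex \<theta> this is not visible from the formula; it follows from a
  maximum principle for the recurrence.\<close>

text \<open>The power with exponent \<kappa> - 1, extended by 0 so that all integrals run over the
  whole line. The form with \<open>exp\<close> and \<open>ln\<close> turns products of powers into
  sums of exponents.\<close>

definition mellin_kernel :: "complex \<Rightarrow> real \<Rightarrow> complex" where
  "mellin_kernel \<kappa> t = (if 0 < t then exp ((\<kappa> - 1) * of_real (ln t)) else 0)"

lemma mellin_kernel_measurable [measurable]: "mellin_kernel \<kappa> \<in> borel_measurable borel"
  unfolding mellin_kernel_def by measurable

lemma norm_mellin_kernel:
  "cmod (mellin_kernel \<kappa> t) = (if 0 < t then t powr (Re \<kappa> - 1) else 0)"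
  by (simp add: mellin_kernel_def powr_def)

lemma mellin_kernel_Suc: "mellin_kernel (\<kappa> + 1) t = of_real t * mellin_kernel \<kappa> t"
proof (cases "0 < t")
  case True
  have "exp (\<kappa> * of_real (ln t)) = exp (of_real (ln t)) * exp ((\<kappa> - 1) * of_real (ln t))"
    by (simp add: exp_add [symmetric] algebra_simps)
  also have "exp (of_real (ln t)) = (of_real t :: complex)"
    using True by (subst exp_of_real) simp
  finally show ?thesis using True by (simp add: mellin_kernel_def)
qed (simp add: mellin_kernel_def)

lemma mellin_kernel_add_simps:
  "mellin_kernel (1 + \<kappa>) t = of_real t * mellin_kernel \<kappa> t"
  "mellin_kernel (\<kappa> + 2) t = of_real t * (of_real t * mellin_kernel \<kappa> t)"
  "mellin_kernel (2 + \<kappa>) t = of_real t * (of_real t * mellin_kernel \<kappa> t)"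
  using mellin_kernel_Suc [of \<kappa> t] mellin_kernel_Suc [of "\<kappa> + 1" t] by (simp_all add: add.commute)

lemma mellin_kernel_eq_powr: "0 < t \<Longrightarrow> mellin_kernel \<kappa> t = of_real t powr (\<kappa> - 1)"
  by (simp add: mellin_kernel_def powr_def Ln_of_real)

lemma integrable_mellin_exp:
  assumes "0 < Re \<kappa>" "0 < c"
  shows "integrable lborel (\<lambda>t. mellin_kernel \<kappa> t * of_real (exp (- c * t)))"
proof -
  have "set_integrable lebesgue {0<..} (\<lambda>t. of_real t powr (\<kappa> - 1) / complex_of_real (exp (c * t)))"
    by (rule absolutely_integrable_Gamma_integral) fact+
  then have "integrable lebesgue (\<lambda>t. mellin_kernel \<kappa> t * of_real (exp (- c * t)))"
    unfolding set_integrable_def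
    by (rule Bochner_Integration.integrable_cong [THEN iffD1, rotated -1])
       (auto simp: mellin_kernel_eq_powr indicator_def mellin_kernel_def exp_minus field_simps powr_def Ln_of_real)
  then show ?thesis
    by (subst (asm) integrable_completion) auto
qed

lemma integral_mellin_exp:
  assumes "0 < Re \<kappa>"
  shows "(LINT t|lborel. mellin_kernel \<kappa> t * of_real (exp (- t))) = Gamma \<kappa>"
proof -
  have int: "integrable lborel (\<lambda>t. mellin_kernel \<kappa> t * of_real (exp (- t)))"
    using integrable_mellin_exp [OF assms, of 1] by simp
  have "((\<lambda>t. of_real t powr (\<kappa> - 1) / complex_of_real (exp t)) has_integral Gamma \<kappa>) {0<..}"
    by (rule Gamma_integral_complex') fact
  then have "((\<lambda>t. if t \<in> {0<..} then of_real t powr (\<kappa> - 1) / complex_of_real (exp t) else 0) has_integral Gamma \<kappa>) UNIV"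
    by (subst has_integral_restrict_UNIV)
  also have "(\<lambda>t. if t \<in> {0<..} then of_real t powr (\<kappa> - 1) / complex_of_real (exp t) else 0) =
     (\<lambda>t. mellin_kernel \<kappa> t * of_real (exp (- t)))"
    by (auto simp: fun_eq_iff mellin_kernel_eq_powr mellin_kernel_def exp_minus field_simps powr_def Ln_of_real)
  finally show ?thesis
    using has_integral_integral_lborel [OF int] has_integral_unique by blast
qed

lemma integrable_mellin_bounded:
  assumes "0 < Re \<kappa>" "0 < c" and [measurable]: "f \<in> borel_measurable borel"
    and "\<And>t. 0 < t \<Longrightarrow> cmod (f t) \<le> C * exp (- c * t)"
  shows "integrable lborel (\<lambda>t. mellin_kernel \<kappa> t * f t)"
proof (rule Bochner_Integration.integrable_bound)
  show "integrable lborel (\<lambda>t. of_real C * (mellin_kernel \<kappa> t * of_real (exp (- c * t))))"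
    by (intro integrable_mult_right integrable_mellin_exp assms)
  have "cmod (f t) \<le> \<bar>C\<bar> * exp (- c * t)" if "0 < t" for t
    using assms(4)[OF that] by (rule order_trans) (auto intro: mult_right_mono)
  then show "AE t in lborel. cmod (mellin_kernel \<kappa> t * f t) \<le>
      cmod (of_real C * (mellin_kernel \<kappa> t * of_real (exp (- c * t))))"
    by (intro AE_I2) (auto simp: norm_mult norm_mellin_kernel mult.left_commute mult_left_mono)
qed measurable

section \<open>The Gaussian Mellin integral as an entire function\<close>

definition gauss_mellin :: "complex \<Rightarrow> complex \<Rightarrow> complex" where
  "gauss_mellin \<kappa> z = (LINT t|lborel. mellin_kernel \<kappa> t * exp (- (of_real t)\<^sup>2 / 2 - z * of_real t))"

lemma Re_gauss_exponent [simp]: "Re (- (complex_of_real t)\<^sup>2 / 2 - z * of_real t) = - t\<^sup>2 / 2 - Re z * t"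
  by (simp flip: of_real_power)

text \<open>Completing the square around 1 - Re z trades the Gaussian for plain exponential decay,
  so the Gamma integral dominates for every complex z.\<close>

lemma gauss_exp_bound:
  "cmod (exp (- (of_real t)\<^sup>2 / 2 - z * of_real t)) \<le> exp ((1 - Re z)\<^sup>2 / 2) * exp (- t)"
proof -
  have "0 \<le> (t - (1 - Re z))\<^sup>2 / 2" by simp
  then have "- t\<^sup>2 / 2 - Re z * t \<le> (1 - Re z)\<^sup>2 / 2 - t"
    by (simp add: power2_eq_square algebra_simps)
  then show ?thesis
    unfolding norm_exp_eq_Re Re_gauss_exponent exp_add [symmetric] by simp
qed

lemma integrable_gauss_mellin:
  assumes "0 < Re \<kappa>"
  shows "integrable lborel (\<lambda>t. mellin_kernel \<kappa> t * exp (- (of_real t)\<^sup>2 / 2 - z * of_real t))"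
  using gauss_exp_bound [of _ z]
  by (intro integrable_mellin_bounded [OF assms zero_less_one, where C = "exp ((1 - Re z)\<^sup>2 / 2)"]) (auto, measurable)

text \<open>A quadratic remainder replaces differentiation under the integral. With w = -h t, the
  Taylor bound for exp w - 1 - w has the factor |h|^2 t^2, which raises \<kappa> by 2, and the
  factor exp |Re w|, at most exp t for |h| at most 1, which is absorbed by passing from z to z -
  1.\<close>

lemma gauss_mellin_increment_bound:
  assumes "0 < Re \<kappa>" "cmod h \<le> 1"
  shows "cmod (gauss_mellin \<kappa> (z + h) - gauss_mellin \<kappa> z + h * gauss_mellin (\<kappa> + 1) z)
    \<le> (cmod h)\<^sup>2 * (LINT t|lborel. cmod (mellin_kernel (\<kappa> + 1 + 1) t * exp (- (of_real t)\<^sup>2 / 2 - (z - 1) * of_real t)))"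
proof -
  define E where "E z t = exp (- (complex_of_real t)\<^sup>2 / 2 - z * of_real t)" for z t
  note int = integrable_gauss_mellin [folded E_def]
  have "gauss_mellin \<kappa> (z + h) - gauss_mellin \<kappa> z + h * gauss_mellin (\<kappa> + 1) z =
    (LINT t|lborel. mellin_kernel \<kappa> t * E (z + h) t - mellin_kernel \<kappa> t * E z t + h * (mellin_kernel (\<kappa> + 1) t * E z t))"
    unfolding gauss_mellin_def E_def [symmetric] using assms(1)
    by (simp add: int)
  also have "cmod \<dots> \<le> (LINT t|lborel. (cmod h)\<^sup>2 * cmod (mellin_kernel (\<kappa> + 1 + 1) t * E (z - 1) t))"
  proof (rule order_trans [OF integral_norm_bound integral_mono])
    show "cmod (mellin_kernel \<kappa> t * E (z + h) t - mellin_kernel \<kappa> t * E z t + h * (mellin_kernel (\<kappa> + 1) t * E z t))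
      \<le> (cmod h)\<^sup>2 * cmod (mellin_kernel (\<kappa> + 1 + 1) t * E (z - 1) t)" for t
    proof (cases "0 < t")
      case True
      define w where "w = - h * of_real t"
      have "E (z + h) t = E z t * exp w"
        unfolding E_def w_def exp_add [symmetric] by (rule arg_cong [of _ _ exp]) (simp add: field_simps)
      then have "mellin_kernel \<kappa> t * E (z + h) t - mellin_kernel \<kappa> t * E z t + h * (mellin_kernel (\<kappa> + 1) t * E z t)
        = mellin_kernel \<kappa> t * E z t * (exp w - (\<Sum>k\<le>1. w ^ k / fact k))"
        unfolding mellin_kernel_Suc by (simp add: w_def algebra_simps)
      also have "cmod \<dots> \<le> cmod (mellin_kernel \<kappa> t) * cmod (E z t) * (exp \<bar>Re w\<bar> * cmod w ^ 2)"
        unfolding norm_mult using Taylor_exp [of w 1]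
        by (intro mult_left_mono) (auto simp: numeral_2_eq_2)
      also have "\<dots> \<le> cmod (mellin_kernel \<kappa> t) * cmod (E z t) * (exp t * cmod w ^ 2)"
      proof -
        have "\<bar>Re w\<bar> \<le> cmod w" by (rule abs_Re_le_cmod)
        also have "\<dots> \<le> 1 * t" using assms(2) True unfolding w_def norm_mult by (intro mult_mono) auto
        finally show ?thesis by (intro mult_left_mono mult_right_mono) auto
      qed
      also have "\<dots> = (cmod h)\<^sup>2 * cmod (mellin_kernel (\<kappa> + 1 + 1) t * E (z - 1) t)"
      proof -
        have "cmod (E (z - 1) t) = cmod (E z t) * exp t"
          unfolding E_def norm_exp_eq_Re Re_gauss_exponent by (simp add: exp_add [symmetric] algebra_simps)
        then show ?thesis using True
          by (simp add: mellin_kernel_Suc mellin_kernel_add_simps norm_mult w_def power2_eq_square)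
      qed
      finally show ?thesis .
    qed (simp add: mellin_kernel_def)
  qed (use assms(1) in \<open>intro integrable_mult_right integrable_norm Bochner_Integration.integrable_add Bochner_Integration.integrable_diff int; simp\<close>)+
  finally show ?thesis by (simp add: E_def)
qed

lemma gauss_mellin_has_field_derivative:
  assumes "0 < Re \<kappa>"
  shows "(gauss_mellin \<kappa> has_field_derivative - gauss_mellin (\<kappa> + 1) z) (at z)"
proof -
  define B where "B = (LINT t|lborel. cmod (mellin_kernel (\<kappa> + 1 + 1) t * exp (- (of_real t)\<^sup>2 / 2 - (z - 1) * of_real t)))"
  have "((\<lambda>h. (gauss_mellin \<kappa> (z + h) - gauss_mellin \<kappa> z) / h - - gauss_mellin (\<kappa> + 1) z) \<longlongrightarrow> 0) (at 0)"
  proof (rule Lim_null_comparison)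
    show "\<forall>\<^sub>F h in at 0. cmod ((gauss_mellin \<kappa> (z + h) - gauss_mellin \<kappa> z) / h - - gauss_mellin (\<kappa> + 1) z) \<le> cmod h * B"
    proof -
      have *: "cmod ((gauss_mellin \<kappa> (z + h) - gauss_mellin \<kappa> z) / h - - gauss_mellin (\<kappa> + 1) z) \<le> cmod h * B"
        if h: "h \<noteq> 0" "cmod h \<le> 1" for h
      proof -
        have "(gauss_mellin \<kappa> (z + h) - gauss_mellin \<kappa> z) / h - - gauss_mellin (\<kappa> + 1) z =
          (gauss_mellin \<kappa> (z + h) - gauss_mellin \<kappa> z + h * gauss_mellin (\<kappa> + 1) z) / h"
          using h by (simp add: field_simps)
        also have "cmod \<dots> \<le> (cmod h)\<^sup>2 * B / cmod h"
          unfolding norm_divide B_def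
          by (intro divide_right_mono gauss_mellin_increment_bound assms h) auto
        also have "\<dots> = cmod h * B" using h by (simp add: power2_eq_square)
        finally show ?thesis .
      qed
      show ?thesis
        using * unfolding eventually_at by (intro exI [of _ 1]) (auto simp: dist_norm)
    qed
    show "((\<lambda>h. cmod h * B) \<longlongrightarrow> 0) (at 0)"
      by (auto intro!: tendsto_eq_intros)
  qed
  then show ?thesis
    unfolding DERIV_def by (rule LIM_zero_cancel)
qed

lemmas gauss_mellin_derivative [derivative_intros] =
  DERIV_chain2 [OF gauss_mellin_has_field_derivative]

lemma mellin_kernel_Suc_tendsto_0:
  assumes "0 < Re \<kappa>"
  shows "((\<lambda>t. mellin_kernel (\<kappa> + 1) t) \<longlongrightarrow> 0) (at_right 0)"
proof (rule tendsto_norm_zero_cancel)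
  have "((\<lambda>t. t powr Re \<kappa>) \<longlongrightarrow> 0) (at_right 0)"
    using assms by real_asymp
  then show "((\<lambda>t. cmod (mellin_kernel (\<kappa> + 1) t)) \<longlongrightarrow> 0) (at_right 0)"
    by (rule Lim_transform_eventually)
       (auto simp: norm_mellin_kernel eventually_at_right_field intro: exI [of _ 1])
qed

lemma mellin_kernel_has_vector_derivative:
  assumes "0 < t"
  shows "(mellin_kernel (\<kappa> + 1) has_vector_derivative \<kappa> * mellin_kernel \<kappa> t) (at t)"
proof -
  have "((\<lambda>t. \<kappa> * of_real (ln t)) has_vector_derivative \<kappa> * of_real (inverse t)) (at t)"
    using assms by (intro has_vector_derivative_mult_right has_vector_derivative_of_real)
      (auto intro!: derivative_eq_intros simp: inverse_eq_divide has_real_derivative_iff_has_vector_derivative [symmetric])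
  from field_vector_diff_chain_at [OF this DERIV_exp]
  have "((\<lambda>t. exp (\<kappa> * of_real (ln t))) has_vector_derivative \<kappa> * of_real (inverse t) * exp (\<kappa> * of_real (ln t))) (at t)"
    by (simp add: o_def)
  also have "exp (\<kappa> * of_real (ln t)) = mellin_kernel (\<kappa> + 1) t"
    using assms by (simp add: mellin_kernel_def)
  also have "\<kappa> * of_real (inverse t) * mellin_kernel (\<kappa> + 1) t = \<kappa> * mellin_kernel \<kappa> t"
    using assms by (simp add: mellin_kernel_Suc mellin_kernel_add_simps field_simps)
  finally show ?thesis
    by (rule has_vector_derivative_transform_within_open [where S = "{0<..}"])
       (use assms in \<open>auto simp: mellin_kernel_def\<close>)
qed

lemma isCont_mellin_kernel [continuous_intros]:
  assumes "0 < t" shows "isCont (mellin_kernel \<kappa>) t"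
  using mellin_kernel_has_vector_derivative [OF assms, of "\<kappa> - 1"]
  by (auto intro: has_vector_derivative_continuous)

text \<open>Integration by parts without boundary terms. The end point \<open>B\<close> may be
  infinite, for the Gaussian and for positive steps, or finite, for the truncated kernels with
  negative step.\<close>

lemma integral_vector_derivative_eq_0:
  fixes F f :: "real \<Rightarrow> complex" and B :: ereal
  assumes B: "0 < B"
    and deriv: "\<And>t. 0 < t \<Longrightarrow> ereal t < B \<Longrightarrow> (F has_vector_derivative f t) (at t)"
    and cont: "\<And>t. 0 < t \<Longrightarrow> ereal t < B \<Longrightarrow> isCont f t"
    and outside: "\<And>t. \<not> (0 < t \<and> ereal t < B) \<Longrightarrow> f t = 0"
    and int: "integrable lborel f"
    and lim0: "(F \<longlongrightarrow> 0) (at_right 0)"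
    and limB: "((F \<circ> real_of_ereal) \<longlongrightarrow> 0) (at_left B)"
  shows "(LINT t|lborel. f t) = 0"
proof -
  have eq: "indicator (einterval 0 B) t *\<^sub>R f t = f t" for t
    using outside [of t] by (auto simp: einterval_def indicator_def)
  have "(LBINT t=0..B. f t) = 0 - 0"
  proof (rule interval_integral_FTC_integrable [OF B])
    show "set_integrable lborel (einterval 0 B) f"
      using int by (simp add: set_integrable_def eq)
    show "((F \<circ> real_of_ereal) \<longlongrightarrow> 0) (at_right 0)"
      using lim0 by (simp add: zero_ereal_def ereal_tendsto_simps)
  qed (use deriv cont limB in \<open>auto simp: zero_ereal_def\<close>)
  then show ?thesis
    using B by (simp add: less_imp_le interval_lebesgue_integral_def set_lebesgue_integral_def eq)
qed

text \<open>Integrates the derivative of t^\<kappa> exp (-t^2/2 - z t), which vanishes at both ends.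
  Since differentiation in z raises \<kappa> by 1, this is a second-order differential equation for
  \<open>gauss_mellin \<kappa>\<close>.\<close>

lemma gauss_mellin_recurrence:
  assumes "0 < Re \<kappa>"
  shows "gauss_mellin (\<kappa> + 2) z + z * gauss_mellin (\<kappa> + 1) z = \<kappa> * gauss_mellin \<kappa> z"
proof -
  define E where "E t = exp (- (complex_of_real t)\<^sup>2 / 2 - z * of_real t)" for t
  have dE: "(E has_vector_derivative E t * (- of_real t - z)) (at t)" for t
  proof -
    have "((\<lambda>w. exp (- w\<^sup>2 / 2 - z * w)) has_field_derivative E t * (- of_real t - z)) (at (of_real t))"
      unfolding E_def by (auto intro!: derivative_eq_intros)
    then show ?thesis
      unfolding E_def by (rule has_vector_derivative_real_field)
  qed
  note int = integrable_gauss_mellin [of _ z, folded E_def]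
  let ?f = "\<lambda>t. \<kappa> * (mellin_kernel \<kappa> t * E t) - mellin_kernel (\<kappa> + 1 + 1) t * E t - z * (mellin_kernel (\<kappa> + 1) t * E t)"
  have "(LINT t|lborel. ?f t) = 0"
  proof (rule integral_vector_derivative_eq_0 [of \<infinity>])
    show "((\<lambda>t. mellin_kernel (\<kappa> + 1) t * E t) has_vector_derivative ?f t) (at t)" if "0 < t" for t
      using mellin_kernel_has_vector_derivative [OF that, of \<kappa>] dE [of t]
      by (rule has_vector_derivative_eq_rhs [OF has_vector_derivative_mult]) (simp add: mellin_kernel_Suc mellin_kernel_add_simps algebra_simps)
    show "isCont ?f t" if "0 < t" for t
      using that has_vector_derivative_continuous [OF dE [of t]]
      by (intro continuous_intros) auto
    show "integrable lborel ?f"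
      using assms by (intro Bochner_Integration.integrable_diff integrable_mult_right int) auto
    have bound: "cmod (mellin_kernel (\<kappa> + 1) t * E t) \<le> exp ((1 - Re z)\<^sup>2 / 2) * (t powr Re \<kappa> * exp (- t))" if "0 < t" for t
      using mult_left_mono [OF gauss_exp_bound [of t z, folded E_def], of "t powr Re \<kappa>"] that
      by (simp add: norm_mult norm_mellin_kernel mult_ac)
    have "((\<lambda>t. mellin_kernel (\<kappa> + 1) t * E t) \<longlongrightarrow> 0) at_top"
    proof (rule Lim_null_comparison)
      show "\<forall>\<^sub>F t in at_top. cmod (mellin_kernel (\<kappa> + 1) t * E t) \<le> exp ((1 - Re z)\<^sup>2 / 2) * (t powr Re \<kappa> * exp (- t))"
        using eventually_gt_at_top [of 0] by eventually_elim (rule bound)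
      have "((\<lambda>t. t powr Re \<kappa> * exp (- t)) \<longlongrightarrow> 0) at_top"
        using assms by real_asymp
      then show "((\<lambda>t. exp ((1 - Re z)\<^sup>2 / 2) * (t powr Re \<kappa> * exp (- t))) \<longlongrightarrow> 0) at_top"
        by (rule tendsto_mult_right_zero)
    qed
    then show "(((\<lambda>t. mellin_kernel (\<kappa> + 1) t * E t) \<circ> real_of_ereal) \<longlongrightarrow> 0) (at_left \<infinity>)"
      by (simp add: ereal_tendsto_simps)
    have "(E \<longlongrightarrow> E 0) (at_right 0)"
      using has_vector_derivative_continuous [OF dE [of 0]]
      by (auto simp: isCont_def intro: filterlim_mono [OF _ _ at_le])
    then show "((\<lambda>t. mellin_kernel (\<kappa> + 1) t * E t) \<longlongrightarrow> 0) (at_right 0)"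
      using tendsto_mult [OF mellin_kernel_Suc_tendsto_0 [OF assms]] by fastforce
    show "?f t = 0" if "\<not> (0 < t \<and> ereal t < \<infinity>)" for t
      using that by (simp add: mellin_kernel_def)
  qed auto
  then have "\<kappa> * gauss_mellin \<kappa> z - gauss_mellin (\<kappa> + 1 + 1) z - z * gauss_mellin (\<kappa> + 1) z = 0"
    unfolding gauss_mellin_def E_def [symmetric] using assms by (simp add: int)
  then show ?thesis by (simp add: algebra_simps)
qed

text \<open>After the substitution t / x the Gaussian factor tends to 1 and only the Gamma integral
  is left. This provides the normalisation of the parabolic cylinder function.\<close>

lemma gauss_mellin_at_top:
  assumes "0 < Re \<kappa>"
  shows "((\<lambda>x::real. of_real x powr \<kappa> * gauss_mellin \<kappa> (of_real x)) \<longlongrightarrow> Gamma \<kappa>) at_top"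
proof -
  let ?s = "\<lambda>x t. mellin_kernel \<kappa> t * of_real (exp (- (t / x)\<^sup>2 / 2 - t))"
  have "of_real x powr \<kappa> * gauss_mellin \<kappa> (of_real x) = (LINT t|lborel. ?s x t)" if x: "0 < x" for x
  proof -
    have "gauss_mellin \<kappa> (of_real x) = \<bar>inverse x\<bar> *\<^sub>R (LINT t|lborel. mellin_kernel \<kappa> (0 + inverse x * t)
        * exp (- (complex_of_real (0 + inverse x * t))\<^sup>2 / 2 - of_real x * of_real (0 + inverse x * t)))"
      unfolding gauss_mellin_def using x by (intro lborel_integral_real_affine) auto
    also have "(\<lambda>t. mellin_kernel \<kappa> (0 + inverse x * t)
        * exp (- (complex_of_real (0 + inverse x * t))\<^sup>2 / 2 - of_real x * of_real (0 + inverse x * t)))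
        = (\<lambda>t. exp (- (\<kappa> - 1) * of_real (ln x)) * ?s x t)" (is "?l = ?r")
    proof
      fix t
      have "complex_of_real (exp (- (t / x)\<^sup>2 / 2 - t)) =
        exp (- (complex_of_real (0 + inverse x * t))\<^sup>2 / 2 - of_real x * of_real (0 + inverse x * t))"
        using x by (simp flip: exp_of_real add: field_simps)
      moreover have "mellin_kernel \<kappa> (0 + inverse x * t) = exp (- (\<kappa> - 1) * of_real (ln x)) * mellin_kernel \<kappa> t"
        using x by (auto simp: mellin_kernel_def ln_mult ln_inverse exp_add [symmetric] zero_less_mult_iff algebra_simps)
      ultimately show "?l t = ?r t" by simp
    qed
    also have "\<bar>inverse x\<bar> *\<^sub>R (LINT t|lborel. exp (- (\<kappa> - 1) * of_real (ln x)) * ?s x t) =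
      inverse (of_real x) * exp (- (\<kappa> - 1) * of_real (ln x)) * (LINT t|lborel. ?s x t)"
      using x by (simp add: scaleR_conv_of_real)
    also have "inverse (of_real x) * exp (- (\<kappa> - 1) * of_real (ln x)) = exp (- \<kappa> * of_real (ln x))"
    proof -
      have "inverse (complex_of_real x) = exp (- of_real (ln x))"
        using x by (simp add: exp_minus exp_of_real)
      then show ?thesis by (simp add: exp_add [symmetric] algebra_simps)
    qed
    finally show ?thesis
      using x by (simp add: powr_def Ln_of_real exp_minus)
  qed
  moreover have "((\<lambda>x. LINT t|lborel. ?s x t) \<longlongrightarrow> (LINT t|lborel. mellin_kernel \<kappa> t * of_real (exp (- t)))) at_top"
  proof (rule integral_dominated_convergence_at_top)
    show "integrable lborel (\<lambda>t. cmod (mellin_kernel \<kappa> t * of_real (exp (- 1 * t))))"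
      by (intro integrable_norm integrable_mellin_exp assms) auto
    show "\<forall>\<^sub>F x in at_top. AE t in lborel. cmod (?s x t) \<le> cmod (mellin_kernel \<kappa> t * of_real (exp (- 1 * t)))"
      by (intro always_eventually allI AE_I2) (auto simp: norm_mult intro!: mult_left_mono)
    show "AE t in lborel. ((\<lambda>x. ?s x t) \<longlongrightarrow> mellin_kernel \<kappa> t * of_real (exp (- t))) at_top"
    proof (intro AE_I2 tendsto_mult tendsto_const tendsto_of_real)
      fix t :: real
      have "((\<lambda>x. t / x) \<longlongrightarrow> 0) at_top" by real_asymp
      from tendsto_exp [OF tendsto_diff [OF tendsto_divide [OF tendsto_minus [OF tendsto_power [OF this, of 2]] tendsto_const [of 2]] tendsto_const [of t]]]
      show "((\<lambda>x. exp (- (t / x)\<^sup>2 / 2 - t)) \<longlongrightarrow> exp (- t)) at_top" by simp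
    qed
  qed measurable
  ultimately show ?thesis
    unfolding integral_mellin_exp [OF assms]
    by (auto intro: Lim_transform_eventually [OF _ eventually_mono [OF eventually_gt_at_top [of 0]]])
qed

text \<open>The substitution u = t^2 / 2 turns the Gaussian integral into a Gamma integral at
  \<kappa> / 2.\<close>

lemma gauss_mellin_0:
  assumes "0 < Re \<kappa>"
  shows "gauss_mellin \<kappa> 0 = exp ((\<kappa> / 2 - 1) * of_real (ln 2)) * Gamma (\<kappa> / 2)"
proof -
  let ?k = "\<kappa> / 2"
  have k: "0 < Re ?k" using assms by simp
  let ?f = "\<lambda>u. mellin_kernel ?k u * of_real (exp (- u))"
  have ind: "indicator (einterval 0 \<infinity>) t *\<^sub>R g t = g t" if "\<And>t. t \<le> 0 \<Longrightarrow> g t = 0" for g :: "real \<Rightarrow> complex" and t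
    using that [of t] by (auto simp: einterval_def indicator_def)
  have key: "t *\<^sub>R ?f (t\<^sup>2 / 2) = exp (- (?k - 1) * of_real (ln 2)) * (mellin_kernel \<kappa> t * exp (- (of_real t)\<^sup>2 / 2 - 0 * of_real t))" (is "?l t = ?r t")
    if "0 < t" for t
  proof -
    have "complex_of_real (exp (- (t\<^sup>2 / 2))) = exp (- (of_real t)\<^sup>2 / 2 - 0 * of_real t)"
      by (simp flip: exp_of_real)
    moreover have "of_real t * mellin_kernel ?k (t\<^sup>2 / 2) = exp (- (?k - 1) * of_real (ln 2)) * mellin_kernel \<kappa> t"
    proof -
      have "complex_of_real t = exp (of_real (ln t))"
        using that by (subst exp_of_real) simp
      then show ?thesis using that
        by (simp add: mellin_kernel_def ln_div ln_realpow exp_add [symmetric] algebra_simps)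
    qed
    ultimately show ?thesis by (simp add: scaleR_conv_of_real)
  qed
  have "Gamma ?k = (LBINT u=0..\<infinity>. ?f u)"
    unfolding integral_mellin_exp [OF k, symmetric] interval_lebesgue_integral_def set_lebesgue_integral_def
    by (subst ind) (auto simp: mellin_kernel_def)
  also have "\<dots> = (LBINT t=0..\<infinity>. t *\<^sub>R ?f (t\<^sup>2 / 2))"
  proof (rule interval_integral_substitution_integrable)
    show "((\<lambda>t. t\<^sup>2 / 2) has_real_derivative t) (at t)" for t :: real
      by (auto intro!: derivative_eq_intros)
    show "isCont ?f (t\<^sup>2 / 2)" if "0 < ereal t" for t
      using that by (intro continuous_intros) (auto simp: zero_ereal_def)
    have "((\<lambda>t::real. t\<^sup>2 / 2) \<longlongrightarrow> 0) (at_right 0)" by real_asymp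
    then show "((ereal \<circ> (\<lambda>t. t\<^sup>2 / 2) \<circ> real_of_ereal) \<longlongrightarrow> 0) (at_right 0)"
      by (simp add: zero_ereal_def ereal_tendsto_simps)
    have "filterlim (\<lambda>t::real. t\<^sup>2 / 2) at_top at_top" by real_asymp
    then show "((ereal \<circ> (\<lambda>t. t\<^sup>2 / 2) \<circ> real_of_ereal) \<longlongrightarrow> \<infinity>) (at_left \<infinity>)"
      by (simp add: ereal_tendsto_simps)
    show "set_integrable lborel (einterval 0 \<infinity>) ?f"
      unfolding set_integrable_def using integrable_mellin_exp [OF k, of 1]
      by (subst ind) (auto simp: mellin_kernel_def)
    have "set_integrable lborel (einterval 0 \<infinity>) ?r"
      unfolding set_integrable_def using integrable_gauss_mellin [OF assms, of 0]
      by (subst ind) (auto simp: mellin_kernel_def)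
    then show "set_integrable lborel (einterval 0 \<infinity>) (\<lambda>t. t *\<^sub>R ?f (t\<^sup>2 / 2))"
      by (rule set_integrable_cong [THEN iffD1, rotated -1]) (auto simp: einterval_def key zero_ereal_def)
  qed (auto simp: zero_ereal_def)
  also have "\<dots> = (LINT t|lborel. ?r t)"
    unfolding interval_lebesgue_integral_def set_lebesgue_integral_def

  proof (subst if_P, simp, rule Bochner_Integration.integral_cong [OF refl])
    fix t :: real
    show "indicator (einterval 0 \<infinity>) t *\<^sub>R (t *\<^sub>R ?f (t\<^sup>2 / 2)) = ?r t"
    proof (cases "0 < t")
      case True
      then have "t \<in> einterval 0 \<infinity>" by (simp add: einterval_def)
      then show ?thesis using key [OF True] by (simp only: indicator_simps) simp
    qed (simp add: einterval_def mellin_kernel_def)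
  qed
  also have "\<dots> = exp (- (?k - 1) * of_real (ln 2)) * gauss_mellin \<kappa> 0"
    by (simp add: gauss_mellin_def)
  finally show ?thesis
    by (simp add: exp_minus field_simps flip: exp_add)
qed

text \<open>By the recurrence at z and at -z, the left side times exp (-z^2/2) has derivative 0. The
  constant is read off at z = 0, where Legendre duplication merges the Gamma values at \<kappa>/2
  and (\<kappa>+1)/2 into Gamma \<kappa>.\<close>

lemma gauss_mellin_wronskian:
  assumes "0 < Re \<kappa>"
  shows "gauss_mellin \<kappa> z * gauss_mellin (\<kappa> + 1) (- z) + gauss_mellin (\<kappa> + 1) z * gauss_mellin \<kappa> (- z)
    = of_real (sqrt (2 * pi)) * Gamma \<kappa> * exp (z\<^sup>2 / 2)"
proof -
  let ?W = "\<lambda>z. gauss_mellin \<kappa> z * gauss_mellin (\<kappa> + 1) (- z) + gauss_mellin (\<kappa> + 1) z * gauss_mellin \<kappa> (- z)"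
  have k: "0 < Re (\<kappa> + 1)" using assms by simp
  have "((\<lambda>z. ?W z * exp (- z\<^sup>2 / 2)) has_field_derivative 0) (at z)" for z
  proof -
    have "((\<lambda>z. ?W z * exp (- z\<^sup>2 / 2)) has_field_derivative
       exp (- z\<^sup>2 / 2) * (gauss_mellin \<kappa> z * gauss_mellin (\<kappa> + 2) (- z) - gauss_mellin (\<kappa> + 2) z * gauss_mellin \<kappa> (- z) - z * ?W z)) (at z)"
      using assms k by (auto intro!: derivative_eq_intros simp: field_simps)
    moreover have "gauss_mellin (\<kappa> + 2) (- z) = \<kappa> * gauss_mellin \<kappa> (- z) + z * gauss_mellin (\<kappa> + 1) (- z)"
      "gauss_mellin (\<kappa> + 2) z = \<kappa> * gauss_mellin \<kappa> z - z * gauss_mellin (\<kappa> + 1) z"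
      using gauss_mellin_recurrence [OF assms, of "- z"] gauss_mellin_recurrence [OF assms, of z]
      by (simp_all add: algebra_simps)
    ultimately show ?thesis by (simp add: algebra_simps)
  qed
  then obtain c where c: "?W z * exp (- z\<^sup>2 / 2) = c" for z
    using has_field_derivative_zero_constant [of UNIV "\<lambda>z. ?W z * exp (- z\<^sup>2 / 2)"] by auto
  have "c = 2 * (gauss_mellin \<kappa> 0 * gauss_mellin (\<kappa> + 1) 0)"
    using c [of 0] by (simp add: mult_ac)
  also have "gauss_mellin \<kappa> 0 * gauss_mellin (\<kappa> + 1) 0 =
     exp ((\<kappa> - 3 / 2) * of_real (ln 2)) * (Gamma (\<kappa> / 2) * Gamma (\<kappa> / 2 + 1 / 2))"
  proof -
    have "exp ((\<kappa> / 2 - 1) * of_real (ln 2)) * exp (((\<kappa> + 1) / 2 - 1) * of_real (ln 2)) = exp ((\<kappa> - 3 / 2) * complex_of_real (ln 2))"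
      unfolding exp_add [symmetric] by (rule arg_cong [of _ _ exp]) (simp add: field_simps)
    then show ?thesis
      unfolding gauss_mellin_0 [OF assms] gauss_mellin_0 [OF k] by (simp add: add_divide_distrib mult_ac)
  qed
  also have "Gamma (\<kappa> / 2) * Gamma (\<kappa> / 2 + 1 / 2) =
     exp ((1 - 2 * (\<kappa> / 2)) * of_real (ln 2)) * of_real (sqrt pi) * Gamma (2 * (\<kappa> / 2))"
    using assms by (intro Gamma_legendre_duplication) (auto elim!: nonpos_Ints_cases simp: complex_eq_iff)
  also have "2 * (exp ((\<kappa> - 3 / 2) * of_real (ln 2)) * (exp ((1 - 2 * (\<kappa> / 2)) * of_real (ln 2)) * of_real (sqrt pi) * Gamma (2 * (\<kappa> / 2))))
     = (2 * exp (- (1 / 2) * of_real (ln 2))) * of_real (sqrt pi) * Gamma \<kappa>"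
    by (simp add: exp_add [symmetric] field_simps)
  also have "2 * exp (- (1 / 2) * complex_of_real (ln 2)) = of_real (sqrt 2)"
  proof -
    have "exp (- (1 / 2) * complex_of_real (ln 2)) = of_real (exp (- (1 / 2) * ln 2))"
      by (simp flip: exp_of_real)
    also have "exp (- (1 / 2) * ln 2) = 1 / sqrt (2::real)"
    proof -
      have "- (1 / 2) * ln 2 = - ln (sqrt (2::real))" by (simp add: ln_sqrt)
      then show ?thesis by (simp only: exp_minus) (simp add: inverse_eq_divide)
    qed
    finally have "2 * exp (- (1 / 2) * complex_of_real (ln 2)) = of_real (2 / sqrt 2)" by simp
    then show ?thesis by (simp only: real_div_sqrt)
  qed
  finally show ?thesis
    using c [of z] unfolding minus_divide_left [symmetric] exp_minus
    by (simp add: field_simps real_sqrt_mult)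
qed

section \<open>Parabolic cylinder functions of negative index\<close>

text \<open>A Taylor step of length 1 expresses f'(x) through f(x + 1), f(x) and a remainder
  controlled by f''. It is needed because the normalisation of a parabolic cylinder function says
  nothing about its derivative.\<close>

lemma tendsto_deriv_0_of_tendsto_0:
  fixes f :: "complex \<Rightarrow> complex"
  assumes f: "f holomorphic_on UNIV"
    and lim: "((\<lambda>x::real. f (of_real x)) \<longlongrightarrow> 0) at_top"
    and lim2: "((\<lambda>x::real. deriv (deriv f) (of_real x)) \<longlongrightarrow> 0) at_top"
  shows "((\<lambda>x::real. deriv f (of_real x)) \<longlongrightarrow> 0) at_top"
proof (rule tendstoI)
  fix e :: real assume "0 < e"
  then have e: "0 < e / 3" by simp
  obtain X where X: "\<And>x. X \<le> x \<Longrightarrow> cmod (f (of_real x)) < e / 3" "\<And>x. X \<le> x \<Longrightarrow> cmod (deriv (deriv f) (of_real x)) < e / 3"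
  proof -
    have "\<forall>\<^sub>F x in at_top. cmod (f (of_real x)) < e / 3 \<and> cmod (deriv (deriv f) (of_real x)) < e / 3"
      using tendstoD [OF lim e] tendstoD [OF lim2 e] by eventually_elim auto
    then show thesis using that by (auto simp: eventually_at_top_linorder)
  qed
  have D1: "(f has_field_derivative deriv f z) (at z)" for z
    using f by (auto intro: holomorphic_derivI)
  have D2: "(deriv f has_field_derivative deriv (deriv f) z) (at z)" for z
    using holomorphic_deriv [OF f open_UNIV] by (auto intro: holomorphic_derivI)
  show "\<forall>\<^sub>F x in at_top. dist (deriv f (of_real x)) 0 < e"
    using eventually_ge_at_top [of X]
  proof eventually_elim
    case (elim x)
    define \<phi> where "\<phi> i = (case i of 0 \<Rightarrow> f | Suc 0 \<Rightarrow> deriv f | _ \<Rightarrow> deriv (deriv f))" for i :: nat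
    let ?S = "closed_segment (complex_of_real x) (of_real (x + 1))"
    have "cmod (\<phi> 0 (of_real (x + 1)) - (\<Sum>i\<le>1. \<phi> i (of_real x) * (of_real (x + 1) - of_real x) ^ i / fact i))
      \<le> e / 3 * cmod (of_real (x + 1) - of_real x) ^ Suc 1 / fact 1"
    proof (rule field_Taylor [of ?S])
      show "(\<phi> i has_field_derivative \<phi> (Suc i) z) (at z within ?S)" if "i \<le> 1" for z i
        using that D1 D2 by (cases i) (auto simp: \<phi>_def intro: has_field_derivative_at_within)
      show "cmod (\<phi> (Suc 1) z) \<le> e / 3" if z: "z \<in> ?S" for z
      proof -
        obtain u where "0 \<le> u" "u \<le> 1" "z = of_real (x + u)"
          using z by (auto simp: in_segment scaleR_conv_of_real algebra_simps)
        then show ?thesis using X(2) [of "x + u"] elim by (simp add: \<phi>_def)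
      qed
    qed auto
    then have "cmod (f (of_real (x + 1)) - f (of_real x) - deriv f (of_real x)) \<le> e / 3"
      by (simp add: \<phi>_def diff_diff_eq)
    moreover have "cmod (f (of_real (x + 1))) < e / 3" "cmod (f (of_real x)) < e / 3"
      using X(1) [of x] X(1) [of "x + 1"] elim by simp_all
    moreover have "deriv f (of_real x) = f (of_real (x + 1)) - f (of_real x) - (f (of_real (x + 1)) - f (of_real x) - deriv f (of_real x))"
      by simp
    then have "cmod (deriv f (of_real x)) \<le> cmod (f (of_real (x + 1))) + cmod (f (of_real x)) + cmod (f (of_real (x + 1)) - f (of_real x) - deriv f (of_real x))"
      by (metis norm_triangle_ineq4 order_trans add_right_mono)
    ultimately show ?case by simp
  qed
qed

text \<open>Asymptotic equivalence reads 0 / 0 as 1. The comparison function has no zero for x > 0,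
  so the plain quotient has the same limit.\<close>

lemma parabolic_cylinder_ratio:
  assumes "is_parabolic_cylinder p f"
  shows "((\<lambda>x::real. f (of_real x) / (of_real x powr p * exp (- (of_real x)\<^sup>2 / 4))) \<longlongrightarrow> 1) at_top"
proof -
  have "((\<lambda>x::real. if f (of_real x) = 0 \<and> of_real x powr p * exp (- (of_real x)\<^sup>2 / 4) = 0 then 1
      else f (of_real x) / (of_real x powr p * exp (- (of_real x)\<^sup>2 / 4))) \<longlongrightarrow> 1) at_top"
    using assms unfolding is_parabolic_cylinder_def asymp_equiv_def by blast
  then show ?thesis
    by (rule Lim_transform_eventually) (use eventually_gt_at_top [of 0] in eventually_elim, auto)
qed

text \<open>The Gaussian factor beats every polynomial, so f and, through the differential equation,
  f'' tend to 0; the derivative in between follows.\<close>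

lemma parabolic_cylinder_tendsto_0:
  assumes f: "is_parabolic_cylinder p f"
  shows "((\<lambda>x::real. f (of_real x)) \<longlongrightarrow> 0) at_top"
    and "((\<lambda>x::real. deriv f (of_real x)) \<longlongrightarrow> 0) at_top"
proof -
  let ?h = "\<lambda>x::real. of_real x powr p * exp (- (complex_of_real x)\<^sup>2 / 4)"
  have norm_h: "cmod (?h x) = x powr Re p * exp (- x\<^sup>2 / 4)" if "0 < x" for x
    using that by (simp add: norm_mult norm_powr_real_powr Re_power2)
  have bound: "((\<lambda>x::real. q (of_real x) * f (of_real x)) \<longlongrightarrow> 0) at_top"
    if "((\<lambda>x::real. cmod (q (of_real x)) * (x powr Re p * exp (- x\<^sup>2 / 4))) \<longlongrightarrow> 0) at_top" for q
  proof -
    have "((\<lambda>x. q (of_real x) * ?h x) \<longlongrightarrow> 0) at_top"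
    proof (rule tendsto_norm_zero_cancel)
      show "((\<lambda>x. cmod (q (of_real x) * ?h x)) \<longlongrightarrow> 0) at_top"
        using that
        by (rule Lim_transform_eventually) (use eventually_gt_at_top [of 0] in eventually_elim, subst norm_mult, subst norm_h, auto)
    qed
    from tendsto_mult [OF this parabolic_cylinder_ratio [OF f]]
    have "((\<lambda>x. q (of_real x) * ?h x * (f (of_real x) / ?h x)) \<longlongrightarrow> 0) at_top" by simp
    then show ?thesis
      by (rule Lim_transform_eventually) (use eventually_gt_at_top [of 0] in eventually_elim, simp)
  qed
  show lim: "((\<lambda>x::real. f (of_real x)) \<longlongrightarrow> 0) at_top"
  proof -
    have "((\<lambda>x::real. x powr Re p * exp (- x\<^sup>2 / 4)) \<longlongrightarrow> 0) at_top" by real_asymp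
    then show ?thesis using bound [of "\<lambda>_. 1"] by simp
  qed
  have l: "((\<lambda>x::real. ((of_real x)\<^sup>2 / 4 - (p + 1 / 2)) * f (of_real x)) \<longlongrightarrow> 0) at_top"
  proof (rule bound [of "\<lambda>z. z\<^sup>2 / 4 - (p + 1 / 2)"], rule Lim_null_comparison)
    show "\<forall>\<^sub>F x::real in at_top. norm (cmod ((of_real x)\<^sup>2 / 4 - (p + 1 / 2)) * (x powr Re p * exp (- x\<^sup>2 / 4)))
       \<le> (x\<^sup>2 / 4 + cmod (p + 1 / 2)) * (x powr Re p * exp (- x\<^sup>2 / 4))"
    proof (rule always_eventually, rule allI)
      fix x :: real
      have "cmod ((of_real x)\<^sup>2 / 4 - (p + 1 / 2)) \<le> x\<^sup>2 / 4 + cmod (p + 1 / 2)"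
        by (rule order_trans [OF norm_triangle_ineq4]) (simp add: norm_divide norm_power)
      then show "norm (cmod ((of_real x)\<^sup>2 / 4 - (p + 1 / 2)) * (x powr Re p * exp (- x\<^sup>2 / 4)))
       \<le> (x\<^sup>2 / 4 + cmod (p + 1 / 2)) * (x powr Re p * exp (- x\<^sup>2 / 4))"
        by (simp add: mult_right_mono)
    qed
    show "((\<lambda>x::real. (x\<^sup>2 / 4 + cmod (p + 1 / 2)) * (x powr Re p * exp (- x\<^sup>2 / 4))) \<longlongrightarrow> 0) at_top"
    proof -
      have "((\<lambda>x::real. (x\<^sup>2 / 4 + c) * (x powr a * exp (- x\<^sup>2 / 4))) \<longlongrightarrow> 0) at_top" for c a :: real
        by real_asymp
      then show ?thesis .
    qed
  qed
  have ode: "((of_real x)\<^sup>2 / 4 - (p + 1 / 2)) * f (of_real x) = deriv (deriv f) (of_real x)" for x :: real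
  proof -
    have "deriv (deriv f) (of_real x) + (p + 1 / 2 - (of_real x)\<^sup>2 / 4) * f (of_real x) = 0"
      using f unfolding is_parabolic_cylinder_def by blast
    then show ?thesis by (simp add: algebra_simps eq_neg_iff_add_eq_0)
  qed
  have lim2: "((\<lambda>x::real. deriv (deriv f) (of_real x)) \<longlongrightarrow> 0) at_top"
    using l unfolding ode .
  have "f holomorphic_on UNIV"
    using f unfolding is_parabolic_cylinder_def by blast
  then show "((\<lambda>x::real. deriv f (of_real x)) \<longlongrightarrow> 0) at_top"
    using lim lim2 by (rule tendsto_deriv_0_of_tendsto_0)
qed

text \<open>
  The Wronskian of two solutions is constant; as both solutions and their derivatives decay along
  the positive axis, it is 0, so the solutions are proportional there.
\<close>

lemma is_parabolic_cylinder_unique: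
  assumes f: "is_parabolic_cylinder p f" and g: "is_parabolic_cylinder p g"
  shows "f = g"
proof -
  have hf: "f holomorphic_on UNIV" and hg: "g holomorphic_on UNIV"
    using f g by (auto simp: is_parabolic_cylinder_def)
  have D: "(f has_field_derivative deriv f z) (at z)" "(deriv f has_field_derivative deriv (deriv f) z) (at z)"
    "(g has_field_derivative deriv g z) (at z)" "(deriv g has_field_derivative deriv (deriv g) z) (at z)" for z
    using hf hg holomorphic_deriv [OF hf open_UNIV] holomorphic_deriv [OF hg open_UNIV]
    by (auto intro: holomorphic_derivI)
  have ode: "deriv (deriv f) z = (z\<^sup>2 / 4 - p - 1 / 2) * f z" "deriv (deriv g) z = (z\<^sup>2 / 4 - p - 1 / 2) * g z" for z
  proof -
    have "deriv (deriv f) z + (p + 1 / 2 - z\<^sup>2 / 4) * f z = 0" "deriv (deriv g) z + (p + 1 / 2 - z\<^sup>2 / 4) * g z = 0"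
      using f g by (auto simp: is_parabolic_cylinder_def)
    then show "deriv (deriv f) z = (z\<^sup>2 / 4 - p - 1 / 2) * f z" "deriv (deriv g) z = (z\<^sup>2 / 4 - p - 1 / 2) * g z"
      by (simp_all add: algebra_simps eq_neg_iff_add_eq_0)
  qed
  have "((\<lambda>z. f z * deriv g z - deriv f z * g z) has_field_derivative 0) (at z)" for z
    by (auto intro!: derivative_eq_intros D simp: ode)
  then obtain c where c: "\<And>z. f z * deriv g z - deriv f z * g z = c"
    using has_field_derivative_zero_constant [of UNIV "\<lambda>z. f z * deriv g z - deriv f z * g z"] by auto
  have "((\<lambda>x::real. f (of_real x) * deriv g (of_real x) - deriv f (of_real x) * g (of_real x)) \<longlongrightarrow> 0 * 0 - 0 * 0) at_top"
    by (intro tendsto_intros parabolic_cylinder_tendsto_0 [OF f] parabolic_cylinder_tendsto_0 [OF g])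
  then have "c = 0"
    unfolding c by (simp add: tendsto_const_iff)
  let ?h = "\<lambda>x::real. of_real x powr p * exp (- (complex_of_real x)\<^sup>2 / 4)"
  have "\<forall>\<^sub>F x::real in at_top. f (of_real x) / ?h x \<noteq> 0"
    using parabolic_cylinder_ratio [OF f] by (rule tendsto_imp_eventually_ne) simp
  then obtain X where X: "\<And>x. X \<le> x \<Longrightarrow> f (of_real x) \<noteq> 0"
    by (auto simp: eventually_at_top_linorder)
  have der: "((\<lambda>x::real. g (of_real x) / f (of_real x)) has_vector_derivative 0) (at x within {X..})" if "x \<in> {X..}" for x
  proof -
    have "((\<lambda>z. g z / f z) has_field_derivative (deriv g (of_real x) * f (of_real x) - g (of_real x) * deriv f (of_real x)) / (f (of_real x) * f (of_real x))) (at (of_real x))"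
      using X [of x] that by (intro DERIV_divide D) auto
    moreover have "deriv g (of_real x) * f (of_real x) - g (of_real x) * deriv f (of_real x) = 0"
    proof -
      have "deriv g (of_real x) * f (of_real x) - g (of_real x) * deriv f (of_real x) =
          f (of_real x) * deriv g (of_real x) - deriv f (of_real x) * g (of_real x)"
        by (simp add: mult.commute)
      also have "\<dots> = 0" unfolding c by (fact \<open>c = 0\<close>)
      finally show ?thesis .
    qed
    ultimately have "((\<lambda>z. g z / f z) has_field_derivative 0) (at (of_real x))"
      by (simp only: div_0)
    then show ?thesis
      by (rule has_vector_derivative_real_field)
  qed
  obtain k where k: "\<And>x. X \<le> x \<Longrightarrow> g (of_real x) / f (of_real x) = k"
    using has_vector_derivative_zero_constant [OF convex_real_interval(1) der] by auto
  \<comment> \<open>The common normalisation fixes the constant ratio \<open>k\<close> as 1. The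
    half-line accumulates at X, so analytic continuation carries the equality to the whole
    plane.\<close>
  have "((\<lambda>x::real. (g (of_real x) / ?h x) / (f (of_real x) / ?h x)) \<longlongrightarrow> 1 / 1) at_top"
    by (intro tendsto_divide parabolic_cylinder_ratio f g) auto
  then have "((\<lambda>x::real. k) \<longlongrightarrow> 1 / 1) at_top"
    by (rule Lim_transform_eventually) (use eventually_gt_at_top [of "max 0 X"] in \<open>eventually_elim, simp add: k\<close>)
  then have "k = 1" by (simp add: tendsto_const_iff)
  have eq: "f (of_real x) - g (of_real x) = 0" if "X \<le> x" for x
    using k [OF that] X [OF that] \<open>k = 1\<close> by simp
  have "f z - g z = 0" for z
  proof (rule analytic_continuation [of "\<lambda>z. f z - g z" UNIV "of_real ` {X..}" "of_real X"])
    show "complex_of_real X islimpt of_real ` {X..}"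
    proof (rule islimptI)
      fix T assume "complex_of_real X \<in> T" "open T"
      then obtain e where "0 < e" "ball (complex_of_real X) e \<subseteq> T" by (auto simp: open_contains_ball)
      then show "\<exists>y\<in>of_real ` {X..}. y \<in> T \<and> y \<noteq> complex_of_real X"
        by (intro bexI [of _ "of_real (X + e / 2)"] imageI) (auto simp: dist_norm subset_iff)
    qed
  qed (use hf hg eq in \<open>auto intro!: holomorphic_intros\<close>)
  then show ?thesis by (intro ext) (metis right_minus_eq)
qed

text \<open>Two differentiations produce indices \<kappa> + 1 and \<kappa> + 2, which the recurrence
  folds back to \<kappa>; this is the differential equation. The limit at infinity is the
  normalisation.\<close>

lemma is_parabolic_cylinder_gauss_mellin:
  assumes k: "0 < Re \<kappa>"
  shows "is_parabolic_cylinder (- \<kappa>) (\<lambda>z. exp (- z\<^sup>2 / 4) * gauss_mellin \<kappa> z / Gamma \<kappa>)"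
    and deriv_gauss_mellin_cylinder: "deriv (\<lambda>z. exp (- z\<^sup>2 / 4) * gauss_mellin \<kappa> z / Gamma \<kappa>) =
      (\<lambda>z. - exp (- z\<^sup>2 / 4) * (z / 2 * gauss_mellin \<kappa> z + gauss_mellin (\<kappa> + 1) z) / Gamma \<kappa>)"
proof -
  have k1: "0 < Re (\<kappa> + 1)" using k by simp
  have G: "Gamma \<kappa> \<noteq> 0"
    using k by (auto simp: Gamma_eq_zero_iff elim!: nonpos_Ints_cases)
  let ?f = "\<lambda>z. exp (- z\<^sup>2 / 4) * gauss_mellin \<kappa> z / Gamma \<kappa>"
  let ?f' = "\<lambda>z. - exp (- z\<^sup>2 / 4) * (z / 2 * gauss_mellin \<kappa> z + gauss_mellin (\<kappa> + 1) z) / Gamma \<kappa>"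
  have D: "(?f has_field_derivative ?f' z) (at z)" for z
    using k G by (auto intro!: derivative_eq_intros simp: field_simps)
  have D': "(?f' has_field_derivative exp (- z\<^sup>2 / 4) * (z\<^sup>2 / 4 - 1 / 2) * gauss_mellin \<kappa> z / Gamma \<kappa>
     + exp (- z\<^sup>2 / 4) * (gauss_mellin (\<kappa> + 2) z + z * gauss_mellin (\<kappa> + 1) z) / Gamma \<kappa>) (at z)" for z
    using k k1 G by (auto intro!: derivative_eq_intros simp: field_simps power2_eq_square)
  show deriv: "deriv ?f = ?f'"
    using D by (auto intro!: DERIV_imp_deriv)
  have deriv2: "deriv ?f' z = exp (- z\<^sup>2 / 4) * (z\<^sup>2 / 4 - 1 / 2) * gauss_mellin \<kappa> z / Gamma \<kappa>
     + exp (- z\<^sup>2 / 4) * (\<kappa> * gauss_mellin \<kappa> z) / Gamma \<kappa>" for z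
    using D' [of z, unfolded gauss_mellin_recurrence [OF k]] by (rule DERIV_imp_deriv)
  have lim: "((\<lambda>x::real. of_real x powr \<kappa> * gauss_mellin \<kappa> (of_real x) / Gamma \<kappa>) \<longlongrightarrow> 1) at_top"
    using tendsto_divide [OF gauss_mellin_at_top [OF k] tendsto_const G] G by simp
  have "(\<lambda>x::real. ?f (of_real x)) \<sim>[at_top] (\<lambda>x. of_real x powr - \<kappa> * exp (- (of_real x)\<^sup>2 / 4))"
    by (rule asymp_equivI', rule Lim_transform_eventually [OF lim])
       (use eventually_gt_at_top [of 0] in \<open>eventually_elim, auto simp: powr_minus field_simps\<close>)
  then show "is_parabolic_cylinder (- \<kappa>) ?f"
    unfolding is_parabolic_cylinder_def deriv deriv2
  proof (intro conjI allI)
    show "?f holomorphic_on UNIV"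
      using D by (auto simp: holomorphic_on_open simp del: times_divide_eq_left times_divide_eq_right)
    show "exp (- z\<^sup>2 / 4) * (z\<^sup>2 / 4 - 1 / 2) * gauss_mellin \<kappa> z / Gamma \<kappa>
      + exp (- z\<^sup>2 / 4) * (\<kappa> * gauss_mellin \<kappa> z) / Gamma \<kappa> + (- \<kappa> + 1 / 2 - z\<^sup>2 / 4) * ?f z = 0" for z
      using G by (simp add: field_simps)
  qed
qed

lemma parabolic_cylinder_eq_gauss_mellin:
  assumes "0 < Re \<kappa>"
  shows "parabolic_cylinder (- \<kappa>) = (\<lambda>z. exp (- z\<^sup>2 / 4) * gauss_mellin \<kappa> z / Gamma \<kappa>)"
  unfolding parabolic_cylinder_def
  using is_parabolic_cylinder_gauss_mellin(1) [OF assms] is_parabolic_cylinder_unique by (intro the_equality) blast+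

lemma deriv_parabolic_cylinder_eq_gauss_mellin:
  assumes "0 < Re \<kappa>"
  shows "deriv (parabolic_cylinder (- \<kappa>)) z = - exp (- z\<^sup>2 / 4) * (z / 2 * gauss_mellin \<kappa> z + gauss_mellin (\<kappa> + 1) z) / Gamma \<kappa>"
  unfolding parabolic_cylinder_eq_gauss_mellin [OF assms] deriv_gauss_mellin_cylinder [OF assms] ..

section \<open>Integral solutions of the birth-death recurrence\<close>

text \<open>
  The step size \<open>\<delta>\<close> may have either sign: with \<open>s = \<bar>\<delta>\<bar> t\<close> the two signs give
  \<open>\<integral> s powr (\<kappa> - 1) e\<^bsup>-r s\<^esup> (1 + s)\<^bsup>a\<^esup> ds\<close> over \<open>(0, \<infinity>)\<close> and \<open>\<integral> s powr (\<kappa> - 1) e\<^bsup>r s\<^esup> (1 - s)\<^bsup>a\<^esup> ds\<close> over \<open>(0, 1)\<close>,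
  two independent solutions of the same three-term recurrence in \<open>a\<close>.
\<close>

definition charlier_kernel :: "real \<Rightarrow> real \<Rightarrow> real \<Rightarrow> real \<Rightarrow> real" where
  "charlier_kernel \<delta> r a t = (if 0 < 1 + \<delta> * t then exp (- r * \<delta> * t + a * ln (1 + \<delta> * t)) else 0)"

definition charlier_mellin :: "complex \<Rightarrow> real \<Rightarrow> real \<Rightarrow> real \<Rightarrow> complex" where
  "charlier_mellin \<kappa> \<delta> r a = (LINT t|lborel. mellin_kernel \<kappa> t * of_real (charlier_kernel \<delta> r a t))"

lemma charlier_kernel_measurable [measurable]: "charlier_kernel \<delta> r a \<in> borel_measurable borel"
  unfolding charlier_kernel_def by measurable

lemma charlier_kernel_nonneg: "0 \<le> charlier_kernel \<delta> r a t"
  by (simp add: charlier_kernel_def)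

lemma charlier_kernel_add_1: "charlier_kernel \<delta> r (a + 1) t = (1 + \<delta> * t) * charlier_kernel \<delta> r a t"
proof (cases "0 < 1 + \<delta> * t")
  case True
  then have "exp (ln (1 + \<delta> * t)) = 1 + \<delta> * t" by simp
  moreover have "- r * \<delta> * t + (a + 1) * ln (1 + \<delta> * t) = (- r * \<delta> * t + a * ln (1 + \<delta> * t)) + ln (1 + \<delta> * t)"
    by (simp add: algebra_simps)
  ultimately show ?thesis
    using True by (simp only: charlier_kernel_def exp_add [of "_ + _ * _"]) simp
qed (simp add: charlier_kernel_def)

text \<open>For \<delta> > 0 the factor exp (-r \<delta> t) wins against a power. For \<delta> < 0
  the support ends at 1 / (-\<delta>), where -r \<delta> t is still at most r, so rate 1 costs only
  a constant. The constants depend on \<delta>, which is enough for integrability but not for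
  limits.\<close>

lemma charlier_kernel_exp_bound:
  assumes "\<delta> \<noteq> 0" "0 < r" "0 \<le> a"
  obtains C c where "0 < c" "\<And>t. 0 < t \<Longrightarrow> charlier_kernel \<delta> r a t \<le> C * exp (- c * t)"
proof (cases "0 < \<delta>")
  case True
  \<comment> \<open>Chosen so that a / K is at most r / 2: the logarithm, bounded by a line of slope
    1 / K, then consumes at most half of the decay.\<close>
  define K where "K = 2 * (a + 1) / r"
  have K: "0 < K" using assms by (simp add: K_def)
  show thesis
  proof (rule that [of "r * \<delta> / 2" "exp (a * \<bar>ln K\<bar> + r / 2)"])
    fix t :: real assume t: "0 < t"
    have pos: "0 < 1 + \<delta> * t" using True t by (simp add: add_pos_pos)
    have "ln (1 + \<delta> * t) = ln K + ln ((1 + \<delta> * t) / K)"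
      using pos K by (simp add: ln_div)
    also have "\<dots> \<le> \<bar>ln K\<bar> + (1 + \<delta> * t) / K"
      using ln_less_self [OF divide_pos_pos [OF pos K]] by linarith
    finally have "a * ln (1 + \<delta> * t) \<le> a * (\<bar>ln K\<bar> + (1 + \<delta> * t) / K)"
      using assms by (intro mult_left_mono)
    also have "\<dots> = a * \<bar>ln K\<bar> + (a / K) * (1 + \<delta> * t)" by (simp add: algebra_simps add_divide_distrib)
    also have "(a / K) * (1 + \<delta> * t) \<le> (r / 2) * (1 + \<delta> * t)"
      using assms pos by (intro mult_right_mono) (simp_all add: K_def field_simps)
    finally have "- r * \<delta> * t + a * ln (1 + \<delta> * t) \<le> (a * \<bar>ln K\<bar> + r / 2) + - (r * \<delta> / 2) * t"
      by (simp add: algebra_simps add_divide_distrib)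
    then show "charlier_kernel \<delta> r a t \<le> exp (a * \<bar>ln K\<bar> + r / 2) * exp (- (r * \<delta> / 2) * t)"
      using pos unfolding exp_add [symmetric] by (simp add: charlier_kernel_def)
  qed (use True assms in simp)
next
  case False
  then have d: "\<delta> < 0" using assms by simp
  show thesis
  proof (rule that [of 1 "exp (r + 1 / (- \<delta>))"])
    fix t :: real assume t: "0 < t"
    show "charlier_kernel \<delta> r a t \<le> exp (r + 1 / (- \<delta>)) * exp (- 1 * t)"
    proof (cases "0 < 1 + \<delta> * t")
      case True
      have "1 + \<delta> * t \<le> 1" using d t by (simp add: mult_nonpos_nonneg)
      then have "a * ln (1 + \<delta> * t) \<le> 0"
        using assms True by (simp add: mult_nonneg_nonpos)
      moreover have "- r * \<delta> * t \<le> r"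
        using mult_left_mono [of "- \<delta> * t" 1 r] True assms by (simp add: algebra_simps)
      moreover have "t \<le> 1 / (- \<delta>)"
        using True d by (simp add: field_simps)
      ultimately have "- r * \<delta> * t + a * ln (1 + \<delta> * t) \<le> r + 1 / (- \<delta>) + - 1 * t" by linarith
      then show ?thesis
        using True unfolding exp_add [symmetric] by (simp add: charlier_kernel_def)
    qed (simp add: charlier_kernel_def)
  qed simp
qed

lemma integrable_charlier_mellin:
  assumes "0 < Re \<kappa>" "\<delta> \<noteq> 0" "0 < r" "0 \<le> a"
  shows "integrable lborel (\<lambda>t. mellin_kernel \<kappa> t * of_real (charlier_kernel \<delta> r a t))"
proof -
  obtain C c where C: "0 < c" "\<And>t. 0 < t \<Longrightarrow> charlier_kernel \<delta> r a t \<le> C * exp (- c * t)"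
    using charlier_kernel_exp_bound [of \<delta> r a] assms by metis
  then show ?thesis
    using charlier_kernel_nonneg by (intro integrable_mellin_bounded [OF assms(1) C(1)]) auto
qed

text \<open>Raising \<open>a\<close> by 1 multiplies the kernel by 1 + \<delta> t, and the extra t
  moves into the Mellin index: the discrete counterpart of differentiating
  \<open>gauss_mellin\<close>.\<close>

lemma charlier_mellin_step:
  assumes "0 < Re \<kappa>" "\<delta> \<noteq> 0" "0 < r" "0 \<le> a"
  shows "charlier_mellin \<kappa> \<delta> r (a + 1) - charlier_mellin \<kappa> \<delta> r a = of_real \<delta> * charlier_mellin (\<kappa> + 1) \<delta> r a"
proof -
  have "charlier_mellin \<kappa> \<delta> r (a + 1) - charlier_mellin \<kappa> \<delta> r a =
    (LINT t|lborel. mellin_kernel \<kappa> t * of_real (charlier_kernel \<delta> r (a + 1) t) - mellin_kernel \<kappa> t * of_real (charlier_kernel \<delta> r a t))"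
    unfolding charlier_mellin_def using assms
    by (intro Bochner_Integration.integral_diff [symmetric] integrable_charlier_mellin) auto
  also have "\<dots> = (LINT t|lborel. of_real \<delta> * (mellin_kernel (\<kappa> + 1) t * of_real (charlier_kernel \<delta> r a t)))"
    unfolding charlier_kernel_add_1 mellin_kernel_Suc
    by (rule Bochner_Integration.integral_cong) (simp_all add: algebra_simps)
  finally show ?thesis
    by (simp add: charlier_mellin_def)
qed

lemma charlier_kernel_has_derivative:
  assumes "0 < 1 + \<delta> * t"
  shows "(charlier_kernel \<delta> r a has_real_derivative
    a * \<delta> * charlier_kernel \<delta> r (a - 1) t - r * \<delta> * charlier_kernel \<delta> r a t) (at t)"
proof -
  let ?g = "\<lambda>t. exp (- r * \<delta> * t + a * ln (1 + \<delta> * t))"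
  have "(?g has_real_derivative ?g t * (- r * \<delta> + a * (\<delta> / (1 + \<delta> * t)))) (at t)"
    using assms by (auto intro!: derivative_eq_intros simp: field_simps)
  also have "?g t * (- r * \<delta> + a * (\<delta> / (1 + \<delta> * t))) = a * \<delta> * charlier_kernel \<delta> r (a - 1) t - r * \<delta> * charlier_kernel \<delta> r a t"
  proof -
    have "?g t = (1 + \<delta> * t) * charlier_kernel \<delta> r (a - 1) t"
      using charlier_kernel_add_1 [of \<delta> r "a - 1" t] assms by (simp add: charlier_kernel_def)
    moreover have "?g t = charlier_kernel \<delta> r a t"
      using assms by (simp add: charlier_kernel_def)
    ultimately show ?thesis
      using assms by (simp add: field_simps)
  qed
  finally show ?thesis
  proof (rule has_field_derivative_transform_within_open)
    show "open {t. 0 < 1 + \<delta> * t}"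
      by (intro open_Collect_less continuous_intros)
  qed (use assms in \<open>auto simp: charlier_kernel_def\<close>)
qed

text \<open>Integrates the derivative of t^\<kappa> times the kernel. The condition on
  \<open>a\<close> secures integrability of the kernel of index a - 1 and, for \<delta> < 0, a zero
  of the kernel at the end of its support.\<close>

lemma charlier_mellin_parts:
  assumes k: "0 < Re \<kappa>" and d: "\<delta> \<noteq> 0" and r: "0 < r" and a: "1 \<le> a \<or> a = 0 \<and> 0 < \<delta>"
  shows "of_real (r * \<delta>) * charlier_mellin (\<kappa> + 1) \<delta> r a - of_real (a * \<delta>) * charlier_mellin (\<kappa> + 1) \<delta> r (a - 1)
    = \<kappa> * charlier_mellin \<kappa> \<delta> r a"
proof -
  \<comment> \<open>The right end of the support of the kernel.\<close>
  define B where "B = (if 0 < \<delta> then \<infinity> else ereal (- 1 / \<delta>))"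
  have B: "ereal t < B \<longleftrightarrow> 0 < 1 + \<delta> * t" if "0 < t" for t
  proof (cases "0 < \<delta>")
    case True then show ?thesis using that by (simp add: B_def add_pos_pos)
  next
    case False then show ?thesis using d by (simp add: B_def field_simps) linarith
  qed
  note int = integrable_charlier_mellin [of _ \<delta> r, OF _ d r]
  have a0: "0 \<le> a" using a by auto
  \<comment> \<open>At a = 0 the kernel of index -1 occurs only with the factor 0.\<close>
  have int1: "integrable lborel (\<lambda>t. of_real (a * \<delta>) * (mellin_kernel (\<kappa> + 1) t * of_real (charlier_kernel \<delta> r (a - 1) t)))"
  proof (cases "1 \<le> a")
    case True then show ?thesis using k by (intro integrable_mult_right int) auto
  next
    case False then show ?thesis using a by simp
  qed
  let ?f = "\<lambda>t. \<kappa> * (mellin_kernel \<kappa> t * of_real (charlier_kernel \<delta> r a t))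
    + of_real (a * \<delta>) * (mellin_kernel (\<kappa> + 1) t * of_real (charlier_kernel \<delta> r (a - 1) t))
    - of_real (r * \<delta>) * (mellin_kernel (\<kappa> + 1) t * of_real (charlier_kernel \<delta> r a t))"
  let ?F = "\<lambda>t. mellin_kernel (\<kappa> + 1) t * of_real (charlier_kernel \<delta> r a t)"
  have int0: "(LINT t|lborel. ?f t) = 0"
  proof (rule integral_vector_derivative_eq_0 [of B])
    show "0 < B" using d by (auto simp: B_def)
    show "(?F has_vector_derivative ?f t) (at t)" if t: "0 < t" "ereal t < B" for t
      using mellin_kernel_has_vector_derivative [OF t(1), of \<kappa>]
        has_vector_derivative_of_real [OF charlier_kernel_has_derivative [of \<delta> t r a]] t B [of t]
      by (intro has_vector_derivative_eq_rhs [OF has_vector_derivative_mult]) (auto simp: algebra_simps)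
    have contk: "isCont (charlier_kernel \<delta> r a') t" if "0 < t" "ereal t < B" for t a'
      using that B [of t] by (intro DERIV_isCont [OF charlier_kernel_has_derivative]) simp
    show "isCont ?f t" if t: "0 < t" "ereal t < B" for t
      by (intro continuous_intros contk t)
    show "?f t = 0" if "\<not> (0 < t \<and> ereal t < B)" for t
      using that B [of t] by (cases "0 < t") (simp_all add: mellin_kernel_def charlier_kernel_def)
    show "integrable lborel ?f"
      using k a0 by (intro Bochner_Integration.integrable_diff Bochner_Integration.integrable_add int1 integrable_mult_right int) auto
    show "(?F \<longlongrightarrow> 0) (at_right 0)"
    proof -
      have "(charlier_kernel \<delta> r a \<longlongrightarrow> charlier_kernel \<delta> r a 0) (at_right 0)"
        using DERIV_isCont [OF charlier_kernel_has_derivative [of \<delta> 0 r a]]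
        by (auto simp: isCont_def intro: filterlim_mono [OF _ _ at_le])
      then show ?thesis
        using tendsto_mult [OF mellin_kernel_Suc_tendsto_0 [OF k] tendsto_of_real] by fastforce
    qed
    show "((?F \<circ> real_of_ereal) \<longlongrightarrow> 0) (at_left B)"
    proof (cases "0 < \<delta>")
      case True
      obtain C c where C: "0 < c" "\<And>t. 0 < t \<Longrightarrow> charlier_kernel \<delta> r a t \<le> C * exp (- c * t)"
        using charlier_kernel_exp_bound [of \<delta> r a] d r a0 by metis
      have "(?F \<longlongrightarrow> 0) at_top"
      proof (rule Lim_null_comparison)
        show "\<forall>\<^sub>F t in at_top. cmod (?F t) \<le> C * (t powr Re \<kappa> * exp (- c * t))"
          using eventually_gt_at_top [of 0]
        proof eventually_elim
          case (elim t)
          then show ?case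
            using mult_left_mono [OF C(2) [OF elim], of "t powr Re \<kappa>"]
            by (simp add: norm_mult norm_mellin_kernel charlier_kernel_nonneg mult_ac)
        qed
        have "((\<lambda>t. t powr Re \<kappa> * exp (- c * t)) \<longlongrightarrow> 0) at_top"
          using k C(1) by real_asymp
        then show "((\<lambda>t. C * (t powr Re \<kappa> * exp (- c * t))) \<longlongrightarrow> 0) at_top"
          by (rule tendsto_mult_right_zero)
      qed
      then show ?thesis using True by (simp add: B_def ereal_tendsto_simps)
    next
      case False
      \<comment> \<open>Strict positivity of \<open>a\<close> is what makes (1 + \<delta> t)^a
        vanish at the finite end point.\<close>
      then have a1: "0 < a" and neg: "\<delta> < 0" using a d by auto
      define b where "b = - 1 / \<delta>"
      have b: "0 < b" "1 + \<delta> * b = 0" using neg by (simp_all add: b_def)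
      have ev: "\<forall>\<^sub>F t in at_left b. 0 < 1 + \<delta> * t"
      proof (rule eventually_mono)
        show "\<forall>\<^sub>F t in at_left b. t \<in> {b - 1<..<b}"
          by (rule eventually_at_left_real) simp
        fix t assume "t \<in> {b - 1<..<b}"
        then have "\<delta> * b < \<delta> * t" using neg by simp
        then show "0 < 1 + \<delta> * t" using b(2) by linarith
      qed
      have l0: "filterlim (\<lambda>t. 1 + \<delta> * t) (at_right 0) (at_left b)"
        unfolding filterlim_at
      proof
        show "\<forall>\<^sub>F t in at_left b. 1 + \<delta> * t \<in> {0<..} \<and> 1 + \<delta> * t \<noteq> 0"
          using ev by eventually_elim auto
        have "((\<lambda>t. 1 + \<delta> * t) \<longlongrightarrow> 1 + \<delta> * b) (at_left b)" by (intro tendsto_intros)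
        then show "((\<lambda>t. 1 + \<delta> * t) \<longlongrightarrow> 0) (at_left b)" using b by simp
      qed
      have "((\<lambda>y. exp (a * ln y)) \<longlongrightarrow> 0) (at_right 0)"
        using a1 by real_asymp
      from filterlim_compose [OF this l0]
      have "((\<lambda>t. exp (a * ln (1 + \<delta> * t))) \<longlongrightarrow> 0) (at_left b)" .
      moreover have "((\<lambda>t. exp (- r * \<delta> * t)) \<longlongrightarrow> exp (- r * \<delta> * b)) (at_left b)"
        by (intro tendsto_intros)
      ultimately have "((\<lambda>t. exp (- r * \<delta> * t) * exp (a * ln (1 + \<delta> * t))) \<longlongrightarrow> exp (- r * \<delta> * b) * 0) (at_left b)"
        by (intro tendsto_mult)
      then have "((\<lambda>t. exp (- r * \<delta> * t) * exp (a * ln (1 + \<delta> * t))) \<longlongrightarrow> 0) (at_left b)"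
        by simp
      then have "(charlier_kernel \<delta> r a \<longlongrightarrow> 0) (at_left b)"
        by (rule Lim_transform_eventually)
           (use ev in \<open>eventually_elim, auto simp: charlier_kernel_def exp_add [symmetric]\<close>)
      moreover have "(mellin_kernel (\<kappa> + 1) \<longlongrightarrow> mellin_kernel (\<kappa> + 1) b) (at_left b)"
        using isCont_mellin_kernel [OF b(1)] by (auto simp: isCont_def intro: filterlim_mono [OF _ _ at_le])
      ultimately have "(?F \<longlongrightarrow> mellin_kernel (\<kappa> + 1) b * of_real 0) (at_left b)"
        by (intro tendsto_mult tendsto_of_real)
      then show ?thesis using False by (simp add: B_def b_def ereal_tendsto_simps)
    qed
  qed
  have "\<kappa> * charlier_mellin \<kappa> \<delta> r a + of_real (a * \<delta>) * charlier_mellin (\<kappa> + 1) \<delta> r (a - 1) - of_real (r * \<delta>) * charlier_mellin (\<kappa> + 1) \<delta> r a = 0"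
  proof -
    have i0: "integrable lborel (\<lambda>t. \<kappa> * (mellin_kernel \<kappa> t * of_real (charlier_kernel \<delta> r a t)))"
      and i2: "integrable lborel (\<lambda>t. of_real (r * \<delta>) * (mellin_kernel (\<kappa> + 1) t * of_real (charlier_kernel \<delta> r a t)))"
      using k a0 by (intro integrable_mult_right int; simp)+
    show ?thesis
      using int0
      unfolding Bochner_Integration.integral_diff [OF Bochner_Integration.integrable_add [OF i0 int1] i2]
        Bochner_Integration.integral_add [OF i0 int1] integral_mult_right_zero charlier_mellin_def .
  qed
  then show ?thesis by (simp add: algebra_simps)
qed

text \<open>Eliminates the integrals of index \<kappa> + 1 from the integration by parts, using the
  difference formula at a and at a - 1. For a = 0 the term with a - 1 drops out, which is the
  equation of an empty system.\<close>

lemma charlier_mellin_recurrence: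
  assumes k: "0 < Re \<kappa>" and d: "\<delta> \<noteq> 0" and r: "0 < r" and a: "1 \<le> a \<or> a = 0 \<and> 0 < \<delta>"
  shows "(\<kappa> + of_real r + of_real a) * charlier_mellin \<kappa> \<delta> r a =
    of_real r * charlier_mellin \<kappa> \<delta> r (a + 1) + of_real a * charlier_mellin \<kappa> \<delta> r (a - 1)"
proof -
  have "of_real \<delta> * charlier_mellin (\<kappa> + 1) \<delta> r a = charlier_mellin \<kappa> \<delta> r (a + 1) - charlier_mellin \<kappa> \<delta> r a"
    using charlier_mellin_step [OF k d r, of a] a by auto
  moreover have "of_real a * (of_real \<delta> * charlier_mellin (\<kappa> + 1) \<delta> r (a - 1)) =
      of_real a * (charlier_mellin \<kappa> \<delta> r a - charlier_mellin \<kappa> \<delta> r (a - 1))"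
    using charlier_mellin_step [OF k d r, of "a - 1"] a by auto
  moreover have "of_real r * (of_real \<delta> * charlier_mellin (\<kappa> + 1) \<delta> r a) - of_real a * (of_real \<delta> * charlier_mellin (\<kappa> + 1) \<delta> r (a - 1))
      = \<kappa> * charlier_mellin \<kappa> \<delta> r a"
    using charlier_mellin_parts [OF assms] by (simp add: mult.assoc)
  ultimately have "of_real r * (charlier_mellin \<kappa> \<delta> r (a + 1) - charlier_mellin \<kappa> \<delta> r a) -
      of_real a * (charlier_mellin \<kappa> \<delta> r a - charlier_mellin \<kappa> \<delta> r (a - 1)) = \<kappa> * charlier_mellin \<kappa> \<delta> r a"
    by (simp only:)
  then show ?thesis
    by (simp add: algebra_simps)
qed

text \<open>The correction is quadratic near 0 and still linear at infinity, so it yields decay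
  uniform in the step size. For u nonnegative the bound is ln y \<le> (y - 1/y) / 2 at y = 1 + u;
  for negative u it is weaker than u - u^2/2.\<close>

lemma ln_one_plus_le:
  fixes u :: real
  assumes "- 1 < u"
  shows "ln (1 + u) \<le> u - u\<^sup>2 / (2 * (1 + \<bar>u\<bar>))"
proof (cases "0 \<le> u")
  case True
  let ?g = "\<lambda>y::real. (y - inverse y) / 2 - ln y"
  have "?g 1 \<le> ?g (1 + u)"
  proof (rule DERIV_nonneg_imp_nondecreasing [where f = ?g and a = 1])
    fix y :: real assume y: "1 \<le> y" "y \<le> 1 + u"
    have "(?g has_real_derivative (1 - inverse y)\<^sup>2 / 2) (at y)"
      using y by (auto intro!: derivative_eq_intros simp: field_simps power2_eq_square)
    then show "\<exists>D. (?g has_real_derivative D) (at y) \<and> 0 \<le> D" by force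
  qed (use True in simp)
  moreover have "(1 + u - inverse (1 + u)) / 2 = u - u\<^sup>2 / (2 * (1 + \<bar>u\<bar>))"
    using True by (simp add: field_simps power2_eq_square)
  ultimately show ?thesis by simp
next
  case False
  let ?g = "\<lambda>u::real. u - u\<^sup>2 / 2 - ln (1 + u)"
  have "?g 0 \<le> ?g u"
  proof (rule DERIV_nonpos_imp_nonincreasing [of u 0])
    fix x :: real assume x: "u \<le> x" "x \<le> 0"
    have "(?g has_real_derivative - x\<^sup>2 / (1 + x)) (at x)"
      using x assms by (auto intro!: derivative_eq_intros simp: field_simps power2_eq_square)
    moreover have "- x\<^sup>2 / (1 + x) \<le> 0" using x assms by simp
    ultimately show "\<exists>y. (?g has_real_derivative y) (at x) \<and> y \<le> 0" by blast
  qed (use False in auto)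
  moreover have "u\<^sup>2 / (2 * (1 + \<bar>u\<bar>)) \<le> u\<^sup>2 / 2"
    by (intro divide_left_mono) auto
  ultimately show ?thesis by simp
qed

text \<open>A dominating function independent of \<delta>, r and a: the drift (a - r) \<delta>
  contributes at most Y t, and the loss \<open>q\<close> from the logarithm, quadratic and then
  linear, outgrows it.\<close>

lemma charlier_kernel_uniform_bound:
  assumes Y: "0 \<le> Y" and d: "\<bar>\<delta>\<bar> \<le> 1 / (8 * (Y + 1))" and y: "(a - r) * \<delta> \<le> Y" and a: "1 / 2 \<le> a * \<delta>\<^sup>2" and t: "0 < t"
  shows "charlier_kernel \<delta> r a t \<le> exp (8 * (Y + 1)\<^sup>2) * exp (- 1 * t)"
proof (cases "0 < 1 + \<delta> * t")
  case True
  have a0: "0 \<le> a"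
  proof (rule ccontr)
    assume "\<not> 0 \<le> a"
    then have "a * \<delta>\<^sup>2 \<le> 0" by (simp add: mult_nonpos_nonneg)
    then show False using a by simp
  qed
  define q where "q = t\<^sup>2 / (4 * (1 + t / (8 * (Y + 1))))"
  have "a * ln (1 + \<delta> * t) \<le> a * (\<delta> * t - (\<delta> * t)\<^sup>2 / (2 * (1 + \<bar>\<delta> * t\<bar>)))"
    using True a0 by (intro mult_left_mono ln_one_plus_le) auto
  also have "\<dots> = a * \<delta> * t - (a * \<delta>\<^sup>2) * (t\<^sup>2 / (2 * (1 + \<bar>\<delta>\<bar> * t)))"
    using t by (simp add: power_mult_distrib abs_mult right_diff_distrib)
  also have "\<dots> \<le> a * \<delta> * t - (1 / 2) * (t\<^sup>2 / (2 * (1 + t / (8 * (Y + 1)))))"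
  proof -
    have "\<bar>\<delta>\<bar> * t \<le> 1 / (8 * (Y + 1)) * t" using d t by (intro mult_right_mono) auto
    moreover have "0 < 1 + t / (8 * (Y + 1))" using t Y by (simp add: add_pos_nonneg)
    ultimately have "t\<^sup>2 / (2 * (1 + t / (8 * (Y + 1)))) \<le> t\<^sup>2 / (2 * (1 + \<bar>\<delta>\<bar> * t))"
      using t by (intro divide_left_mono mult_pos_pos) (auto intro: add_pos_nonneg)
    moreover have "0 \<le> t\<^sup>2 / (2 * (1 + t / (8 * (Y + 1))))" using t Y by simp
    ultimately have "(1 / 2) * (t\<^sup>2 / (2 * (1 + t / (8 * (Y + 1))))) \<le> (a * \<delta>\<^sup>2) * (t\<^sup>2 / (2 * (1 + \<bar>\<delta>\<bar> * t)))"
      using a by (intro mult_mono) auto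
    then show ?thesis by simp
  qed
  finally have "- r * \<delta> * t + a * ln (1 + \<delta> * t) \<le> (a - r) * \<delta> * t - q"
    by (simp add: q_def algebra_simps)
  also have "\<dots> \<le> Y * t - q" using y t by (simp add: mult_right_mono)
  also have "\<dots> \<le> 8 * (Y + 1)\<^sup>2 - t"
  \<comment> \<open>At t = 8 (Y + 1) the lower bound \<open>q\<close> for the loss reaches (Y + 1) t
    and stays above it; before that, (Y + 1) t is at most 8 (Y + 1)^2.\<close>
  proof (cases "t \<le> 8 * (Y + 1)")
    case True
    have "(Y + 1) * t \<le> (Y + 1) * (8 * (Y + 1))" using True Y by (intro mult_left_mono) auto
    moreover have "0 \<le> q" using t Y by (simp add: q_def)
    ultimately show ?thesis by (simp add: power2_eq_square algebra_simps)
  next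
    case False
    have "(Y + 1) * t \<le> q"
    proof -
      have "(Y + 1) * t * (4 * (1 + t / (8 * (Y + 1)))) = t * (4 * (Y + 1) + t / 2)"
        using Y by (simp add: field_simps)
      also have "\<dots> \<le> t * t" using False t by (intro mult_left_mono) auto
      finally show ?thesis
        using t Y unfolding q_def by (subst pos_le_divide_eq) (auto simp: power2_eq_square intro!: add_pos_nonneg)
    qed
    moreover have "(Y + 1) * t = Y * t + t" "0 \<le> 8 * (Y + 1)\<^sup>2" by (simp_all add: distrib_right)
    ultimately show ?thesis by linarith
  qed
  finally show ?thesis
    using True unfolding exp_add [symmetric] by (simp add: charlier_kernel_def)
qed (simp add: charlier_kernel_def)

text \<open>With u = \<delta> t the exponent splits into (a - r) \<delta> t and a \<delta>^2 t^2
  times (ln (1 + u) - u) / u^2; the last quotient tends to -1/2.\<close>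

lemma charlier_kernel_tendsto:
  fixes \<delta> r a :: "nat \<Rightarrow> real"
  assumes d: "\<delta> \<longlonglongrightarrow> 0" and d0: "\<forall>\<^sub>F n in sequentially. \<delta> n \<noteq> 0" and y: "(\<lambda>n. (a n - r n) * \<delta> n) \<longlonglongrightarrow> y" and a: "(\<lambda>n. a n * (\<delta> n)\<^sup>2) \<longlonglongrightarrow> 1"
    and t: "0 < t"
  shows "(\<lambda>n. charlier_kernel (\<delta> n) (r n) (a n) t) \<longlonglongrightarrow> exp (- t\<^sup>2 / 2 + y * t)"
proof -
  have dt: "(\<lambda>n. \<delta> n * t) \<longlonglongrightarrow> 0" using tendsto_mult_left_zero [OF d] .
  have "((\<lambda>u::real. (ln (1 + u) - u) / u\<^sup>2) \<longlongrightarrow> - 1 / 2) (at 0)" by real_asymp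
  moreover have "filterlim (\<lambda>n. \<delta> n * t) (at 0) sequentially"
    using dt d0 t by (auto simp: filterlim_at elim: eventually_mono)
  ultimately have L: "(\<lambda>n. (ln (1 + \<delta> n * t) - \<delta> n * t) / (\<delta> n * t)\<^sup>2) \<longlonglongrightarrow> - 1 / 2"
    by (rule filterlim_compose)
  from tendsto_exp [OF tendsto_add [OF tendsto_mult [OF y tendsto_const] tendsto_mult [OF tendsto_mult [OF a tendsto_const] L]]]
  have "(\<lambda>n. exp ((a n - r n) * \<delta> n * t + a n * (\<delta> n)\<^sup>2 * t\<^sup>2 * ((ln (1 + \<delta> n * t) - \<delta> n * t) / (\<delta> n * t)\<^sup>2)))
     \<longlonglongrightarrow> exp (- t\<^sup>2 / 2 + y * t)" by (simp add: add.commute)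
  moreover have "\<forall>\<^sub>F n in sequentially. \<delta> n * t > - 1"
    using dt by (rule order_tendstoD) simp
  ultimately show ?thesis
  proof (rule Lim_transform_eventually [OF _ eventually_mono [OF eventually_conj [OF d0]]])
    fix n assume n: "\<delta> n \<noteq> 0 \<and> \<delta> n * t > - 1"
    have "a n * (\<delta> n)\<^sup>2 * t\<^sup>2 * ((ln (1 + \<delta> n * t) - \<delta> n * t) / (\<delta> n * t)\<^sup>2) = a n * (ln (1 + \<delta> n * t) - \<delta> n * t)"
      using n t by (simp add: power_mult_distrib)
    then show "exp ((a n - r n) * \<delta> n * t + a n * (\<delta> n)\<^sup>2 * t\<^sup>2 * ((ln (1 + \<delta> n * t) - \<delta> n * t) / (\<delta> n * t)\<^sup>2)) = charlier_kernel (\<delta> n) (r n) (a n) t"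
      using n by (simp add: charlier_kernel_def algebra_simps)
  qed
qed

lemma charlier_mellin_tendsto:
  fixes \<delta> r a :: "nat \<Rightarrow> real"
  assumes k: "0 < Re \<kappa>" and d: "\<delta> \<longlonglongrightarrow> 0" and d0: "\<forall>\<^sub>F n in sequentially. \<delta> n \<noteq> 0" and y: "(\<lambda>n. (a n - r n) * \<delta> n) \<longlonglongrightarrow> y" and a: "(\<lambda>n. a n * (\<delta> n)\<^sup>2) \<longlonglongrightarrow> 1"
  shows "(\<lambda>n. charlier_mellin \<kappa> (\<delta> n) (r n) (a n)) \<longlonglongrightarrow> gauss_mellin \<kappa> (of_real (- y))"
proof -
  define Y where "Y = \<bar>y\<bar> + 1"
  have Y: "0 \<le> Y" by (simp add: Y_def)
  have "\<forall>\<^sub>F n in sequentially. \<bar>\<delta> n\<bar> < 1 / (8 * (Y + 1)) \<and> (a n - r n) * \<delta> n < Y \<and> 1 / 2 < a n * (\<delta> n)\<^sup>2"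
    using tendsto_rabs [OF d] y a Y by (intro eventually_conj order_tendstoD) (auto simp: Y_def)
  then obtain n0 where n0: "\<And>n. n0 \<le> n \<Longrightarrow> \<bar>\<delta> n\<bar> < 1 / (8 * (Y + 1)) \<and> (a n - r n) * \<delta> n < Y \<and> 1 / 2 < a n * (\<delta> n)\<^sup>2"
    by (auto simp: eventually_sequentially)
  show ?thesis
    unfolding charlier_mellin_def gauss_mellin_def
  \<comment> \<open>The uniform bound holds only from \<open>n0\<close> on, while the convergence
    theorem asks for it at every index; hence the shift.\<close>
  proof (rule LIMSEQ_offset [of _ n0], rule integral_dominated_convergence)
    let ?w = "\<lambda>t. cmod (of_real (exp (8 * (Y + 1)\<^sup>2)) * (mellin_kernel \<kappa> t * of_real (exp (- 1 * t))))"
    show "integrable lborel ?w"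
      by (intro integrable_norm integrable_mult_right integrable_mellin_exp k) auto
    show "AE t in lborel. cmod (mellin_kernel \<kappa> t * of_real (charlier_kernel (\<delta> (n + n0)) (r (n + n0)) (a (n + n0)) t)) \<le> ?w t" for n
    proof (rule AE_I2)
      fix t
      show "cmod (mellin_kernel \<kappa> t * of_real (charlier_kernel (\<delta> (n + n0)) (r (n + n0)) (a (n + n0)) t)) \<le> ?w t"
      proof (cases "0 < t")
        case True
        have "charlier_kernel (\<delta> (n + n0)) (r (n + n0)) (a (n + n0)) t \<le> exp (8 * (Y + 1)\<^sup>2) * exp (- 1 * t)"
          using n0 [of "n + n0"] by (intro charlier_kernel_uniform_bound Y True) auto
        then have "cmod (mellin_kernel \<kappa> t) * charlier_kernel (\<delta> (n + n0)) (r (n + n0)) (a (n + n0)) t \<le> cmod (mellin_kernel \<kappa> t) * (exp (8 * (Y + 1)\<^sup>2) * exp (- 1 * t))"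
          by (intro mult_left_mono) auto
        then show ?thesis by (simp add: norm_mult charlier_kernel_nonneg mult_ac)
      qed (simp add: mellin_kernel_def)
    qed
    show "AE t in lborel. (\<lambda>n. mellin_kernel \<kappa> t * of_real (charlier_kernel (\<delta> (n + n0)) (r (n + n0)) (a (n + n0)) t))
        \<longlonglongrightarrow> mellin_kernel \<kappa> t * exp (- (of_real t)\<^sup>2 / 2 - of_real (- y) * of_real t)"
    proof (rule AE_I2)
      fix t
      show "(\<lambda>n. mellin_kernel \<kappa> t * of_real (charlier_kernel (\<delta> (n + n0)) (r (n + n0)) (a (n + n0)) t))
        \<longlonglongrightarrow> mellin_kernel \<kappa> t * exp (- (of_real t)\<^sup>2 / 2 - of_real (- y) * of_real t)"
      proof (cases "0 < t")
        case True
        have "exp (- (of_real t)\<^sup>2 / 2 - of_real (- y) * of_real t) = complex_of_real (exp (- t\<^sup>2 / 2 + y * t))"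
          by (simp flip: exp_of_real)
        then show ?thesis
          using LIMSEQ_ignore_initial_segment [OF charlier_kernel_tendsto [OF d d0 y a True], of n0]
          by (auto intro!: tendsto_mult tendsto_of_real simp del: of_real_exp)
      qed (simp add: mellin_kernel_def)
    qed
  qed measurable
qed

section \<open>Hitting probabilities of sampled Markov chains\<close>

lemma norm_indicator_complex: "cmod (indicator A x) = indicator A x"
  by (simp add: indicator_def)

lemma (in prob_space) integral_indicator_complex:
  assumes [measurable]: "A \<in> events"
  shows "(LINT x|M. (indicator A x :: complex)) = of_real (prob A)"
proof -
  have "(LINT x|M. (indicator A x :: complex)) = (LINT x|M. complex_of_real (indicator A x))"
    by (rule Bochner_Integration.integral_cong) (simp_all add: indicator_def)
  then show ?thesis by simp
qed

text \<open>The Markov property is stated as a product instead of a conditional probability, so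
  paths of probability 0 need no exception.\<close>

locale markov_chain_paths = prob_space M for M :: "'a measure" +
  fixes X :: "nat \<Rightarrow> 'a \<Rightarrow> nat" and P :: "nat \<Rightarrow> nat \<Rightarrow> real"
  assumes X_measurable [measurable]: "\<And>k. X k \<in> measurable M (count_space UNIV)"
    and path_step: "\<And>k s j. prob {\<omega> \<in> space M. (\<forall>i\<le>k. X i \<omega> = s i) \<and> X (Suc k) \<omega> = j}
          = prob {\<omega> \<in> space M. \<forall>i\<le>k. X i \<omega> = s i} * P (s k) j"
begin

text \<open>Sums \<open>path_step\<close> over the finitely many paths through the sets
  \<open>S l\<close>; the last position is pinned to \<open>i\<close>, so the transition factor is
  common. This lifts the Markov property to events such as staying below a level.\<close>

lemma block_step:
  assumes S: "\<And>l. l \<le> k \<Longrightarrow> finite (S l)" and i: "S k \<subseteq> {i}"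
  shows "prob {\<omega> \<in> space M. (\<forall>l\<le>k. X l \<omega> \<in> S l) \<and> X (Suc k) \<omega> = j}
    = prob {\<omega> \<in> space M. \<forall>l\<le>k. X l \<omega> \<in> S l} * P i j"
proof -
  let ?T = "PiE {..k} S"
  have T: "finite ?T" using S by (intro finite_PiE) auto
  have path: "\<exists>s\<in>?T. \<forall>l\<le>k. X l \<omega> = s l" if "\<forall>l\<le>k. X l \<omega> \<in> S l" for \<omega>
    using that by (intro bexI [of _ "restrict (\<lambda>l. X l \<omega>) {..k}"]) auto
  have disj: "s = s'" if "s \<in> ?T" "s' \<in> ?T" "\<And>l. l \<le> k \<Longrightarrow> s l = s' l" for s s'
    using that by (intro PiE_ext [of _ "{..k}" S]) auto
  have sum: "prob {\<omega> \<in> space M. (\<forall>l\<le>k. X l \<omega> \<in> S l) \<and> Q \<omega>} = (\<Sum>s\<in>?T. prob {\<omega> \<in> space M. (\<forall>l\<le>k. X l \<omega> = s l) \<and> Q \<omega>})"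
    if [measurable]: "Measurable.pred M Q" for Q
  proof -
    have "{\<omega> \<in> space M. (\<forall>l\<le>k. X l \<omega> \<in> S l) \<and> Q \<omega>} = (\<Union>s\<in>?T. {\<omega> \<in> space M. (\<forall>l\<le>k. X l \<omega> = s l) \<and> Q \<omega>})"
      using path by (auto simp: PiE_iff)
    moreover have "disjoint_family_on (\<lambda>s. {\<omega> \<in> space M. (\<forall>l\<le>k. X l \<omega> = s l) \<and> Q \<omega>}) ?T"
      unfolding disjoint_family_on_def
    proof (intro ballI impI)
      fix s s' assume "s \<in> ?T" "s' \<in> ?T" "s \<noteq> s'"
      then obtain l where "l \<le> k" "s l \<noteq> s' l" using disj by blast
      then show "{\<omega> \<in> space M. (\<forall>l\<le>k. X l \<omega> = s l) \<and> Q \<omega>} \<inter> {\<omega> \<in> space M. (\<forall>l\<le>k. X l \<omega> = s' l) \<and> Q \<omega>} = {}"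
        by auto
    qed
    ultimately show ?thesis
      using T by (simp add: finite_measure_finite_Union image_subset_iff)
  qed
  have "prob {\<omega> \<in> space M. (\<forall>l\<le>k. X l \<omega> \<in> S l) \<and> X (Suc k) \<omega> = j} =
      (\<Sum>s\<in>?T. prob {\<omega> \<in> space M. (\<forall>l\<le>k. X l \<omega> = s l) \<and> X (Suc k) \<omega> = j})"
    by (rule sum) measurable
  also have "\<dots> = (\<Sum>s\<in>?T. prob {\<omega> \<in> space M. \<forall>l\<le>k. X l \<omega> = s l} * P i j)"
  proof (rule sum.cong [OF refl])
    fix s assume "s \<in> ?T"
    then have "s k = i" using i by (auto simp: PiE_iff)
    then show "prob {\<omega> \<in> space M. (\<forall>l\<le>k. X l \<omega> = s l) \<and> X (Suc k) \<omega> = j} = prob {\<omega> \<in> space M. \<forall>l\<le>k. X l \<omega> = s l} * P i j"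
      using path_step [of k s j] by simp
  qed
  also have "\<dots> = prob {\<omega> \<in> space M. \<forall>l\<le>k. X l \<omega> \<in> S l} * P i j"
    using sum [of "\<lambda>_. True"] by (simp add: sum_distrib_right)
  finally show ?thesis .
qed

section \<open>Paths started in \<open>n\<close> and killed on leaving the states below
  \<open>L\<close>\<close>

context
  fixes n L :: nat
  assumes nL: "n < L"
begin

text \<open>The law of the killed chain without conditioning: its total mass at time 0 is the
  probability of starting in \<open>n\<close>, not 1.\<close>

definition occupation :: "nat \<Rightarrow> nat \<Rightarrow> real" where
  "occupation k i = prob {\<omega> \<in> space M. X 0 \<omega> = n \<and> (\<forall>l\<le>k. X l \<omega> < L) \<and> X k \<omega> = i}"

text \<open>The index \<open>k\<close> is the last time known to be spent below \<open>L\<close>, so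
  the landing takes place at \<open>Suc k\<close>. For \<open>j < L\<close> the event describes
  continued survival, which gives the evolution of \<open>occupation\<close>.\<close>

definition exit_event :: "nat \<Rightarrow> nat \<Rightarrow> 'a set" where
  "exit_event k j = {\<omega> \<in> space M. X 0 \<omega> = n \<and> (\<forall>l\<le>k. X l \<omega> < L) \<and> X (Suc k) \<omega> = j}"

text \<open>Between two sampling times the process may jump over the level \<open>L\<close>.\<close>

definition overshoot_event :: "nat \<Rightarrow> 'a set" where
  "overshoot_event k = {\<omega> \<in> space M. X 0 \<omega> = n \<and> (\<forall>l\<le>k. X l \<omega> < L) \<and> L < X (Suc k) \<omega>}"

lemma exit_event_measurable [measurable]: "exit_event k j \<in> sets M"
  unfolding exit_event_def by measurable

lemma overshoot_event_measurable [measurable]: "overshoot_event k \<in> sets M"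
  unfolding overshoot_event_def by measurable

lemma occupation_nonneg: "0 \<le> occupation k i"
  by (simp add: occupation_def)

lemma prob_split_position:
  assumes [measurable]: "Measurable.pred M Q"
  shows "prob {\<omega> \<in> space M. X 0 \<omega> = n \<and> (\<forall>l\<le>k. X l \<omega> < L) \<and> Q \<omega>} =
    (\<Sum>i<L. prob {\<omega> \<in> space M. X 0 \<omega> = n \<and> (\<forall>l\<le>k. X l \<omega> < L) \<and> X k \<omega> = i \<and> Q \<omega>})"
proof -
  have "{\<omega> \<in> space M. X 0 \<omega> = n \<and> (\<forall>l\<le>k. X l \<omega> < L) \<and> Q \<omega>} =
    (\<Union>i<L. {\<omega> \<in> space M. X 0 \<omega> = n \<and> (\<forall>l\<le>k. X l \<omega> < L) \<and> X k \<omega> = i \<and> Q \<omega>})"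
    by auto
  also have "prob \<dots> = (\<Sum>i<L. prob {\<omega> \<in> space M. X 0 \<omega> = n \<and> (\<forall>l\<le>k. X l \<omega> < L) \<and> X k \<omega> = i \<and> Q \<omega>})"
    by (intro finite_measure_finite_Union) (auto simp: disjoint_family_on_def)
  finally show ?thesis .
qed

lemma sum_occupation_le_1: "(\<Sum>i<L. occupation k i) \<le> 1"
proof -
  have "(\<Sum>i<L. occupation k i) = prob {\<omega> \<in> space M. X 0 \<omega> = n \<and> (\<forall>l\<le>k. X l \<omega> < L)}"
    using prob_split_position [of "\<lambda>_. True" k] by (simp add: occupation_def)
  then show ?thesis by simp
qed

lemma occupation_step:
  assumes "i < L"
  shows "prob {\<omega> \<in> space M. X 0 \<omega> = n \<and> (\<forall>l\<le>k. X l \<omega> < L) \<and> X k \<omega> = i \<and> X (Suc k) \<omega> = j} = occupation k i * P i j"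
proof -
  \<comment> \<open>All constraints on the path are put into one family of finite sets; the last set
    is {i}, or empty when k = 0 and i differs from n.\<close>
  define S where "S l = {x. x < L \<and> (l = 0 \<longrightarrow> x = n) \<and> (l = k \<longrightarrow> x = i)}" for l :: nat
  have eq: "(\<forall>l\<le>k. X l \<omega> \<in> S l) \<longleftrightarrow> X 0 \<omega> = n \<and> (\<forall>l\<le>k. X l \<omega> < L) \<and> X k \<omega> = i" for \<omega>
    by (auto simp: S_def)
  have "prob {\<omega> \<in> space M. (\<forall>l\<le>k. X l \<omega> \<in> S l) \<and> X (Suc k) \<omega> = j} = prob {\<omega> \<in> space M. \<forall>l\<le>k. X l \<omega> \<in> S l} * P i j"
    by (intro block_step) (auto simp: S_def)
  then show ?thesis
    unfolding eq by (simp add: occupation_def conj_assoc)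
qed

lemma prob_exit_event: "prob (exit_event k j) = (\<Sum>i<L. occupation k i * P i j)"
  using prob_split_position [of "\<lambda>\<omega>. X (Suc k) \<omega> = j" k] by (simp add: exit_event_def occupation_step)

lemma occupation_Suc:
  assumes "j < L"
  shows "occupation (Suc k) j = (\<Sum>i<L. occupation k i * P i j)"
proof -
  have "occupation (Suc k) j = prob (exit_event k j)"
    unfolding occupation_def exit_event_def
    by (rule arg_cong [of _ _ prob]) (use assms in \<open>auto simp: le_Suc_eq\<close>)
  then show ?thesis by (simp only: prob_exit_event)
qed

lemma occupation_0: "occupation 0 i = (if i = n then prob {\<omega> \<in> space M. X 0 \<omega> = n} else 0)"
proof (cases "i = n")
  case True
  then show ?thesis using nL unfolding occupation_def by (auto intro!: arg_cong [of _ _ prob])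
next
  case False
  then have "{\<omega> \<in> space M. X 0 \<omega> = n \<and> (\<forall>l\<le>0. X l \<omega> < L) \<and> X 0 \<omega> = i} = {}" by auto
  then show ?thesis using False by (simp only: occupation_def measure_empty if_False)
qed

text \<open>Taking the complement of the targets up to \<open>L\<close> avoids a sum over the
  infinitely many states above it.\<close>

lemma prob_overshoot_event: "prob (overshoot_event k) = (\<Sum>i<L. occupation k i * (1 - (\<Sum>j\<le>L. P i j)))"
proof -
  have "prob {\<omega> \<in> space M. X 0 \<omega> = n \<and> (\<forall>l\<le>k. X l \<omega> < L) \<and> X k \<omega> = i \<and> L < X (Suc k) \<omega>} = occupation k i * (1 - (\<Sum>j\<le>L. P i j))"
    if i: "i < L" for i
  proof -
    define A where "A = {\<omega> \<in> space M. X 0 \<omega> = n \<and> (\<forall>l\<le>k. X l \<omega> < L) \<and> X k \<omega> = i}"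
    define B where "B j = {\<omega> \<in> space M. X 0 \<omega> = n \<and> (\<forall>l\<le>k. X l \<omega> < L) \<and> X k \<omega> = i \<and> X (Suc k) \<omega> = j}" for j
    have [measurable]: "A \<in> events" unfolding A_def by measurable
    have B_eq: "B j = A \<inter> exit_event k j" for j
      by (auto simp: A_def B_def exit_event_def)
    have [measurable]: "B j \<in> events" for j unfolding B_eq by measurable
    have "{\<omega> \<in> space M. X 0 \<omega> = n \<and> (\<forall>l\<le>k. X l \<omega> < L) \<and> X k \<omega> = i \<and> L < X (Suc k) \<omega>} = A - (\<Union>j\<le>L. B j)"
      by (auto simp: A_def B_def not_less)
    also have "prob \<dots> = prob A - prob (\<Union>j\<le>L. B j)"
      by (intro finite_measure_Diff) (auto simp: B_eq)
    also have "prob (\<Union>j\<le>L. B j) = (\<Sum>j\<le>L. prob (B j))"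
    proof (rule finite_measure_finite_Union)
      show "B ` {..L} \<subseteq> events" by auto
      show "disjoint_family_on B {..L}"
        by (auto simp: disjoint_family_on_def B_eq exit_event_def)
    qed simp
    also have "\<dots> = (\<Sum>j\<le>L. occupation k i * P i j)"
      unfolding B_def occupation_step [OF i] ..
    also have "prob A = occupation k i"
      unfolding A_def occupation_def ..
    finally show ?thesis
      by (simp add: right_diff_distrib sum_distrib_left)
  qed
  then show ?thesis
    using prob_split_position [of "\<lambda>\<omega>. L < X (Suc k) \<omega>" k] by (simp add: overshoot_event_def)
qed

lemma prob_overshoot_le:
  assumes "\<And>i. i < L \<Longrightarrow> 1 - (\<Sum>j\<le>L. P i j) \<le> \<epsilon>" "0 \<le> \<epsilon>"
  shows "prob (overshoot_event k) \<le> \<epsilon>"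
proof -
  have "prob (overshoot_event k) \<le> (\<Sum>i<L. occupation k i * \<epsilon>)"
    unfolding prob_overshoot_event
    by (intro sum_mono mult_left_mono assms occupation_nonneg) auto
  also have "\<dots> = (\<Sum>i<L. occupation k i) * \<epsilon>" by (simp add: sum_distrib_right)
  also have "\<dots> \<le> 1 * \<epsilon>" using assms(2) by (intro mult_right_mono sum_occupation_le_1)
  finally show ?thesis by simp
qed

text \<open>
  Discrete Dynkin formula: \<open>w\<^bsup>k\<^esup> U (X k)\<close>, stopped on leaving the states below \<open>L\<close>, is a martingale
  up to an error \<open>\<epsilon>\<close> per step; overshooting the level is treated as absorption with value 0.
\<close>

lemma exit_sum_bound:
  fixes w :: complex and U :: "nat \<Rightarrow> complex"
  assumes w: "cmod w < 1" and \<epsilon>: "0 \<le> \<epsilon>"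
    and U: "\<And>i. i < L \<Longrightarrow> cmod (U i - w * (\<Sum>j\<le>L. of_real (P i j) * U j)) \<le> \<epsilon>"
  shows "cmod (of_real (prob {\<omega> \<in> space M. X 0 \<omega> = n}) * U n - (\<Sum>k. w ^ Suc k * of_real (prob (exit_event k L))) * U L) \<le> \<epsilon> / (1 - cmod w)"
proof -
  define s where "s k = (\<Sum>i<L. of_real (occupation k i) * U i)" for k
  define R where "R k = (\<Sum>i<L. of_real (occupation k i) * (U i - w * (\<Sum>j\<le>L. of_real (P i j) * U j)))" for k
  \<comment> \<open>After one step the mass is either below \<open>L\<close>, giving the next
    \<open>s\<close>, or on \<open>L\<close>; overshooting mass does not occur in the sum over
    \<open>j \<le> L\<close>.\<close>
  have R: "s k = R k + w * (s (Suc k) + of_real (prob (exit_event k L)) * U L)" for k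
  proof -
    have "(\<Sum>i<L. of_real (occupation k i) * (\<Sum>j\<le>L. of_real (P i j) * U j)) = (\<Sum>j\<le>L. \<Sum>i<L. of_real (occupation k i) * (of_real (P i j) * U j))"
      unfolding sum_distrib_left by (rule sum.swap)
    also have "\<dots> = (\<Sum>j\<le>L. of_real (\<Sum>i<L. occupation k i * P i j) * U j)"
      by (simp add: sum_distrib_right mult.assoc)
    also have "\<dots> = (\<Sum>j<L. of_real (\<Sum>i<L. occupation k i * P i j) * U j) + of_real (prob (exit_event k L)) * U L"
      by (simp add: lessThan_Suc_atMost [symmetric] prob_exit_event)
    also have "(\<Sum>j<L. of_real (\<Sum>i<L. occupation k i * P i j) * U j) = s (Suc k)"
      unfolding s_def by (intro sum.cong) (auto simp: occupation_Suc)
    finally have *: "(\<Sum>i<L. of_real (occupation k i) * (\<Sum>j\<le>L. of_real (P i j) * U j)) = s (Suc k) + of_real (prob (exit_event k L)) * U L" .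
    have "R k = s k - w * (\<Sum>i<L. of_real (occupation k i) * (\<Sum>j\<le>L. of_real (P i j) * U j))"
      by (simp add: R_def s_def right_diff_distrib sum_subtractf sum_distrib_left mult_ac)
    then show ?thesis unfolding * by simp
  qed
  have R_bound: "cmod (R k) \<le> \<epsilon>" for k
  proof -
    have "cmod (R k) \<le> (\<Sum>i<L. occupation k i * \<epsilon>)"
      unfolding R_def using U occupation_nonneg
      by (intro sum_norm_le) (auto simp: norm_mult intro!: mult_left_mono)
    also have "\<dots> = (\<Sum>i<L. occupation k i) * \<epsilon>" by (simp add: sum_distrib_right)
    also have "\<dots> \<le> 1 * \<epsilon>" using \<epsilon> by (intro mult_right_mono sum_occupation_le_1)
    finally show ?thesis by simp
  qed
  have tele: "s 0 - w ^ K * s K - (\<Sum>k<K. w ^ Suc k * of_real (prob (exit_event k L))) * U L = (\<Sum>k<K. w ^ k * R k)" for K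
  proof (induction K)
    case (Suc K)
    have "w ^ K * s K = w ^ K * R K + w ^ Suc K * s (Suc K) + w ^ Suc K * of_real (prob (exit_event K L)) * U L"
      by (subst R) (simp add: algebra_simps)
    then show ?case using Suc by (simp add: algebra_simps)
  qed simp
  have geo: "summable (\<lambda>k. cmod w ^ k)" using w by (simp add: summable_geometric)
  have summ: "summable (\<lambda>k. w ^ Suc k * of_real (prob (exit_event k L)))"
  proof (rule summable_comparison_test' [OF geo])
    fix k
    have "cmod (w ^ Suc k * of_real (prob (exit_event k L))) \<le> cmod w ^ Suc k * 1"
      unfolding norm_mult norm_power by (intro mult_left_mono) auto
    also have "\<dots> \<le> cmod w ^ k" using w by (simp add: mult_left_le_one_le)
    finally show "cmod (w ^ Suc k * of_real (prob (exit_event k L))) \<le> cmod w ^ k" .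
  qed
  have s_bound: "cmod (s k) \<le> (\<Sum>i<L. cmod (U i))" for k
    unfolding s_def
  proof (intro sum_norm_le)
    fix i
    have "occupation k i \<le> 1" by (simp add: occupation_def)
    then show "cmod (of_real (occupation k i) * U i) \<le> cmod (U i)"
      using occupation_nonneg [of k i] by (simp add: norm_mult mult_left_le_one_le)
  qed
  \<comment> \<open>Only finitely many states lie below \<open>L\<close>, so \<open>s\<close> is
    bounded and the discount removes the contribution of paths that never leave.\<close>
  have "(\<lambda>K. w ^ K * s K) \<longlonglongrightarrow> 0"
  proof (rule Lim_null_comparison)
    show "\<forall>\<^sub>F K in sequentially. cmod (w ^ K * s K) \<le> cmod w ^ K * (\<Sum>i<L. cmod (U i))"
      by (intro always_eventually allI) (auto simp: norm_mult norm_power intro!: mult_left_mono s_bound)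
    show "(\<lambda>K. cmod w ^ K * (\<Sum>i<L. cmod (U i))) \<longlonglongrightarrow> 0"
      using w by (intro tendsto_mult_left_zero LIMSEQ_power_zero) auto
  qed
  then have "(\<lambda>K. s 0 - w ^ K * s K - (\<Sum>k<K. w ^ Suc k * of_real (prob (exit_event k L))) * U L) \<longlonglongrightarrow>
      s 0 - 0 - (\<Sum>k. w ^ Suc k * of_real (prob (exit_event k L))) * U L"
    by (intro tendsto_intros summable_LIMSEQ summ)
  then have lim: "(\<lambda>K. \<Sum>k<K. w ^ k * R k) \<longlonglongrightarrow> s 0 - (\<Sum>k. w ^ Suc k * of_real (prob (exit_event k L))) * U L"
    unfolding tele by simp
  have "cmod (\<Sum>k<K. w ^ k * R k) \<le> \<epsilon> / (1 - cmod w)" for K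
  proof -
    have "cmod (\<Sum>k<K. w ^ k * R k) \<le> (\<Sum>k<K. cmod w ^ k * \<epsilon>)"
      by (intro sum_norm_le) (auto simp: norm_mult norm_power intro!: mult_left_mono R_bound)
    also have "\<dots> = (\<Sum>k<K. cmod w ^ k) * \<epsilon>" by (simp add: sum_distrib_right)
    also have "\<dots> \<le> (\<Sum>k. cmod w ^ k) * \<epsilon>"
      using geo \<epsilon> by (intro mult_right_mono sum_le_suminf) auto
    also have "\<dots> = \<epsilon> / (1 - cmod w)"
      using w by (simp add: suminf_geometric)
    finally show ?thesis .
  qed
  then have "cmod (s 0 - (\<Sum>k. w ^ Suc k * of_real (prob (exit_event k L))) * U L) \<le> \<epsilon> / (1 - cmod w)"
    using LIMSEQ_le_const2 [OF tendsto_norm [OF lim]] by blast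
  moreover have "s 0 = of_real (prob {\<omega> \<in> space M. X 0 \<omega> = n}) * U n"
    using nL by (simp add: s_def occupation_0 if_distrib [of of_real] mult_delta_left cong: if_cong)
  ultimately show ?thesis by simp
qed

text \<open>This counts the first visit to \<open>L\<close> even after an earlier jump over it, as
  the sampled first passage time requires. The series over \<open>exit_event\<close> ignores such
  visits, and the two have to be compared.\<close>

definition first_hit_value :: "complex \<Rightarrow> 'a \<Rightarrow> complex" where
  "first_hit_value w \<omega> = (if X 0 \<omega> = n \<and> (\<exists>k. X k \<omega> = L) then w ^ (LEAST k. X k \<omega> = L) else 0)"

lemma first_hit_value_measurable [measurable]: "first_hit_value w \<in> borel_measurable M"
proof -
  have "(\<lambda>\<omega>. LEAST k. X k \<omega> = L) \<in> measurable M (count_space UNIV)" by measurable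
  then have [measurable]: "(\<lambda>\<omega>. w ^ (LEAST k. X k \<omega> = L)) \<in> borel_measurable M"
    by (rule measurable_compose) auto
  show ?thesis unfolding first_hit_value_def by measurable
qed

lemma norm_first_hit_value:
  assumes "cmod w < 1" shows "cmod (first_hit_value w \<omega>) \<le> 1"
  using assms by (simp add: first_hit_value_def norm_power power_le_one)

text \<open>Both sides are decided at the first time \<open>T\<close> at or above \<open>L\<close>.
  Landing on \<open>L\<close> makes the two values equal; overshooting makes the exit series 0 and
  is paid for by the matching term of the overshoot series.\<close>

lemma first_hit_value_exit_bound:
  assumes w: "cmod w < 1" and \<omega>: "\<omega> \<in> space M"
  shows "cmod (first_hit_value w \<omega> - (\<Sum>k. w ^ Suc k * indicator (exit_event k L) \<omega>)) \<le> (\<Sum>k. cmod w ^ Suc k * indicator (overshoot_event k) \<omega>)"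
proof (cases "X 0 \<omega> = n \<and> (\<exists>k. L \<le> X k \<omega>)")
  case True
  define T where "T = (LEAST k. L \<le> X k \<omega>)"
  have XT: "L \<le> X T \<omega>" unfolding T_def using True by (metis LeastI)
  have lessT: "X l \<omega> < L" if "l < T" for l
    using that not_less_Least [of l "\<lambda>k. L \<le> X k \<omega>"] unfolding T_def by auto
  have "T \<noteq> 0" using XT True nL by (auto intro: ccontr)
  then obtain k where k: "T = Suc k" by (cases T) auto
  have other: "(\<forall>l\<le>k'. X l \<omega> < L) \<and> L \<le> X (Suc k') \<omega> \<longleftrightarrow> k' = k" for k'
  proof
    assume *: "(\<forall>l\<le>k'. X l \<omega> < L) \<and> L \<le> X (Suc k') \<omega>"
    have "\<not> T \<le> k'" using * XT by (meson not_le)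
    moreover have "\<not> Suc k' < T" using * lessT [of "Suc k'"] by auto
    ultimately show "k' = k" using k by simp
  next
    assume "k' = k"
    then show "(\<forall>l\<le>k'. X l \<omega> < L) \<and> L \<le> X (Suc k') \<omega>" using lessT XT k by auto
  qed
  have exit_iff: "\<omega> \<in> exit_event k' L \<longleftrightarrow> k' = k \<and> X T \<omega> = L" for k'
  proof (cases "k' = k")
    case True
    then show ?thesis using other [of k'] \<omega> \<open>X 0 \<omega> = n \<and> _\<close> k by (simp add: exit_event_def)
  next
    case False
    then have "\<not> ((\<forall>l\<le>k'. X l \<omega> < L) \<and> L \<le> X (Suc k') \<omega>)" using other by simp
    then show ?thesis using False by (auto simp: exit_event_def)
  qed
  have over_iff: "\<omega> \<in> overshoot_event k' \<longleftrightarrow> k' = k \<and> L < X T \<omega>" for k'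
  proof (cases "k' = k")
    case True
    then show ?thesis using other [of k'] \<omega> \<open>X 0 \<omega> = n \<and> _\<close> k by (simp add: overshoot_event_def)
  next
    case False
    then have "\<not> ((\<forall>l\<le>k'. X l \<omega> < L) \<and> L \<le> X (Suc k') \<omega>)" using other by simp
    then show ?thesis using False by (auto simp: overshoot_event_def)
  qed
  have single: "(\<Sum>k'. if k' = k then g k' else 0) = g k" for g :: "nat \<Rightarrow> 'b :: {comm_monoid_add,t2_space}"
    using sums_unique [OF sums_single [of k g]] by simp
  show ?thesis
  proof (cases "X T \<omega> = L")
    case hit: True
    have "(\<lambda>k'. w ^ Suc k' * indicator (exit_event k' L) \<omega>) = (\<lambda>k'. if k' = k then w ^ Suc k' else 0)"
      using hit by (simp add: exit_iff indicator_def fun_eq_iff)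
    then have "(\<Sum>k. w ^ Suc k * indicator (exit_event k L) \<omega>) = w ^ T"
      using single [of "\<lambda>k. w ^ Suc k"] k by simp
    moreover have "(LEAST k. X k \<omega> = L) = T"
    proof (rule Least_equality [where P = "\<lambda>k. X k \<omega> = L", OF hit])
      fix y assume "X y \<omega> = L"
      then show "T \<le> y" using lessT [of y] by (cases "y < T") auto
    qed
    then have "first_hit_value w \<omega> = w ^ T"
      using True hit by (auto simp: first_hit_value_def)
    moreover have "(\<lambda>k'. cmod w ^ Suc k' * indicator (overshoot_event k') \<omega>) = (\<lambda>_. 0)"
      using hit by (simp add: over_iff indicator_def fun_eq_iff)
    ultimately show ?thesis by simp
  next
    case over: False
    have "(\<lambda>k'. w ^ Suc k' * indicator (exit_event k' L) \<omega>) = (\<lambda>_. 0)"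
      using over by (simp add: exit_iff indicator_def fun_eq_iff)
    moreover have "(\<lambda>k'. cmod w ^ Suc k' * indicator (overshoot_event k') \<omega>) = (\<lambda>k'. if k' = k then cmod w ^ Suc k' else 0)"
      using over XT by (simp add: over_iff indicator_def fun_eq_iff)
    then have "(\<Sum>k. cmod w ^ Suc k * indicator (overshoot_event k) \<omega>) = cmod w ^ T"
      using single [of "\<lambda>k. cmod w ^ Suc k"] k by simp
    \<comment> \<open>A path that has jumped over \<open>L\<close> can return to it only after
      \<open>T\<close>, when the discount is at most |w|^T.\<close>
    moreover have "cmod (first_hit_value w \<omega>) \<le> cmod w ^ T"
    proof (cases "\<exists>k. X k \<omega> = L")
      case ex: True
      then have "X (LEAST k. X k \<omega> = L) \<omega> = L" by (metis (mono_tags, lifting) LeastI)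
      then have "T \<le> (LEAST k. X k \<omega> = L)" using lessT by (metis not_le less_irrefl)
      then show ?thesis using w True ex by (simp add: first_hit_value_def norm_power power_decreasing)
    qed (simp add: first_hit_value_def)
    ultimately show ?thesis by simp
  qed
next
  case False
  then have "first_hit_value w \<omega> = 0"
    by (auto simp: first_hit_value_def)
  moreover have over: "(\<lambda>k. cmod w ^ Suc k * indicator (overshoot_event k) \<omega>) = (\<lambda>_. 0)"
  proof -
    have "\<omega> \<notin> overshoot_event k" for k
      using False by (auto simp: overshoot_event_def intro: less_imp_le)
    then show ?thesis by simp
  qed
  moreover have "(\<lambda>k. w ^ Suc k * indicator (exit_event k L) \<omega>) = (\<lambda>_. 0)"
    using False by (auto simp: exit_event_def fun_eq_iff indicator_def)
  ultimately show ?thesis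
    using over by simp
qed

text \<open>Two errors of size \<epsilon> / (1 - |w|) add up: the martingale error, and the
  overshoot probability, which is weighted by |U L|.\<close>

lemma expectation_first_hit_bound:
  fixes w :: complex and U :: "nat \<Rightarrow> complex"
  assumes w: "cmod w < 1" and \<epsilon>: "0 \<le> \<epsilon>"
    and U: "\<And>i. i < L \<Longrightarrow> cmod (U i - w * (\<Sum>j\<le>L. of_real (P i j) * U j)) \<le> \<epsilon>"
    and over: "\<And>i. i < L \<Longrightarrow> 1 - (\<Sum>j\<le>L. P i j) \<le> \<epsilon>"
  shows "cmod (of_real (prob {\<omega> \<in> space M. X 0 \<omega> = n}) * U n - (LINT \<omega>|M. first_hit_value w \<omega>) * U L)
    \<le> (1 + cmod (U L)) * (\<epsilon> / (1 - cmod w))"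
proof -
  have geo: "summable (\<lambda>k. cmod w ^ k)" using w by (simp add: summable_geometric)
  have geo': "summable (\<lambda>k. cmod w ^ Suc k)" using geo by (simp only: summable_Suc_iff)
  have sums_Y: "summable (\<lambda>k. LINT \<omega>|M. cmod (w ^ Suc k * indicator (exit_event k L) \<omega>))"
    and sums_Z: "summable (\<lambda>k. LINT \<omega>|M. norm (cmod w ^ Suc k * indicator (overshoot_event k) \<omega>))"
  proof -
    have "(LINT \<omega>|M. cmod (w ^ Suc k * indicator (exit_event k L) \<omega>)) = cmod w ^ Suc k * prob (exit_event k L)" for k
      unfolding norm_mult norm_power by (simp add: norm_indicator_complex del: power_Suc)
    then show "summable (\<lambda>k. LINT \<omega>|M. cmod (w ^ Suc k * indicator (exit_event k L) \<omega>))"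
      by (intro summable_comparison_test' [OF geo']) (simp add: mult_left_le del: power_Suc)
    have "(LINT \<omega>|M. norm (cmod w ^ Suc k * indicator (overshoot_event k) \<omega>)) = cmod w ^ Suc k * prob (overshoot_event k)" for k
      by (simp add: abs_mult del: power_Suc)
    then show "summable (\<lambda>k. LINT \<omega>|M. norm (cmod w ^ Suc k * indicator (overshoot_event k) \<omega>))"
      by (intro summable_comparison_test' [OF geo']) (simp add: mult_left_le del: power_Suc)
  qed
  have int_Y: "integrable M (\<lambda>\<omega>. w ^ Suc k * indicator (exit_event k L) \<omega>)" for k
    by (rule integrable_const_bound [of _ "cmod w ^ Suc k"]) (auto simp: norm_mult norm_power indicator_def)
  have int_Z: "integrable M (\<lambda>\<omega>. cmod w ^ Suc k * indicator (overshoot_event k) \<omega>)" for k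
    by (rule integrable_const_bound [of _ "cmod w ^ Suc k"]) (auto simp: indicator_def)
  have ae_Y: "AE \<omega> in M. summable (\<lambda>k. cmod (w ^ Suc k * indicator (exit_event k L) \<omega>))"
    by (intro AE_I2 summable_comparison_test' [OF geo']) (auto simp: norm_mult norm_power indicator_def)
  have ae_Z: "AE \<omega> in M. summable (\<lambda>k. norm (cmod w ^ Suc k * indicator (overshoot_event k) \<omega>))"
    by (intro AE_I2 summable_comparison_test' [OF geo']) (auto simp: norm_mult norm_power indicator_def)
  let ?Y = "\<lambda>\<omega>. \<Sum>k. w ^ Suc k * indicator (exit_event k L) \<omega>"
  let ?Z = "\<lambda>\<omega>. \<Sum>k. cmod w ^ Suc k * indicator (overshoot_event k) \<omega>"
  have Y: "integrable M ?Y" "(LINT \<omega>|M. ?Y \<omega>) = (\<Sum>k. w ^ Suc k * of_real (prob (exit_event k L)))"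
    using integrable_suminf [OF int_Y ae_Y sums_Y] integral_suminf [OF int_Y ae_Y sums_Y]
    by (simp_all add: integral_indicator_complex del: power_Suc)
  have Z: "integrable M ?Z" "(LINT \<omega>|M. ?Z \<omega>) = (\<Sum>k. cmod w ^ Suc k * prob (overshoot_event k))"
    using integrable_suminf [OF int_Z ae_Z sums_Z] integral_suminf [OF int_Z ae_Z sums_Z]
    by (simp_all del: power_Suc)
  have V: "integrable M (first_hit_value w)"
    using norm_first_hit_value [OF w] by (intro integrable_const_bound [of _ 1]) auto
  have "cmod ((LINT \<omega>|M. first_hit_value w \<omega>) - (LINT \<omega>|M. ?Y \<omega>)) = cmod (LINT \<omega>|M. first_hit_value w \<omega> - ?Y \<omega>)"
    using V Y(1) by simp
  also have "\<dots> \<le> (LINT \<omega>|M. ?Z \<omega>)"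
    using V Y(1) Z(1) first_hit_value_exit_bound [OF w]
    by (intro order_trans [OF integral_norm_bound integral_mono]) auto
  also have "\<dots> \<le> (\<Sum>k. cmod w ^ k * \<epsilon>)"
    unfolding Z(2)
  proof (rule suminf_le)
    show "cmod w ^ Suc k * prob (overshoot_event k) \<le> cmod w ^ k * \<epsilon>" for k
      using w prob_overshoot_le [OF over \<epsilon>, of k]
      by (intro mult_mono) (auto simp: mult_left_le_one_le)
    show "summable (\<lambda>k. cmod w ^ k * \<epsilon>)" using geo by (rule summable_mult2)
    show "summable (\<lambda>k. cmod w ^ Suc k * prob (overshoot_event k))"
      by (rule summable_comparison_test' [OF geo']) (auto simp: mult_left_le simp del: power_Suc)
  qed
  also have "\<dots> = \<epsilon> / (1 - cmod w)"
    using geo w by (simp add: suminf_mult2 [symmetric] suminf_geometric)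
  finally have VY: "cmod ((LINT \<omega>|M. ?Y \<omega>) - (LINT \<omega>|M. first_hit_value w \<omega>)) \<le> \<epsilon> / (1 - cmod w)"
    by (simp add: norm_minus_commute)
  let ?u = "of_real (prob {\<omega> \<in> space M. X 0 \<omega> = n}) * U n"
  have "?u - (LINT \<omega>|M. first_hit_value w \<omega>) * U L = (?u - (LINT \<omega>|M. ?Y \<omega>) * U L) + ((LINT \<omega>|M. ?Y \<omega>) - (LINT \<omega>|M. first_hit_value w \<omega>)) * U L"
    by (simp add: left_diff_distrib)
  also have "cmod \<dots> \<le> \<epsilon> / (1 - cmod w) + \<epsilon> / (1 - cmod w) * cmod (U L)"
  proof (rule norm_triangle_mono)
    show "cmod (?u - (LINT \<omega>|M. ?Y \<omega>) * U L) \<le> \<epsilon> / (1 - cmod w)"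
      using exit_sum_bound [OF w \<epsilon> U] unfolding Y(2) .
    show "cmod (((LINT \<omega>|M. ?Y \<omega>) - (LINT \<omega>|M. first_hit_value w \<omega>)) * U L) \<le> \<epsilon> / (1 - cmod w) * cmod (U L)"
      unfolding norm_mult using VY by (rule mult_right_mono) simp
  qed
  finally show ?thesis by (simp add: algebra_simps add_divide_distrib)
qed

end

end

section \<open>Laplace transforms of first passage times\<close>

text \<open>The off-diagonal part of the generator; the diagonal value is 0 here, and the exit rate
  is treated separately.\<close>

definition jump_rate :: "(nat \<Rightarrow> real) \<Rightarrow> (nat \<Rightarrow> real) \<Rightarrow> nat \<Rightarrow> nat \<Rightarrow> real" where
  "jump_rate birth death i j = (if j = Suc i then birth i else if i = Suc j then death i else 0)"

section \<open>Infinitesimal behaviour of the transition function\<close>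

lemma transition_sum_le_1:
  assumes "transition_function p" "0 \<le> t" "finite F"
  shows "(\<Sum>j\<in>F. p t i j) \<le> 1"
proof -
  have "(\<lambda>j. p t i j) sums 1" "\<And>j. 0 \<le> p t i j"
    using assms by (auto simp: transition_function_def)
  then show ?thesis
    using sum_le_suminf [of "p t i" F] assms(3) by (simp add: sums_iff)
qed

text \<open>Rates to states other than the neighbours are not prescribed but forced to be 0: the
  exit rate of \<open>i\<close> is already exhausted by its neighbours, which squeezes
  \<open>p h i j / h\<close> between 0 and the vanishing defect \<open>D\<close>.\<close>

lemma transition_rate:
  assumes p: "transition_function p" and r: "has_birth_death_rates p birth death" and ij: "i \<noteq> j"
  shows "((\<lambda>h. p h i j / h) \<longlongrightarrow> jump_rate birth death i j) (at_right 0)"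
proof -
  have b: "\<And>i. ((\<lambda>h. p h i (Suc i) / h) \<longlongrightarrow> birth i) (at_right 0)"
    and d: "\<And>i. ((\<lambda>h. p h (Suc i) i / h) \<longlongrightarrow> death (Suc i)) (at_right 0)"
    and s: "\<And>i. ((\<lambda>h. (1 - p h i i) / h) \<longlongrightarrow> birth i + death i) (at_right 0)"
    and d0: "death 0 = 0"
    using r by (auto simp: has_birth_death_rates_def)
  consider "j = Suc i" | "i = Suc j" | "j \<noteq> Suc i" "i \<noteq> Suc j" by blast
  then show ?thesis
  proof cases
    case 1 then show ?thesis using b by (simp add: jump_rate_def)
  next
    case 2 then show ?thesis using d by (simp add: jump_rate_def)
  next
    case 3
    \<comment> \<open>The lower neighbour, which is absent at 0; there \<open>death 0 = 0\<close>
      makes the empty sum the right limit.\<close>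
    define F where "F = (if i = 0 then {} else {i - 1})"
    define D where "D h = (1 - p h i i) / h - p h i (Suc i) / h - (\<Sum>l\<in>F. p h i l / h)" for h
    have F: "finite F" "i \<notin> F" "Suc i \<notin> F" "j \<notin> F"
      using 3 by (auto simp: F_def)
    have down: "((\<lambda>h. \<Sum>l\<in>F. p h i l / h) \<longlongrightarrow> death i) (at_right 0)"
      using d [of "i - 1"] d0 by (cases i) (auto simp: F_def)
    have "(D \<longlongrightarrow> birth i + death i - birth i - death i) (at_right 0)"
      unfolding D_def by (intro tendsto_intros s b down)
    then have D: "(D \<longlongrightarrow> 0) (at_right 0)" by simp
    have "((\<lambda>h. p h i j / h) \<longlongrightarrow> 0) (at_right 0)"
    proof (rule tendsto_sandwich [OF _ _ tendsto_const D])
      have nonneg: "0 \<le> p h i j / h \<and> p h i j / h \<le> D h" if h: "0 < h" for h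
      proof
        have "0 \<le> p h i j" using p h by (auto simp: transition_function_def)
        then show "0 \<le> p h i j / h" using h by simp
        have "(\<Sum>l\<in>insert j (insert i (insert (Suc i) F)). p h i l) \<le> 1"
          using h F by (intro transition_sum_le_1 p) auto
        then have "p h i j \<le> 1 - p h i i - p h i (Suc i) - (\<Sum>l\<in>F. p h i l)"
          using F 3 ij by (auto simp: insert_ident)
        then have "p h i j / h \<le> (1 - p h i i - p h i (Suc i) - (\<Sum>l\<in>F. p h i l)) / h"
          using h by (simp add: divide_right_mono)
        also have "\<dots> = D h" by (simp add: D_def diff_divide_distrib sum_divide_distrib)
        finally show "p h i j / h \<le> D h" .
      qed
      show "\<forall>\<^sub>F h in at_right 0. 0 \<le> p h i j / h" "\<forall>\<^sub>F h in at_right 0. p h i j / h \<le> D h"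
        using nonneg by (auto simp: eventually_at_right_less intro!: eventually_mono [OF eventually_at_right_less [of 0]])
    qed
    then show ?thesis using 3 by (simp add: jump_rate_def)
  qed
qed

lemma generator_sum:
  fixes U :: "nat \<Rightarrow> complex"
  assumes "i < L" "death 0 = 0"
  shows "(\<Sum>j\<in>{..L} - {i}. of_real (jump_rate birth death i j) * U j) = of_real (birth i) * U (Suc i) + of_real (death i) * U (i - 1)"
proof (cases i)
  case 0
  have "(\<Sum>j\<in>{..L} - {i}. of_real (jump_rate birth death i j) * U j) = (\<Sum>j\<in>{Suc i}. of_real (jump_rate birth death i j) * U j)"
    using assms 0 by (intro sum.mono_neutral_right) (auto simp: jump_rate_def)
  then show ?thesis using 0 assms by (simp add: jump_rate_def)
next
  case (Suc l)
  have "(\<Sum>j\<in>{..L} - {i}. of_real (jump_rate birth death i j) * U j) = (\<Sum>j\<in>{Suc i, l}. of_real (jump_rate birth death i j) * U j)"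
    using assms Suc by (intro sum.mono_neutral_right) (auto simp: jump_rate_def)
  then show ?thesis using Suc by (simp add: jump_rate_def)
qed

text \<open>Differentiates at h = 0 both the discount and the transition function. Truncating the
  sum at \<open>L\<close> loses nothing in the limit, since \<open>i < L\<close> keeps both
  neighbours; at i = 0 the truncated predecessor is multiplied by
  \<open>death 0 = 0\<close>.\<close>

lemma generator_limit:
  fixes U :: "nat \<Rightarrow> complex" and \<theta> :: complex
  assumes p: "transition_function p" and r: "has_birth_death_rates p birth death" and i: "i < L"
  shows "((\<lambda>h. (U i - exp (- \<theta> * of_real h) * (\<Sum>j\<le>L. of_real (p h i j) * U j)) / of_real h) \<longlongrightarrow>
    (\<theta> + of_real (birth i) + of_real (death i)) * U i - (of_real (birth i) * U (Suc i) + of_real (death i) * U (i - 1))) (at_right 0)"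
proof -
  have d0: "death 0 = 0" and s: "((\<lambda>h. (1 - p h i i) / h) \<longlongrightarrow> birth i + death i) (at_right 0)"
    using r by (auto simp: has_birth_death_rates_def)
  have w0: "((\<lambda>h::real. exp (- \<theta> * of_real h)) \<longlongrightarrow> exp (- \<theta> * of_real 0)) (at_right 0)"
    by (intro tendsto_intros)
  have "((\<lambda>z. 1 - exp (- \<theta> * z)) has_field_derivative \<theta>) (at 0)"
    by (auto intro!: derivative_eq_intros)
  then have "((\<lambda>z. (1 - exp (- \<theta> * z)) / z) \<longlongrightarrow> \<theta>) (at 0)"
    by (simp add: has_field_derivative_iff)
  moreover have "filterlim complex_of_real (at 0) (at_right 0)"
    unfolding filterlim_at
  proof
    show "\<forall>\<^sub>F h in at_right 0. complex_of_real h \<in> UNIV \<and> complex_of_real h \<noteq> 0"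
      using eventually_at_right_less [of "0::real"] by eventually_elim simp
    show "(complex_of_real \<longlongrightarrow> 0) (at_right 0)"
      using tendsto_of_real [OF tendsto_ident_at [of "0::real" "{0<..}"], where 'a = complex] by simp
  qed
  ultimately have w1: "((\<lambda>h. (1 - exp (- \<theta> * of_real h)) / of_real h) \<longlongrightarrow> \<theta>) (at_right 0)"
    by (rule filterlim_compose)
  have "((\<lambda>h. (1 - exp (- \<theta> * of_real h)) / of_real h * U i
      + exp (- \<theta> * of_real h) * (of_real ((1 - p h i i) / h) * U i)
      - exp (- \<theta> * of_real h) * (\<Sum>j\<in>{..L} - {i}. of_real (p h i j / h) * U j)) \<longlongrightarrow>
    \<theta> * U i + exp (- \<theta> * of_real 0) * (of_real (birth i + death i) * U i)
      - exp (- \<theta> * of_real 0) * (\<Sum>j\<in>{..L} - {i}. of_real (jump_rate birth death i j) * U j)) (at_right 0)"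
    by (intro tendsto_add tendsto_diff tendsto_mult tendsto_sum tendsto_of_real w0 w1 s transition_rate [OF p r] tendsto_const) auto
  then have "((\<lambda>h. (1 - exp (- \<theta> * of_real h)) / of_real h * U i
      + exp (- \<theta> * of_real h) * (of_real ((1 - p h i i) / h) * U i)
      - exp (- \<theta> * of_real h) * (\<Sum>j\<in>{..L} - {i}. of_real (p h i j / h) * U j)) \<longlongrightarrow>
    (\<theta> + of_real (birth i) + of_real (death i)) * U i - (of_real (birth i) * U (Suc i) + of_real (death i) * U (i - 1))) (at_right 0)"
    unfolding generator_sum [where death = death, OF i d0] by (simp add: algebra_simps)
  then show ?thesis
  proof (rule Lim_transform_eventually)
    show "\<forall>\<^sub>F h in at_right 0. (1 - exp (- \<theta> * of_real h)) / of_real h * U i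
      + exp (- \<theta> * of_real h) * (of_real ((1 - p h i i) / h) * U i)
      - exp (- \<theta> * of_real h) * (\<Sum>j\<in>{..L} - {i}. of_real (p h i j / h) * U j)
      = (U i - exp (- \<theta> * of_real h) * (\<Sum>j\<le>L. of_real (p h i j) * U j)) / of_real h"
      using eventually_at_right_less [of "0::real"]
    proof eventually_elim
      case (elim h)
      have "(\<Sum>j\<le>L. of_real (p h i j) * U j) = of_real (p h i i) * U i + (\<Sum>j\<in>{..L} - {i}. of_real (p h i j) * U j)"
        using i by (intro sum.remove) auto
      moreover have "(\<Sum>j\<in>{..L} - {i}. of_real (p h i j / h) * U j) = (\<Sum>j\<in>{..L} - {i}. of_real (p h i j) * U j) / of_real h"
        by (simp add: sum_divide_distrib)
      ultimately show ?case using elim by (simp add: field_simps)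
    qed
  qed
qed

lemma markov_chain_paths_skeleton:
  assumes M: "prob_space M" and N: "\<And>t. 0 \<le> t \<Longrightarrow> N t \<in> measurable M (count_space UNIV)"
    and markov: "markov_with_transitions M N p" and h: "0 < h"
  shows "markov_chain_paths M (\<lambda>k. N (real k * h)) (p h)"
proof -
  interpret prob_space M by (rule M)
  have meas [measurable]: "N (real k * h) \<in> measurable M (count_space UNIV)" for k
    using h by (intro N) auto
  show ?thesis
  proof
    fix k s j
    let ?Q = "\<lambda>\<omega>. \<forall>i\<le>k. N (real i * h) \<omega> = s i"
    let ?R = "\<lambda>\<omega>. N (real (Suc k) * h) \<omega> = j"
    show "prob {\<omega> \<in> space M. ?Q \<omega> \<and> ?R \<omega>} = prob {\<omega> \<in> space M. ?Q \<omega>} * p h (s k) j"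
    proof (cases "0 < prob {\<omega> \<in> space M. ?Q \<omega>}")
      case True
      \<comment> \<open>The Markov property takes past and future states from a single sequence, so
        the target is stored at position \<open>Suc k\<close>, which leaves the past event
        unchanged.\<close>
      have Q: "(\<lambda>\<omega>. \<forall>i\<le>k. N (real i * h) \<omega> = (s(Suc k := j)) i) = ?Q"
        by (auto simp: fun_eq_iff)
      have "\<P>(\<omega> in M. N (real (Suc k) * h) \<omega> = (s(Suc k := j)) (Suc k) \<bar> \<forall>i\<le>k. N (real i * h) \<omega> = (s(Suc k := j)) i)
          = p (real (Suc k) * h - real k * h) ((s(Suc k := j)) k) ((s(Suc k := j)) (Suc k))"
        using markov [unfolded markov_with_transitions_def, rule_format, of "\<lambda>i. real i * h" k "s(Suc k := j)"] h True
        unfolding Q by auto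
      moreover have "real (Suc k) * h - real k * h = h" by (simp add: algebra_simps)
      ultimately have "\<P>(\<omega> in M. ?R \<omega> \<bar> ?Q \<omega>) = p h (s k) j"
        unfolding Q by simp
      then have "prob {\<omega> \<in> space M. ?R \<omega> \<and> ?Q \<omega>} / prob {\<omega> \<in> space M. ?Q \<omega>} = p h (s k) j"
        by (simp add: cond_prob_def)
      moreover have "{\<omega> \<in> space M. ?R \<omega> \<and> ?Q \<omega>} = {\<omega> \<in> space M. ?Q \<omega> \<and> ?R \<omega>}" by auto
      ultimately show ?thesis using True by (simp add: field_simps)
    next
      case False
      then have zero: "prob {\<omega> \<in> space M. ?Q \<omega>} = 0" by (simp add: zero_less_measure_iff)
      have "prob {\<omega> \<in> space M. ?Q \<omega> \<and> ?R \<omega>} \<le> prob {\<omega> \<in> space M. ?Q \<omega>}"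
        by (intro finite_measure_mono) auto
      then show ?thesis using zero by (simp add: measure_le_0_iff)
    qed
  qed (rule meas)
qed

text \<open>Right-continuity in the discrete state space means constancy on a short interval to the
  right. Hence the infimum is attained and the level is held for a positive time \<open>e\<close>,
  long enough for a fine grid to notice it.\<close>

lemma first_passage_time_cases [consumes 1]:
  fixes N :: "real \<Rightarrow> 'a \<Rightarrow> nat"
  assumes rc: "\<forall>t\<ge>0. \<forall>\<^sub>F s in at_right t. N s \<omega> = N t \<omega>"
  obtains (never) "\<And>t. 0 \<le> t \<Longrightarrow> N t \<omega> \<noteq> k" "first_passage_time N k \<omega> = \<infinity>"
  | (hits) \<tau> e where "0 \<le> \<tau>" "first_passage_time N k \<omega> = ereal \<tau>" "0 < e"
     "\<And>t. \<tau> \<le> t \<Longrightarrow> t < \<tau> + e \<Longrightarrow> N t \<omega> = k" "\<And>t. 0 \<le> t \<Longrightarrow> t < \<tau> \<Longrightarrow> N t \<omega> \<noteq> k"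
proof -
  define S where "S = {t. 0 \<le> t \<and> N t \<omega> = k}"
  have fpt: "first_passage_time N k \<omega> = Inf (ereal ` S)"
    unfolding first_passage_time_def S_def by (rule arg_cong [of _ _ Inf]) auto
  show thesis
  proof (cases "S = {}")
    case True
    then have "first_passage_time N k \<omega> = \<infinity>" unfolding fpt by (simp add: top_ereal_def)
    then show thesis using True by (intro never) (auto simp: S_def)
  next
    case False
    define \<tau> where "\<tau> = Inf S"
    have bdd: "bdd_below S" by (auto simp: S_def bdd_below_def)
    have \<tau>0: "0 \<le> \<tau>" unfolding \<tau>_def using False by (intro cInf_greatest) (auto simp: S_def)
    have before: "N t \<omega> \<noteq> k" if "0 \<le> t" "t < \<tau>" for t
      using that cInf_lower [OF _ bdd, of t] by (auto simp: S_def \<tau>_def)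
    obtain e where e: "0 < e" "\<And>t. \<tau> < t \<Longrightarrow> t < \<tau> + e \<Longrightarrow> N t \<omega> = N \<tau> \<omega>"
    proof -
      obtain b where "\<tau> < b" "\<And>t. \<tau> < t \<Longrightarrow> t < b \<Longrightarrow> N t \<omega> = N \<tau> \<omega>"
        using rc \<tau>0 by (auto simp: eventually_at_right_field)
      then show thesis by (intro that [of "b - \<tau>"]) auto
    qed
    obtain t where t: "t \<in> S" "t < \<tau> + e"
      using cInf_lessD [OF False, of "\<tau> + e"] e(1) by (auto simp: \<tau>_def)
    have "\<tau> \<le> t" unfolding \<tau>_def using t bdd by (intro cInf_lower)
    then have hit: "N \<tau> \<omega> = k" using t e(2) [of t] by (cases "t = \<tau>") (auto simp: S_def)
    have "Inf (ereal ` S) = ereal \<tau>"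
    proof (rule antisym)
      show "Inf (ereal ` S) \<le> ereal \<tau>"
        using hit \<tau>0 by (intro Inf_lower imageI) (simp add: S_def)
      show "ereal \<tau> \<le> Inf (ereal ` S)"
        using bdd by (intro Inf_greatest) (auto simp: \<tau>_def intro: cInf_lower)
    qed
    moreover have "N t \<omega> = k" if "\<tau> \<le> t" "t < \<tau> + e" for t
      using that hit e(2) [of t] by (cases "t = \<tau>") auto
    ultimately show thesis
      using \<tau>0 before e(1) fpt by (intro hits [of \<tau> e]) auto
  qed
qed

text \<open>The grid point \<open>K l\<close> is the first one at or after \<tau>. Once the mesh is
  below the holding time \<open>e\<close> it is the first sampled hit, and its time converges to
  \<tau>.\<close>

lemma skeleton_hit_tendsto:
  fixes N :: "real \<Rightarrow> 'a \<Rightarrow> nat"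
  assumes rc: "\<forall>t\<ge>0. \<forall>\<^sub>F s in at_right t. N s \<omega> = N t \<omega>"
    and h: "\<And>l. 0 < h l" "h \<longlonglongrightarrow> 0"
  shows "(\<lambda>l. if \<exists>k. N (real k * h l) \<omega> = L then exp (- \<theta> * of_real (h l)) ^ (LEAST k. N (real k * h l) \<omega> = L) else 0)
    \<longlonglongrightarrow> laplace_kernel \<theta> (first_passage_time N L \<omega>)"
  using rc
proof (cases rule: first_passage_time_cases [where N = N and \<omega> = \<omega> and k = L])
  case never
  then have "\<not> (\<exists>k. N (real k * h l) \<omega> = L)" for l
    using h(1) [of l] by (auto simp: less_imp_le)
  then show ?thesis using never by (simp add: laplace_kernel_def)
next
  case (hits \<tau> e)
  define K where "K l = nat \<lceil>\<tau> / h l\<rceil>" for l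
  have K: "\<tau> \<le> real (K l) * h l" "real (K l) * h l < \<tau> + h l" for l
  proof -
    have "0 \<le> \<tau> / h l" using hits(1) h(1) [of l] by simp
    then have "real (K l) = of_int \<lceil>\<tau> / h l\<rceil>" by (simp add: K_def)
    then have "\<tau> / h l \<le> real (K l)" "real (K l) < \<tau> / h l + 1" by linarith+
    then show "\<tau> \<le> real (K l) * h l" "real (K l) * h l < \<tau> + h l"
      using h(1) [of l] by (simp_all add: field_simps)
  qed
  have "(\<lambda>l. real (K l) * h l) \<longlonglongrightarrow> \<tau>"
  proof (rule tendsto_sandwich [of "\<lambda>_. \<tau>" _ _ "\<lambda>l. \<tau> + h l"])
    show "(\<lambda>l. \<tau> + h l) \<longlonglongrightarrow> \<tau>" using tendsto_add [OF tendsto_const h(2)] by simp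
  qed (use K in \<open>auto intro!: always_eventually less_imp_le\<close>)
  then have "(\<lambda>l. exp (- \<theta> * of_real (real (K l) * h l))) \<longlonglongrightarrow> exp (- \<theta> * of_real \<tau>)"
    by (intro tendsto_intros)
  moreover have "exp (- \<theta> * of_real \<tau>) = laplace_kernel \<theta> (first_passage_time N L \<omega>)"
    using hits by (simp add: laplace_kernel_def)
  moreover have "\<forall>\<^sub>F l in sequentially. h l < e"
    using h(2) hits(3) by (rule order_tendstoD)
  then have "\<forall>\<^sub>F l in sequentially. exp (- \<theta> * of_real (real (K l) * h l)) =
     (if \<exists>k. N (real k * h l) \<omega> = L then exp (- \<theta> * of_real (h l)) ^ (LEAST k. N (real k * h l) \<omega> = L) else 0)"
  proof eventually_elim
    case (elim l)
    have hit: "N (real (K l) * h l) \<omega> = L"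
      using hits(4) K [of l] elim by simp
    have "(LEAST k. N (real k * h l) \<omega> = L) = K l"
    proof (rule Least_equality [where P = "\<lambda>k. N (real k * h l) \<omega> = L", OF hit])
      fix k assume k: "N (real k * h l) \<omega> = L"
      show "K l \<le> k"
      proof (rule ccontr)
        assume "\<not> K l \<le> k"
        then have "real k * h l \<le> (real (K l) - 1) * h l"
          using h(1) [of l] by (intro mult_right_mono) auto
        also have "\<dots> < \<tau>" using K(2) [of l] by (simp add: algebra_simps)
        finally show False using hits(5) [of "real k * h l"] k h(1) [of l] by simp
      qed
    qed
    moreover have "exp (- \<theta> * of_real (real (K l) * h l)) = exp (- \<theta> * of_real (h l)) ^ K l"
      by (simp add: exp_of_nat_mult [symmetric] mult_ac)
    moreover have "\<exists>k. N (real k * h l) \<omega> = L" using hit by blast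
    ultimately show ?case by simp
  qed
  ultimately show ?thesis
    using Lim_transform_eventually by fastforce
qed

lemma integral_uniform_measure:
  fixes f :: "'a \<Rightarrow> complex"
  assumes [measurable]: "A \<in> sets M" "f \<in> borel_measurable M" and A: "0 < measure M A" "emeasure M A \<noteq> \<infinity>"
  shows "(LINT \<omega>|uniform_measure M A. f \<omega>) = (LINT \<omega>|M. indicator A \<omega> * f \<omega>) / of_real (measure M A)"
proof -
  have "uniform_measure M A = density M (\<lambda>x. ennreal (indicator A x / measure M A))"
    unfolding uniform_measure_def
    by (rule density_cong) (use A in \<open>auto simp: emeasure_eq_ennreal_measure divide_ennreal indicator_def ennreal_1 [symmetric] simp del: ennreal_1\<close>)
  then have "(LINT \<omega>|uniform_measure M A. f \<omega>) = (LINT \<omega>|M. (indicator A \<omega> / measure M A) *\<^sub>R f \<omega>)"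
    by (simp add: integral_density)
  also have "\<dots> = (LINT \<omega>|M. (indicator A \<omega> * f \<omega>) / of_real (measure M A))"
    by (rule Bochner_Integration.integral_cong) (auto simp: indicator_def scaleR_conv_of_real)
  finally show ?thesis by simp
qed

text \<open>The recurrence says that the generator error of \<open>U\<close> is o(h) per step, and
  about 1 / (h Re \<theta>) steps count. The product form covers the case U L = 0 as well.\<close>

theorem first_passage_laplace_recurrence:
  fixes U :: "nat \<Rightarrow> complex"
  assumes bd: "birth_death_process M N birth death" and \<theta>: "0 < Re \<theta>" and nL: "n < L"
    and pos: "0 < measure M {\<omega> \<in> space M. N 0 \<omega> = n}"
    and U: "\<And>i. i < L \<Longrightarrow> (\<theta> + of_real (birth i) + of_real (death i)) * U i = of_real (birth i) * U (Suc i) + of_real (death i) * U (i - 1)"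
  shows "U n = U L * first_passage_laplace M N L n \<theta>"
proof -
  obtain p where M: "prob_space M" and N: "\<And>t. 0 \<le> t \<Longrightarrow> N t \<in> measurable M (count_space UNIV)"
    and rc: "\<And>\<omega> t. \<omega> \<in> space M \<Longrightarrow> 0 \<le> t \<Longrightarrow> \<forall>\<^sub>F s in at_right t. N s \<omega> = N t \<omega>"
    and p: "transition_function p" and r: "has_birth_death_rates p birth death" and markov: "markov_with_transitions M N p"
    using bd unfolding birth_death_process_def by blast
  interpret prob_space M by (rule M)
  define A where "A = {\<omega> \<in> space M. N 0 \<omega> = n}"
  have [measurable]: "N 0 \<in> measurable M (count_space UNIV)" by (rule N) simp
  have [measurable]: "A \<in> events" unfolding A_def by measurable
  define h where "h l = inverse (real (Suc l))" for l
  have h: "0 < h l" "h \<longlonglongrightarrow> 0" for l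
    using LIMSEQ_inverse_real_of_nat by (simp_all add: h_def [abs_def])
  have h_right: "filterlim h (at_right 0) sequentially"
    unfolding filterlim_at
  proof
    show "\<forall>\<^sub>F l in sequentially. h l \<in> {0<..} \<and> h l \<noteq> 0"
      using h(1) by (intro always_eventually allI) (metis greaterThan_iff less_irrefl)
  qed (rule h(2))
  define w where "w l = exp (- \<theta> * of_real (h l))" for l
  have norm_w: "cmod (w l) = exp (- Re \<theta> * h l)" "cmod (w l) < 1" for l
    using h(1) [of l] \<theta> by (simp_all add: w_def)
  define c where "c l i = cmod (U i - w l * (\<Sum>j\<le>L. of_real (p (h l) i j) * U j))" for l i
  define d where "d l i = 1 - (\<Sum>j\<le>L. p (h l) i j)" for l i
  \<comment> \<open>Summing over the finitely many states below \<open>L\<close> gives a single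
    error for the martingale defect \<open>c\<close> and the overshoot probability
    \<open>d\<close>.\<close>
  define \<epsilon> where "\<epsilon> l = (\<Sum>i<L. c l i + d l i)" for l
  have cd: "0 \<le> c l i" "0 \<le> d l i" for l i
    using transition_sum_le_1 [OF p less_imp_le [OF h(1)], of "{..L}"] by (simp_all add: c_def d_def)
  have \<epsilon>0: "0 \<le> \<epsilon> l" for l unfolding \<epsilon>_def using cd by (intro sum_nonneg add_nonneg_nonneg)
  have \<epsilon>_ge: "c l i \<le> \<epsilon> l" "d l i \<le> \<epsilon> l" if "i < L" for l i
  proof -
    have "c l i + d l i \<le> \<epsilon> l" unfolding \<epsilon>_def using that cd by (intro member_le_sum) auto
    then show "c l i \<le> \<epsilon> l" "d l i \<le> \<epsilon> l" using cd [of l i] by linarith+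
  qed
  have c_lim: "(\<lambda>l. c l i / h l) \<longlonglongrightarrow> 0" if i: "i < L" for i
  proof -
    have "(\<lambda>l. cmod ((U i - w l * (\<Sum>j\<le>L. of_real (p (h l) i j) * U j)) / of_real (h l))) \<longlonglongrightarrow> 0"
      using tendsto_norm [OF filterlim_compose [OF generator_limit [OF p r i, of U \<theta>] h_right]] U [OF i] by (simp add: w_def)
    then show ?thesis using h(1) by (simp add: c_def norm_divide less_imp_le)
  qed
  \<comment> \<open>The generator limit for the constant function 1 with \<theta> = 0 says exactly
    that overshooting has probability o(h).\<close>
  have d_lim: "(\<lambda>l. d l i / h l) \<longlonglongrightarrow> 0" if i: "i < L" for i
  proof -
    have "(\<lambda>l. (1 - exp (- 0 * of_real (h l)) * (\<Sum>j\<le>L. of_real (p (h l) i j) * (1::complex))) / of_real (h l)) \<longlonglongrightarrow> 0"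
      using filterlim_compose [OF generator_limit [OF p r i, of "\<lambda>_. 1" 0] h_right] by simp
    also have "(\<lambda>l. (1 - exp (- 0 * of_real (h l)) * (\<Sum>j\<le>L. of_real (p (h l) i j) * (1::complex))) / of_real (h l)) = (\<lambda>l. of_real (d l i / h l))"
      by (simp add: d_def)
    finally show ?thesis by (auto dest: tendsto_Re)
  qed
  have "(\<lambda>l. \<epsilon> l / h l) \<longlonglongrightarrow> (\<Sum>i<L. 0 + 0)"
    unfolding \<epsilon>_def sum_divide_distrib add_divide_distrib
    by (intro tendsto_sum tendsto_add c_lim d_lim) auto
  moreover have "(\<lambda>l. h l / (1 - exp (- Re \<theta> * h l))) \<longlonglongrightarrow> 1 / Re \<theta>"
  proof -
    have "((\<lambda>x. x / (1 - exp (- Re \<theta> * x))) \<longlongrightarrow> 1 / Re \<theta>) (at_right 0)"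
      using \<theta> by (real_asymp simp: inverse_eq_divide)
    then show ?thesis using h_right by (rule filterlim_compose)
  qed
  ultimately have "(\<lambda>l. \<epsilon> l / h l * (h l / (1 - exp (- Re \<theta> * h l)))) \<longlonglongrightarrow> (\<Sum>i<L. 0 + 0) * (1 / Re \<theta>)"
    by (intro tendsto_mult)
  moreover have "\<epsilon> l / h l * (h l / (1 - exp (- Re \<theta> * h l))) = \<epsilon> l / (1 - cmod (w l))" for l
    using h(1) [of l] by (simp add: norm_w)
  ultimately have \<epsilon>_lim: "(\<lambda>l. \<epsilon> l / (1 - cmod (w l))) \<longlonglongrightarrow> 0" by simp
  have mc: "markov_chain_paths M (\<lambda>k. N (real k * h l)) (p (h l))" for l
    by (rule markov_chain_paths_skeleton [OF M N markov h(1)])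
  define V where "V l \<omega> = (if N 0 \<omega> = n \<and> (\<exists>k. N (real k * h l) \<omega> = L) then w l ^ (LEAST k. N (real k * h l) \<omega> = L) else 0)" for l \<omega>
  have V: "markov_chain_paths.first_hit_value (\<lambda>k. N (real k * h l)) n L (w l) = V l" for l
    by (rule ext) (simp add: V_def markov_chain_paths.first_hit_value_def [OF mc nL])
  have [measurable]: "V l \<in> borel_measurable M" for l
    using markov_chain_paths.first_hit_value_measurable [OF mc nL, of l "w l"] unfolding V .
  have V_bound: "cmod (V l \<omega>) \<le> 1" for l \<omega>
    using markov_chain_paths.norm_first_hit_value [OF mc [of l] nL norm_w(2) [of l]] unfolding V .
  have bound: "cmod (of_real (prob A) * U n - (LINT \<omega>|M. V l \<omega>) * U L) \<le> (1 + cmod (U L)) * (\<epsilon> l / (1 - cmod (w l)))" for l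
    using markov_chain_paths.expectation_first_hit_bound [OF mc [of l] nL norm_w(2) [of l] \<epsilon>0 [of l], of U] \<epsilon>_ge [of _ l]
    unfolding V by (simp add: A_def c_def d_def)
  define K where "K \<omega> = indicator A \<omega> * laplace_kernel \<theta> (first_passage_time N L \<omega>)" for \<omega>
  have V_lim: "(\<lambda>l. V l \<omega>) \<longlonglongrightarrow> K \<omega>" if "\<omega> \<in> space M" for \<omega>
  proof (cases "N 0 \<omega> = n")
    case True
    have "(\<lambda>l. if \<exists>k. N (real k * h l) \<omega> = L then w l ^ (LEAST k. N (real k * h l) \<omega> = L) else 0)
      \<longlonglongrightarrow> laplace_kernel \<theta> (first_passage_time N L \<omega>)"
      unfolding w_def using rc [OF that] h by (intro skeleton_hit_tendsto) auto
    then show ?thesis using True that by (simp add: V_def K_def A_def)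
  qed (simp add: V_def K_def A_def)
  define f where "f \<omega> = laplace_kernel \<theta> (first_passage_time N L \<omega>)" for \<omega>
  \<comment> \<open>The first passage time is an infimum over uncountably many times; measurability
    of its kernel comes from the sampled approximations.\<close>
  have f [measurable]: "f \<in> borel_measurable M"
  proof (rule borel_measurable_LIMSEQ_metric)
    fix l
    have [measurable]: "N (real k * h l) \<in> measurable M (count_space UNIV)" for k
      using h(1) [of l] by (intro N) simp
    have "(\<lambda>\<omega>. LEAST k. N (real k * h l) \<omega> = L) \<in> measurable M (count_space UNIV)" by measurable
    then have [measurable]: "(\<lambda>\<omega>. w l ^ (LEAST k. N (real k * h l) \<omega> = L)) \<in> borel_measurable M"
      by (rule measurable_compose) auto
    show "(\<lambda>\<omega>. if \<exists>k. N (real k * h l) \<omega> = L then w l ^ (LEAST k. N (real k * h l) \<omega> = L) else 0) \<in> borel_measurable M"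
      by measurable
  next
    fix \<omega> assume "\<omega> \<in> space M"
    then show "(\<lambda>l. if \<exists>k. N (real k * h l) \<omega> = L then w l ^ (LEAST k. N (real k * h l) \<omega> = L) else 0) \<longlonglongrightarrow> f \<omega>"
      unfolding w_def f_def using rc h by (intro skeleton_hit_tendsto) auto
  qed
  have K_eq: "K \<omega> = indicator A \<omega> * f \<omega>" for \<omega> by (simp add: K_def f_def)
  have K_measurable: "K \<in> borel_measurable M"
    unfolding K_eq [abs_def] by measurable
  have "(\<lambda>l. LINT \<omega>|M. V l \<omega>) \<longlonglongrightarrow> (LINT \<omega>|M. K \<omega>)"
    using V_bound V_lim K_measurable
    by (intro integral_dominated_convergence [where w = "\<lambda>_. 1"]) auto
  then have "(\<lambda>l. cmod (of_real (prob A) * U n - (LINT \<omega>|M. V l \<omega>) * U L)) \<longlonglongrightarrow> cmod (of_real (prob A) * U n - (LINT \<omega>|M. K \<omega>) * U L)"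
    by (intro tendsto_intros)
  moreover have "(\<lambda>l. (1 + cmod (U L)) * (\<epsilon> l / (1 - cmod (w l)))) \<longlonglongrightarrow> (1 + cmod (U L)) * 0"
    by (intro tendsto_mult tendsto_const \<epsilon>_lim)
  ultimately have "cmod (of_real (prob A) * U n - (LINT \<omega>|M. K \<omega>) * U L) \<le> (1 + cmod (U L)) * 0"
    using bound by (intro LIMSEQ_le) auto
  then have eq: "of_real (prob A) * U n = (LINT \<omega>|M. K \<omega>) * U L" by simp
  have "first_passage_laplace M N L n \<theta> = (LINT \<omega>|M. K \<omega>) / of_real (prob A)"
    unfolding first_passage_laplace_def A_def [symmetric] K_eq f_def [symmetric]
    using pos by (intro integral_uniform_measure) (simp_all add: A_def [symmetric])
  moreover have "U n = (LINT \<omega>|M. K \<omega>) * U L / of_real (prob A)"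
    using eq pos by (simp add: A_def [symmetric] field_simps)
  ultimately show ?thesis by simp
qed

section \<open>The diffusion limit\<close>

text \<open>Here k is the distance n - m. Dividing the equation above \<open>m\<close> by \<eta>
  turns the death rate m + k \<eta> into the exponent m / \<eta> + k and \<theta> into \<theta> /
  \<eta>. The sign \<epsilon> selects one of the two solutions; \<eta> = 1 and \<epsilon> = 1 give
  the one used below \<open>m\<close>.\<close>

definition scaled_charlier :: "complex \<Rightarrow> real \<Rightarrow> real \<Rightarrow> real \<Rightarrow> nat \<Rightarrow> real \<Rightarrow> complex" where
  "scaled_charlier \<kappa> \<eta> \<epsilon> \<beta> m k =
     charlier_mellin \<kappa> (\<epsilon> * sqrt \<eta> / sqrt (real m)) ((real m - sqrt (real m) * \<beta>) / \<eta>) (real m / \<eta> + k)"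

text \<open>The step sqrt \<eta> / sqrt m is the one for which a \<delta>^2 tends to 1; the drift (a
  - r) \<delta> then tends to \<epsilon> (\<beta> + \<eta> y) / sqrt \<eta>.\<close>

lemma scaled_charlier_tendsto:
  assumes k: "0 < Re \<kappa>" and \<eta>: "0 < \<eta>" and \<epsilon>: "\<epsilon>\<^sup>2 = 1" and y: "(\<lambda>m. k m / sqrt (real m)) \<longlonglongrightarrow> y"
  shows "(\<lambda>m. scaled_charlier \<kappa> \<eta> \<epsilon> \<beta> m (k m)) \<longlonglongrightarrow> gauss_mellin \<kappa> (of_real (- (\<epsilon> * ((\<beta> + \<eta> * y) / sqrt \<eta>))))"
  unfolding scaled_charlier_def
proof (rule charlier_mellin_tendsto [OF k])
  have s0: "(\<lambda>m. inverse (sqrt (real m))) \<longlonglongrightarrow> 0"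
    by real_asymp
  show "(\<lambda>m. \<epsilon> * sqrt \<eta> / sqrt (real m)) \<longlonglongrightarrow> 0"
    using tendsto_mult_right_zero [OF s0, of "\<epsilon> * sqrt \<eta>"] by (simp add: divide_inverse)
  show "\<forall>\<^sub>F m in sequentially. \<epsilon> * sqrt \<eta> / sqrt (real m) \<noteq> 0"
    using eventually_gt_at_top [of 0] by eventually_elim (use \<eta> \<epsilon> in auto)
  have "(\<lambda>m. \<epsilon> * (sqrt \<eta> * (k m / sqrt (real m)) + \<beta> / sqrt \<eta>)) \<longlonglongrightarrow> \<epsilon> * (sqrt \<eta> * y + \<beta> / sqrt \<eta>)"
    by (intro tendsto_intros y)
  also have "\<epsilon> * (sqrt \<eta> * y + \<beta> / sqrt \<eta>) = \<epsilon> * ((\<beta> + \<eta> * y) / sqrt \<eta>)"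
    using \<eta> by (simp add: field_simps)
  finally show "(\<lambda>m. (real m / \<eta> + k m - (real m - sqrt (real m) * \<beta>) / \<eta>) * (\<epsilon> * sqrt \<eta> / sqrt (real m))) \<longlonglongrightarrow> \<epsilon> * ((\<beta> + \<eta> * y) / sqrt \<eta>)"
  proof (rule Lim_transform_eventually)
    show "\<forall>\<^sub>F m in sequentially. \<epsilon> * (sqrt \<eta> * (k m / sqrt (real m)) + \<beta> / sqrt \<eta>) =
       (real m / \<eta> + k m - (real m - sqrt (real m) * \<beta>) / \<eta>) * (\<epsilon> * sqrt \<eta> / sqrt (real m))"
      using eventually_gt_at_top [of 0]
    proof eventually_elim
      case (elim m)
      have e: "\<eta> = sqrt \<eta> * sqrt \<eta>" using \<eta> by simp
      have "real m / \<eta> + k m - (real m - sqrt (real m) * \<beta>) / \<eta> = k m + sqrt (real m) * \<beta> / \<eta>"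
        by (simp add: diff_divide_distrib)
      moreover have "(k m + sqrt (real m) * \<beta> / \<eta>) * (\<epsilon> * sqrt \<eta> / sqrt (real m)) = \<epsilon> * (sqrt \<eta> * (k m / sqrt (real m)) + \<beta> / sqrt \<eta>)"
        using \<eta> elim by (subst e) (simp add: field_simps del: real_sqrt_mult_self)
      ultimately show ?case by (simp only:)
    qed
  qed
  have "(\<lambda>m. 1 + \<eta> * ((k m / sqrt (real m)) * inverse (sqrt (real m)))) \<longlonglongrightarrow> 1 + \<eta> * (y * 0)"
    by (intro tendsto_intros y s0)
  then have "(\<lambda>m. 1 + \<eta> * ((k m / sqrt (real m)) * inverse (sqrt (real m)))) \<longlonglongrightarrow> 1" by simp
  then show "(\<lambda>m. (real m / \<eta> + k m) * (\<epsilon> * sqrt \<eta> / sqrt (real m))\<^sup>2) \<longlonglongrightarrow> 1"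
  proof (rule Lim_transform_eventually)
    show "\<forall>\<^sub>F m in sequentially. 1 + \<eta> * ((k m / sqrt (real m)) * inverse (sqrt (real m))) = (real m / \<eta> + k m) * (\<epsilon> * sqrt \<eta> / sqrt (real m))\<^sup>2"
      using eventually_gt_at_top [of 0]
    proof eventually_elim
      case (elim m)
      have "(\<epsilon> * sqrt \<eta> / sqrt (real m))\<^sup>2 = \<eta> / real m"
        using \<epsilon> \<eta> elim by (simp add: power_divide power_mult_distrib)
      moreover have "(k m / sqrt (real m)) * inverse (sqrt (real m)) = k m / real m"
        using elim by (simp add: field_simps)
      ultimately show ?case using \<eta> elim by (simp add: field_simps)
    qed
  qed
qed

lemma scaled_charlier_step:
  assumes "0 < Re \<kappa>" "0 < \<eta>" "\<epsilon> \<noteq> 0" "0 < m" "sqrt (real m) * \<beta> < real m" "0 \<le> real m / \<eta> + k"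
  shows "scaled_charlier \<kappa> \<eta> \<epsilon> \<beta> m (k + 1) =
    scaled_charlier \<kappa> \<eta> \<epsilon> \<beta> m k + of_real (\<epsilon> * sqrt \<eta> / sqrt (real m)) * scaled_charlier (\<kappa> + 1) \<eta> \<epsilon> \<beta> m k"
  using charlier_mellin_step [OF assms(1), of "\<epsilon> * sqrt \<eta> / sqrt (real m)" "(real m - sqrt (real m) * \<beta>) / \<eta>" "real m / \<eta> + k"] assms(2-)
  by (simp add: scaled_charlier_def algebra_simps)

text \<open>The Charlier recurrence multiplied by \<eta>. The second alternative for
  \<open>k\<close> serves the empty system, k = -m with \<eta> = 1.\<close>

lemma scaled_charlier_recurrence:
  assumes k: "0 < Re \<theta>" and \<eta>: "0 < \<eta>" and "\<epsilon> \<noteq> 0" "0 < m" "sqrt (real m) * \<beta> < real m"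
    and "1 \<le> real m / \<eta> + k \<or> real m / \<eta> + k = 0 \<and> 0 < \<epsilon>"
  shows "(\<theta> + of_real (real m - sqrt (real m) * \<beta>) + of_real (real m + k * \<eta>)) * scaled_charlier (\<theta> / of_real \<eta>) \<eta> \<epsilon> \<beta> m k =
    of_real (real m - sqrt (real m) * \<beta>) * scaled_charlier (\<theta> / of_real \<eta>) \<eta> \<epsilon> \<beta> m (k + 1)
    + of_real (real m + k * \<eta>) * scaled_charlier (\<theta> / of_real \<eta>) \<eta> \<epsilon> \<beta> m (k - 1)"
proof -
  define r where "r = (real m - sqrt (real m) * \<beta>) / \<eta>"
  define a where "a = real m / \<eta> + k"
  define S where "S = scaled_charlier (\<theta> / of_real \<eta>) \<eta> \<epsilon> \<beta> m"
  have "(\<theta> / of_real \<eta> + of_real r + of_real a) * S k = of_real r * S (k + 1) + of_real a * S (k - 1)"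
    using charlier_mellin_recurrence [of "\<theta> / of_real \<eta>" "\<epsilon> * sqrt \<eta> / sqrt (real m)" r a] assms
    by (simp add: S_def scaled_charlier_def r_def a_def add.assoc add_diff_eq zero_less_divide_iff zero_less_mult_iff)
  then have "of_real \<eta> * ((\<theta> / of_real \<eta> + of_real r + of_real a) * S k) = of_real \<eta> * (of_real r * S (k + 1) + of_real a * S (k - 1))"
    by simp
  moreover have "of_real \<eta> * ((\<theta> / of_real \<eta> + of_real r + of_real a) * S k) = (\<theta> + of_real (\<eta> * r) + of_real (\<eta> * a)) * S k"
    using \<eta> by (simp add: field_simps)
  moreover have "of_real \<eta> * (of_real r * S (k + 1) + of_real a * S (k - 1)) = of_real (\<eta> * r) * S (k + 1) + of_real (\<eta> * a) * S (k - 1)"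
    by (simp add: algebra_simps)
  moreover have "\<eta> * r = real m - sqrt (real m) * \<beta>" "\<eta> * a = real m + k * \<eta>"
    using \<eta> by (simp_all add: r_def a_def field_simps)
  ultimately show ?thesis by (simp only: S_def)
qed

text \<open>A discrete maximum principle: Re \<theta> \<ge> 0 makes the coefficient on the left at
  least birth + death in modulus, so a modulus that has not decreased so far cannot decrease next.
  The induction starts because \<open>0 - 1 = 0\<close>.\<close>

lemma recurrence_norm_mono:
  fixes U :: "nat \<Rightarrow> complex"
  assumes U: "\<And>i. (\<theta> + of_real (birth i) + of_real (death i)) * U i = of_real (birth i) * U (Suc i) + of_real (death i) * U (i - 1)"
    and pos: "\<And>i. 0 < birth i" "\<And>i. 0 \<le> death i" and \<theta>: "0 \<le> Re \<theta>"
  shows "i \<le> j \<Longrightarrow> cmod (U i) \<le> cmod (U j)"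
proof -
  have "cmod (U (i - 1)) \<le> cmod (U i) \<Longrightarrow> cmod (U i) \<le> cmod (U (Suc i))" for i
  proof -
    assume prev: "cmod (U (i - 1)) \<le> cmod (U i)"
    have "birth i + death i \<le> Re (\<theta> + of_real (birth i) + of_real (death i))" using \<theta> by simp
    also have "\<dots> \<le> cmod (\<theta> + of_real (birth i) + of_real (death i))" by (rule complex_Re_le_cmod)
    finally have "(birth i + death i) * cmod (U i) \<le> cmod ((\<theta> + of_real (birth i) + of_real (death i)) * U i)"
      unfolding norm_mult by (rule mult_right_mono) simp
    also have "\<dots> \<le> birth i * cmod (U (Suc i)) + death i * cmod (U (i - 1))"
      unfolding U using pos(1) [of i] pos(2) [of i] by (intro order_trans [OF norm_triangle_ineq]) (simp add: norm_mult)
    also have "\<dots> \<le> birth i * cmod (U (Suc i)) + death i * cmod (U i)"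
      using pos prev by (intro add_left_mono mult_left_mono)
    finally show ?thesis using pos(1) [of i] by (simp add: distrib_right)
  qed
  then have step: "cmod (U i) \<le> cmod (U (Suc i))" for i
    by (induction i) auto
  show "i \<le> j \<Longrightarrow> cmod (U i) \<le> cmod (U j)"
    by (rule lift_Suc_mono_le [of "\<lambda>i. cmod (U i)", OF step])
qed

lemma Gamma_nonzero_of_Re_pos: "0 < Re z \<Longrightarrow> Gamma z \<noteq> 0"
  by (auto simp: Gamma_eq_zero_iff elim!: nonpos_Ints_cases)

text \<open>
  The coefficients come from Cramer's rule: they make the combination of the two solutions above
  the number of servers agree at \<open>n = m\<close> and \<open>n = m + 1\<close> with the solution below it.
\<close>

context
  fixes \<eta> \<beta> :: real and \<theta> :: complex
  assumes \<eta>: "0 < \<eta>" and \<theta>: "0 < Re \<theta>"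
begin

definition left_coefficient :: "nat \<Rightarrow> complex" where
  "left_coefficient m =
    (scaled_charlier \<theta> 1 1 \<beta> m 0 * scaled_charlier (\<theta> / of_real \<eta> + 1) \<eta> (- 1) \<beta> m 0
      + scaled_charlier (\<theta> / of_real \<eta>) \<eta> (- 1) \<beta> m 0 * scaled_charlier (\<theta> + 1) 1 1 \<beta> m 0 / of_real (sqrt \<eta>))
    / (scaled_charlier (\<theta> / of_real \<eta>) \<eta> 1 \<beta> m 0 * scaled_charlier (\<theta> / of_real \<eta> + 1) \<eta> (- 1) \<beta> m 0
      + scaled_charlier (\<theta> / of_real \<eta> + 1) \<eta> 1 \<beta> m 0 * scaled_charlier (\<theta> / of_real \<eta>) \<eta> (- 1) \<beta> m 0)"

definition right_coefficient :: "nat \<Rightarrow> complex" where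
  "right_coefficient m =
    (scaled_charlier (\<theta> / of_real \<eta> + 1) \<eta> 1 \<beta> m 0 * scaled_charlier \<theta> 1 1 \<beta> m 0
      - scaled_charlier (\<theta> / of_real \<eta>) \<eta> 1 \<beta> m 0 * scaled_charlier (\<theta> + 1) 1 1 \<beta> m 0 / of_real (sqrt \<eta>))
    / (scaled_charlier (\<theta> / of_real \<eta>) \<eta> 1 \<beta> m 0 * scaled_charlier (\<theta> / of_real \<eta> + 1) \<eta> (- 1) \<beta> m 0
      + scaled_charlier (\<theta> / of_real \<eta> + 1) \<eta> 1 \<beta> m 0 * scaled_charlier (\<theta> / of_real \<eta>) \<eta> (- 1) \<beta> m 0)"

definition waiting_solution :: "nat \<Rightarrow> real \<Rightarrow> complex" where
  "waiting_solution m k = left_coefficient m * scaled_charlier (\<theta> / of_real \<eta>) \<eta> 1 \<beta> m k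
    + right_coefficient m * scaled_charlier (\<theta> / of_real \<eta>) \<eta> (- 1) \<beta> m k"

definition erlang_solution :: "nat \<Rightarrow> nat \<Rightarrow> complex" where
  "erlang_solution m n = (if n \<le> m then scaled_charlier \<theta> 1 1 \<beta> m (real n - real m) else waiting_solution m (real n - real m))"

definition limit_left :: "real \<Rightarrow> complex" where
  "limit_left x = gauss_mellin \<theta> (of_real (- \<beta> - x))"

definition limit_wronskian :: complex where
  "limit_wronskian = gauss_mellin (\<theta> / of_real \<eta>) (of_real (\<beta> / sqrt \<eta>)) * gauss_mellin (\<theta> / of_real \<eta> + 1) (of_real (- (\<beta> / sqrt \<eta>)))
    + gauss_mellin (\<theta> / of_real \<eta> + 1) (of_real (\<beta> / sqrt \<eta>)) * gauss_mellin (\<theta> / of_real \<eta>) (of_real (- (\<beta> / sqrt \<eta>)))"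

definition limit_right :: "real \<Rightarrow> complex" where
  "limit_right x =
    (gauss_mellin \<theta> (of_real (- \<beta>)) * gauss_mellin (\<theta> / of_real \<eta> + 1) (of_real (\<beta> / sqrt \<eta>))
      + gauss_mellin (\<theta> / of_real \<eta>) (of_real (\<beta> / sqrt \<eta>)) * gauss_mellin (\<theta> + 1) (of_real (- \<beta>)) / of_real (sqrt \<eta>))
      / limit_wronskian * gauss_mellin (\<theta> / of_real \<eta>) (of_real (- ((\<beta> + \<eta> * x) / sqrt \<eta>)))
    + (gauss_mellin (\<theta> / of_real \<eta> + 1) (of_real (- (\<beta> / sqrt \<eta>))) * gauss_mellin \<theta> (of_real (- \<beta>))
      - gauss_mellin (\<theta> / of_real \<eta>) (of_real (- (\<beta> / sqrt \<eta>))) * gauss_mellin (\<theta> + 1) (of_real (- \<beta>)) / of_real (sqrt \<eta>))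
      / limit_wronskian * gauss_mellin (\<theta> / of_real \<eta>) (of_real ((\<beta> + \<eta> * x) / sqrt \<eta>))"

section \<open>Limits of the matched solutions\<close>

lemma Re_quotient_pos: "0 < Re (\<theta> / of_real \<eta>)" "0 < Re (\<theta> / of_real \<eta> + 1)" "0 < Re (\<theta> + 1)"
  using \<eta> \<theta> by (simp_all add: Re_divide_of_real add_pos_pos)

lemma limit_wronskian_eq:
  "limit_wronskian = of_real (sqrt (2 * pi)) * Gamma (\<theta> / of_real \<eta>) * of_real (exp ((\<beta> / sqrt \<eta>)\<^sup>2 / 2))"
  using gauss_mellin_wronskian [OF Re_quotient_pos(1), of "of_real (\<beta> / sqrt \<eta>)"]
  unfolding limit_wronskian_def by (simp flip: exp_of_real)

lemma limit_wronskian_nonzero: "limit_wronskian \<noteq> 0"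
  unfolding limit_wronskian_eq using Gamma_nonzero_of_Re_pos [OF Re_quotient_pos(1)] by simp

text \<open>The terms with index \<theta> + 1 cancel and the others add up to the Wronskian, so the
  two branches meet at 0.\<close>

lemma limit_right_0: "limit_right 0 = limit_left 0"
proof -
  have "limit_right 0 = gauss_mellin \<theta> (of_real (- \<beta>)) * limit_wronskian / limit_wronskian"
    unfolding limit_right_def by (simp add: limit_wronskian_def add_divide_distrib diff_divide_distrib algebra_simps)
  then show ?thesis using limit_wronskian_nonzero by (simp add: limit_left_def)
qed

lemma scaled_charlier_0_tendsto:
  assumes "0 < Re \<kappa>" "0 < \<gamma>" "\<epsilon>\<^sup>2 = 1"
  shows "(\<lambda>m. scaled_charlier \<kappa> \<gamma> \<epsilon> \<beta> m 0) \<longlonglongrightarrow> gauss_mellin \<kappa> (of_real (- (\<epsilon> * (\<beta> / sqrt \<gamma>))))"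
  using scaled_charlier_tendsto [OF assms, of "\<lambda>_. 0" 0] by simp

lemma discrete_wronskian_tendsto:
  "(\<lambda>m. scaled_charlier (\<theta> / of_real \<eta>) \<eta> 1 \<beta> m 0 * scaled_charlier (\<theta> / of_real \<eta> + 1) \<eta> (- 1) \<beta> m 0
      + scaled_charlier (\<theta> / of_real \<eta> + 1) \<eta> 1 \<beta> m 0 * scaled_charlier (\<theta> / of_real \<eta>) \<eta> (- 1) \<beta> m 0)
    \<longlonglongrightarrow> limit_wronskian"
proof -
  note lims = scaled_charlier_0_tendsto [OF Re_quotient_pos(1) \<eta>] scaled_charlier_0_tendsto [OF Re_quotient_pos(2) \<eta>]
  show ?thesis
    using tendsto_add [OF tendsto_mult [OF lims(1) [of 1] lims(2) [of "- 1"]] tendsto_mult [OF lims(2) [of 1] lims(1) [of "- 1"]]]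
    by (simp add: limit_wronskian_def algebra_simps)
qed

lemma waiting_solution_tendsto:
  assumes x: "(\<lambda>m. k m / sqrt (real m)) \<longlonglongrightarrow> x"
  shows "(\<lambda>m. waiting_solution m (k m)) \<longlonglongrightarrow> limit_right x"
proof -
  note q0 = scaled_charlier_0_tendsto [OF Re_quotient_pos(1) \<eta>]
  note q1 = scaled_charlier_0_tendsto [OF Re_quotient_pos(2) \<eta>]
  note t0 = scaled_charlier_0_tendsto [OF \<theta> zero_less_one, of 1]
  note t1 = scaled_charlier_0_tendsto [OF Re_quotient_pos(3) zero_less_one, of 1]
  have eta_ne: "complex_of_real (sqrt \<eta>) \<noteq> 0" using \<eta> by simp
  have L: "left_coefficient \<longlonglongrightarrow> (gauss_mellin \<theta> (of_real (- \<beta>)) * gauss_mellin (\<theta> / of_real \<eta> + 1) (of_real (\<beta> / sqrt \<eta>))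
      + gauss_mellin (\<theta> / of_real \<eta>) (of_real (\<beta> / sqrt \<eta>)) * gauss_mellin (\<theta> + 1) (of_real (- \<beta>)) / of_real (sqrt \<eta>))
      / limit_wronskian"
    unfolding left_coefficient_def [abs_def]
    using q0 [of "- 1"] q1 [of "- 1"] t0 t1
    by (intro tendsto_divide [OF _ discrete_wronskian_tendsto limit_wronskian_nonzero] tendsto_add tendsto_mult tendsto_divide [OF _ tendsto_const eta_ne]) simp_all
  have R: "right_coefficient \<longlonglongrightarrow> (gauss_mellin (\<theta> / of_real \<eta> + 1) (of_real (- (\<beta> / sqrt \<eta>))) * gauss_mellin \<theta> (of_real (- \<beta>))
      - gauss_mellin (\<theta> / of_real \<eta>) (of_real (- (\<beta> / sqrt \<eta>))) * gauss_mellin (\<theta> + 1) (of_real (- \<beta>)) / of_real (sqrt \<eta>))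
      / limit_wronskian"
    unfolding right_coefficient_def [abs_def]
    using q0 [of 1] q1 [of 1] t0 t1
    by (intro tendsto_divide [OF _ discrete_wronskian_tendsto limit_wronskian_nonzero] tendsto_diff tendsto_mult tendsto_divide [OF _ tendsto_const eta_ne]) simp_all
  show ?thesis
    unfolding waiting_solution_def limit_right_def
  proof (intro tendsto_add tendsto_mult L R)
    show "(\<lambda>m. scaled_charlier (\<theta> / of_real \<eta>) \<eta> 1 \<beta> m (k m)) \<longlonglongrightarrow> gauss_mellin (\<theta> / of_real \<eta>) (of_real (- ((\<beta> + \<eta> * x) / sqrt \<eta>)))"
      using scaled_charlier_tendsto [OF Re_quotient_pos(1) \<eta> _ x, of 1 \<beta>] by simp
    have "- (- 1 * ((\<beta> + \<eta> * x) / sqrt \<eta>)) = (\<beta> + \<eta> * x) / sqrt \<eta>"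
      by (simp only: mult_minus_left mult_1 minus_minus)
    then show "(\<lambda>m. scaled_charlier (\<theta> / of_real \<eta>) \<eta> (- 1) \<beta> m (k m)) \<longlonglongrightarrow> gauss_mellin (\<theta> / of_real \<eta>) (of_real ((\<beta> + \<eta> * x) / sqrt \<eta>))"
      using scaled_charlier_tendsto [OF Re_quotient_pos(1) \<eta> _ x, of "- 1" \<beta>] by (simp only: power2_minus one_power2 simp_thms)
  qed
qed

lemma busy_solution_tendsto:
  assumes x: "(\<lambda>m. k m / sqrt (real m)) \<longlonglongrightarrow> x"
  shows "(\<lambda>m. scaled_charlier \<theta> 1 1 \<beta> m (k m)) \<longlonglongrightarrow> limit_left x"
  using scaled_charlier_tendsto [OF \<theta> zero_less_one _ x, of 1] by (simp add: limit_left_def algebra_simps)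

lemma erlang_solution_tendsto:
  assumes x: "(\<lambda>m. (real (n m) - real m) / sqrt (real m)) \<longlonglongrightarrow> x"
  shows "(\<lambda>m. erlang_solution m (n m)) \<longlonglongrightarrow> (if x \<le> 0 then limit_left x else limit_right x)"
proof -
  note left = busy_solution_tendsto [OF x] and right = waiting_solution_tendsto [OF x]
  have sgn: "(real (n m) - real m) / sqrt (real m) \<le> 0 \<longleftrightarrow> n m \<le> m" if "0 < m" for m
    using that by (simp add: divide_le_0_iff)
  consider "x < 0" | "x = 0" | "0 < x" by linarith
  then show ?thesis
  proof cases
    case 1
    then have "\<forall>\<^sub>F m in sequentially. (real (n m) - real m) / sqrt (real m) < 0"
      using x by (intro order_tendstoD)
    then have "\<forall>\<^sub>F m in sequentially. scaled_charlier \<theta> 1 1 \<beta> m (real (n m) - real m) = erlang_solution m (n m)"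
      using eventually_gt_at_top [of 0]
    proof eventually_elim
      case (elim m)
      then have "n m \<le> m" using sgn [of m] by simp
      then show ?case by (simp add: erlang_solution_def)
    qed
    then show ?thesis using 1 Lim_transform_eventually [OF left] by simp
  next
    case 2
    \<comment> \<open>For x = 0 the states \<open>n m\<close> may lie on either side of
      \<open>m\<close> infinitely often, so both formulas must have the same limit.\<close>
    have "limit_right x = limit_left x" using 2 limit_right_0 by simp
    then have right': "(\<lambda>m. waiting_solution m (real (n m) - real m)) \<longlonglongrightarrow> limit_left x" using right by simp
    have "(\<lambda>m. erlang_solution m (n m)) \<longlonglongrightarrow> limit_left x"
      unfolding erlang_solution_def
      by (intro filterlim_If filterlim_mono [OF left] filterlim_mono [OF right']) auto
    then show ?thesis using 2 by simp
  next
    case 3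
    then have "\<forall>\<^sub>F m in sequentially. 0 < (real (n m) - real m) / sqrt (real m)"
      using x by (intro order_tendstoD)
    then have "\<forall>\<^sub>F m in sequentially. waiting_solution m (real (n m) - real m) = erlang_solution m (n m)"
      using eventually_gt_at_top [of 0]
    proof eventually_elim
      case (elim m)
      then have "\<not> n m \<le> m" using sgn [of m] by simp
      then show ?case by (simp add: erlang_solution_def)
    qed
    then show ?thesis using 3 Lim_transform_eventually [OF right] by simp
  qed
qed

text \<open>The equation at \<open>m\<close> also uses state \<open>m + 1\<close>, and the equation
  at \<open>m + 1\<close> uses state \<open>m\<close>. Matching at these two states lets the lower
  formula hold up to \<open>m + 1\<close> and the upper one from \<open>m\<close> on, so every
  equation lies inside one range.\<close>

lemma eventually_erlang_recurrence:
  "\<forall>\<^sub>F m in sequentially. 0 < real m - sqrt (real m) * \<beta> \<and>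
    (\<forall>n. (\<theta> + of_real (real m - sqrt (real m) * \<beta>) + of_real (erlang_a_death_rate m \<eta> n)) * erlang_solution m n =
      of_real (real m - sqrt (real m) * \<beta>) * erlang_solution m (Suc n) + of_real (erlang_a_death_rate m \<eta> n) * erlang_solution m (n - 1))"
proof -
  let ?q = "\<theta> / of_real \<eta>"
  have "\<forall>\<^sub>F m in sequentially. scaled_charlier ?q \<eta> 1 \<beta> m 0 * scaled_charlier (?q + 1) \<eta> (- 1) \<beta> m 0
      + scaled_charlier (?q + 1) \<eta> 1 \<beta> m 0 * scaled_charlier ?q \<eta> (- 1) \<beta> m 0 \<noteq> 0"
    using discrete_wronskian_tendsto limit_wronskian_nonzero by (rule tendsto_imp_eventually_ne)
  moreover have "\<forall>\<^sub>F m in sequentially. 0 < real m - sqrt (real m) * \<beta>"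
    by real_asymp
  ultimately show ?thesis
    using eventually_gt_at_top [of 0]
  proof eventually_elim
    case (elim m)
    define \<rho> where "\<rho> = real m - sqrt (real m) * \<beta>"
    have m: "0 < m" and \<rho>: "sqrt (real m) * \<beta> < real m" using elim by auto
    define P where "P = scaled_charlier ?q \<eta> 1 \<beta> m"
    define Q where "Q = scaled_charlier ?q \<eta> (- 1) \<beta> m"
    define I where "I = scaled_charlier \<theta> 1 1 \<beta> m"
    define P' where "P' = scaled_charlier (?q + 1) \<eta> 1 \<beta> m 0"
    define Q' where "Q' = scaled_charlier (?q + 1) \<eta> (- 1) \<beta> m 0"
    define I' where "I' = scaled_charlier (\<theta> + 1) 1 1 \<beta> m 0"
    define W where "W = P 0 * Q' + P' * Q 0"
    have W: "W \<noteq> 0" using elim by (simp add: W_def P_def Q_def P'_def Q'_def)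
    define A where "A = (I 0 * Q' + Q 0 * I' / of_real (sqrt \<eta>)) / W"
    define B where "B = (P' * I 0 - P 0 * I' / of_real (sqrt \<eta>)) / W"
    have ws: "waiting_solution m k = A * P k + B * Q k" for k
      by (simp add: waiting_solution_def left_coefficient_def right_coefficient_def A_def B_def W_def P_def Q_def I_def P'_def Q'_def I'_def)
    have sq: "complex_of_real (sqrt \<eta>) \<noteq> 0" using \<eta> by simp
    have match0: "A * P 0 + B * Q 0 = I 0"
    proof -
      have "A * P 0 + B * Q 0 = ((I 0 * Q' + Q 0 * I' / of_real (sqrt \<eta>)) * P 0 + (P' * I 0 - P 0 * I' / of_real (sqrt \<eta>)) * Q 0) / W"
        by (simp only: A_def B_def times_divide_eq_left add_divide_distrib [symmetric])
      also have "(I 0 * Q' + Q 0 * I' / of_real (sqrt \<eta>)) * P 0 + (P' * I 0 - P 0 * I' / of_real (sqrt \<eta>)) * Q 0 = I 0 * W"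
        by (simp add: W_def algebra_simps)
      finally show ?thesis using W by simp
    qed
    \<comment> \<open>Equality of the increments from \<open>m\<close> to \<open>m + 1\<close>: the
      steps are sqrt \<eta> / sqrt m above and 1 / sqrt m below, hence the division by sqrt \<eta>;
      the sign at Q' comes from the negative step.\<close>
    have match': "A * P' - B * Q' = I' / of_real (sqrt \<eta>)"
    proof -
      have "A * P' - B * Q' = ((I 0 * Q' + Q 0 * I' / of_real (sqrt \<eta>)) * P' - (P' * I 0 - P 0 * I' / of_real (sqrt \<eta>)) * Q') / W"
        by (simp only: A_def B_def times_divide_eq_left diff_divide_distrib [symmetric])
      also have "(I 0 * Q' + Q 0 * I' / of_real (sqrt \<eta>)) * P' - (P' * I 0 - P 0 * I' / of_real (sqrt \<eta>)) * Q' = I' / of_real (sqrt \<eta>) * W"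
        unfolding W_def divide_inverse by (simp add: algebra_simps)
      finally show ?thesis using W by simp
    qed
    have pos0: "0 \<le> real m / \<eta> + 0" "0 \<le> real m / 1 + 0" using \<eta> by simp_all
    define D where "D = complex_of_real (sqrt \<eta> / sqrt (real m))"
    have P1: "P 1 = P 0 + D * P'"
      using scaled_charlier_step [OF Re_quotient_pos(1) \<eta> _ m \<rho> pos0(1), of 1] by (simp add: P_def P'_def D_def)
    have Q1: "Q 1 = Q 0 - D * Q'"
      using scaled_charlier_step [OF Re_quotient_pos(1) \<eta> _ m \<rho> pos0(1), of "- 1"] by (simp add: Q_def Q'_def D_def)
    have I1: "I 1 = I 0 + of_real (1 / sqrt (real m)) * I'"
      using scaled_charlier_step [OF \<theta> zero_less_one _ m \<rho> pos0(2), of 1] by (simp add: I_def I'_def)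
    have match1: "A * P 1 + B * Q 1 = I 1"
    proof -
      have "A * P 1 + B * Q 1 = (A * P 0 + B * Q 0) + D * (A * P' - B * Q')"
        unfolding P1 Q1 by (simp add: algebra_simps)
      also have "\<dots> = I 0 + D * (I' / of_real (sqrt \<eta>))"
        unfolding match0 match' ..
      also have "\<dots> = I 1" unfolding I1 D_def using sq by simp
      finally show ?thesis .
    qed
    have low: "erlang_solution m n = I (real n - real m)" if "n \<le> Suc m" for n
      using that match1 by (cases "n \<le> m") (auto simp: erlang_solution_def I_def ws [unfolded I_def] le_Suc_eq)
    have high: "erlang_solution m n = A * P (real n - real m) + B * Q (real n - real m)" if "m \<le> n" for n
      using that match0 by (cases "n = m") (auto simp: erlang_solution_def I_def ws)
    have "(\<theta> + of_real \<rho> + of_real (erlang_a_death_rate m \<eta> n)) * erlang_solution m n =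
      of_real \<rho> * erlang_solution m (Suc n) + of_real (erlang_a_death_rate m \<eta> n) * erlang_solution m (n - 1)" for n
    proof (cases "n \<le> m")
      case True
      define k where "k = real n - real m"
      have death: "erlang_a_death_rate m \<eta> n = real m + k * 1"
        using True by (simp add: erlang_a_death_rate_def k_def)
      have a: "1 \<le> real m / 1 + k \<or> real m / 1 + k = 0 \<and> 0 < (1::real)" by (cases n) (auto simp: k_def)
      have "(\<theta> + of_real \<rho> + of_real (real m + k * 1)) * I k = of_real \<rho> * I (k + 1) + of_real (real m + k * 1) * I (k - 1)"
        using scaled_charlier_recurrence [OF \<theta> zero_less_one _ m \<rho> a] by (simp add: I_def \<rho>_def)
      moreover have "erlang_solution m n = I k" "erlang_solution m (Suc n) = I (k + 1)"
        using True by (simp_all add: low k_def algebra_simps)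
      \<comment> \<open>At n = 0 the predecessor \<open>n - 1\<close> is 0 while k - 1 is -m - 1;
        the factor m + k = 0 reconciles them.\<close>
      moreover have "of_real (real m + k * 1) * I (k - 1) = of_real (real m + k * 1) * erlang_solution m (n - 1)"
        using True by (cases n) (simp_all add: low k_def algebra_simps)
      ultimately show ?thesis unfolding death by simp
    next
      case False
      define k where "k = real n - real m"
      have death: "erlang_a_death_rate m \<eta> n = real m + k * \<eta>"
        using False by (simp add: erlang_a_death_rate_def k_def)
      have k1: "1 \<le> k" using False by (simp add: k_def)
      \<comment> \<open>Strictly above \<open>m\<close> the first alternative always holds, so the
        solution with negative step is admissible as well.\<close>
      then have a: "1 \<le> real m / \<eta> + k \<or> real m / \<eta> + k = 0 \<and> 0 < \<epsilon>" for \<epsilon> :: real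
        using \<eta> by (simp add: add_increasing)
      define d where "d = complex_of_real (real m + k * \<eta>)"
      have PQ: "(\<theta> + of_real \<rho> + d) * P k = of_real \<rho> * P (k + 1) + d * P (k - 1)"
        "(\<theta> + of_real \<rho> + d) * Q k = of_real \<rho> * Q (k + 1) + d * Q (k - 1)"
        using scaled_charlier_recurrence [OF \<theta> \<eta> _ m \<rho> a, of 1] scaled_charlier_recurrence [OF \<theta> \<eta> _ m \<rho> a, of "- 1"]
        by (simp_all add: P_def Q_def \<rho>_def d_def)
      have "(\<theta> + of_real \<rho> + d) * (A * P k + B * Q k) = A * ((\<theta> + of_real \<rho> + d) * P k) + B * ((\<theta> + of_real \<rho> + d) * Q k)"
        by (simp add: algebra_simps)
      also have "\<dots> = of_real \<rho> * (A * P (k + 1) + B * Q (k + 1)) + d * (A * P (k - 1) + B * Q (k - 1))"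
        unfolding PQ by (simp add: algebra_simps)
      finally have "(\<theta> + of_real \<rho> + d) * (A * P k + B * Q k) = of_real \<rho> * (A * P (k + 1) + B * Q (k + 1)) + d * (A * P (k - 1) + B * Q (k - 1))" .
      moreover have "erlang_solution m n = A * P k + B * Q k" "erlang_solution m (Suc n) = A * P (k + 1) + B * Q (k + 1)"
        "erlang_solution m (n - 1) = A * P (k - 1) + B * Q (k - 1)"
        using False by (simp_all add: high k_def algebra_simps of_nat_diff)
      ultimately show ?thesis unfolding death d_def by simp
    qed
    then show ?case using \<rho> unfolding \<rho>_def by simp
  qed
qed

text \<open>
  The moduli of the discrete solutions increase with the state. A zero of the limit would therefore
  force it to vanish on a half-line, against the behaviour of \<^const>\<open>gauss_mellin\<close> at infinity.
\<close>

lemma limit_nonzero: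
  "(if y \<le> 0 then limit_left y else limit_right y) \<noteq> 0" (is "?F y \<noteq> 0")
proof
  assume zero: "?F y = 0"
  \<comment> \<open>Integer states whose scaled positions converge to z, so that monotonicity in the
    state passes to the limit.\<close>
  define n where "n z m = nat \<lfloor>real m + sqrt (real m) * z\<rfloor>" for z :: real and m :: nat
  have n: "(\<lambda>m. (real (n z m) - real m) / sqrt (real m)) \<longlonglongrightarrow> z" for z
  proof (rule tendsto_sandwich [of "\<lambda>m. z - inverse (sqrt (real m))" _ _ "\<lambda>m. z"])
    have "\<forall>\<^sub>F m in sequentially. 0 \<le> real m + sqrt (real m) * z" by real_asymp
    moreover have "\<forall>\<^sub>F m in sequentially. 0 < m" by (rule eventually_gt_at_top)
    ultimately have "\<forall>\<^sub>F m in sequentially. z - inverse (sqrt (real m)) \<le> (real (n z m) - real m) / sqrt (real m)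
       \<and> (real (n z m) - real m) / sqrt (real m) \<le> z"
    proof eventually_elim
      case (elim m)
      have "real (n z m) \<le> real m + sqrt (real m) * z" "real m + sqrt (real m) * z - 1 \<le> real (n z m)"
        using elim unfolding n_def by linarith+
      moreover have s: "0 < sqrt (real m)" "sqrt (real m) * sqrt (real m) = real m" using elim by simp_all
      moreover have "(z - inverse (sqrt (real m))) * sqrt (real m) = z * sqrt (real m) - 1"
        using s(1) by (simp add: left_diff_distrib)
      ultimately show ?case
        by (simp only: pos_le_divide_eq pos_divide_le_eq) (simp add: mult.commute)
    qed
    then show "\<forall>\<^sub>F m in sequentially. z - inverse (sqrt (real m)) \<le> (real (n z m) - real m) / sqrt (real m)"
      "\<forall>\<^sub>F m in sequentially. (real (n z m) - real m) / sqrt (real m) \<le> z"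
      by (auto elim: eventually_mono)
    have "(\<lambda>m. inverse (sqrt (real m))) \<longlonglongrightarrow> 0" by real_asymp
    from tendsto_diff [OF tendsto_const this, of z] show "(\<lambda>m. z - inverse (sqrt (real m))) \<longlonglongrightarrow> z" by simp
  qed simp
  have mono: "cmod (?F z) \<le> cmod (?F y)" if "z \<le> y" for z
  proof (rule tendsto_le [OF sequentially_bot])
    show "(\<lambda>m. cmod (erlang_solution m (n y m))) \<longlonglongrightarrow> cmod (?F y)"
      by (intro tendsto_norm erlang_solution_tendsto n)
    show "(\<lambda>m. cmod (erlang_solution m (n z m))) \<longlonglongrightarrow> cmod (?F z)"
      by (intro tendsto_norm erlang_solution_tendsto n)
    show "\<forall>\<^sub>F m in sequentially. cmod (erlang_solution m (n z m)) \<le> cmod (erlang_solution m (n y m))"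
      using eventually_erlang_recurrence
    proof eventually_elim
      case (elim m)
      have "n z m \<le> n y m"
        unfolding n_def using that by (intro nat_mono floor_mono add_left_mono mult_left_mono) auto
      then show ?case
        using elim \<eta> \<theta>
        by (intro recurrence_norm_mono [where birth = "\<lambda>_. real m - sqrt (real m) * \<beta>" and death = "erlang_a_death_rate m \<eta>" and \<theta> = \<theta>])
           (auto simp: erlang_a_death_rate_def)
    qed
  qed
  \<comment> \<open>Large u corresponds to the position -\<beta> - u, left of both 0 and y, where
    monotonicity forces \<open>limit_left\<close> to vanish.\<close>
  have "gauss_mellin \<theta> (of_real u) = 0" if "max (- \<beta>) (- \<beta> - y) \<le> u" for u
  proof -
    have "- \<beta> - u \<le> 0" "- \<beta> - u \<le> y" using that by auto
    then have "limit_left (- \<beta> - u) = 0" using mono [of "- \<beta> - u"] zero by simp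
    then show ?thesis by (simp add: limit_left_def)
  qed
  then have "\<forall>\<^sub>F u in at_top. of_real u powr \<theta> * gauss_mellin \<theta> (of_real u) = 0"
    using eventually_ge_at_top [of "max (- \<beta>) (- \<beta> - y)"] by (auto elim: eventually_mono)
  with gauss_mellin_at_top [OF \<theta>] have "((\<lambda>u::real. 0) \<longlongrightarrow> Gamma \<theta>) at_top"
    by (rule Lim_transform_eventually)
  then have "Gamma \<theta> = 0" by (simp add: tendsto_const_iff)
  then show False using Gamma_nonzero_of_Re_pos [OF \<theta>] by simp
qed

text \<open>In \<open>Lambda1\<close> and \<open>Lambda2\<close> the z/2 parts of the derivatives
  cancel, because sqrt \<eta> times \<beta> / sqrt \<eta> is \<beta>. What remains are the
  numerators of the matching coefficients; their common Wronskian denominator supplies sqrt (2 pi)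
  and Gamma (\<theta> / \<eta>).\<close>

lemma Lambda_comb_eq:
  "Lambda_comb \<eta> \<beta> \<theta> y = of_real (exp (- (\<beta> * y / 2 + \<eta> * y\<^sup>2 / 4)) * exp (- \<beta>\<^sup>2 / 4) * sqrt (2 * pi * \<eta>))
     / (Gamma (\<theta> / of_real \<eta>) * Gamma \<theta>) * limit_right y"
proof -
  let ?q = "\<theta> / of_real \<eta>"
  define a where "a = \<beta> / sqrt \<eta>"
  define s where "s = (\<beta> + \<eta> * y) / sqrt \<eta>"
  have sq: "sqrt \<eta> * a = \<beta>" "sqrt \<eta> \<noteq> 0" using \<eta> by (simp_all add: a_def)
  have args: "- \<beta> / sqrt \<eta> = - a" "\<beta> / sqrt \<eta> = a" "(\<beta> + \<eta> * y) / sqrt \<eta> = s" "(- \<beta> - \<eta> * y) / sqrt \<eta> = - s"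
    by (simp_all add: a_def s_def add_divide_distrib diff_divide_distrib)
  have Dq: "parabolic_cylinder (- \<theta> / of_real \<eta>) (of_real z) = of_real (exp (- z\<^sup>2 / 4)) * gauss_mellin ?q (of_real z) / Gamma ?q" for z
    using parabolic_cylinder_eq_gauss_mellin [OF Re_quotient_pos(1)] by (simp flip: exp_of_real)
  have Dq': "deriv (parabolic_cylinder (- \<theta> / of_real \<eta>)) (of_real z) = - of_real (exp (- z\<^sup>2 / 4)) * (of_real z / 2 * gauss_mellin ?q (of_real z) + gauss_mellin (?q + 1) (of_real z)) / Gamma ?q" for z
    using deriv_parabolic_cylinder_eq_gauss_mellin [OF Re_quotient_pos(1), of "of_real z"] by (simp flip: exp_of_real)
  have Dt: "parabolic_cylinder (- \<theta>) (of_real z) = of_real (exp (- z\<^sup>2 / 4)) * gauss_mellin \<theta> (of_real z) / Gamma \<theta>" for z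
    using parabolic_cylinder_eq_gauss_mellin [OF \<theta>] by (simp flip: exp_of_real)
  have Dt': "deriv (parabolic_cylinder (- \<theta>)) (of_real z) = - of_real (exp (- z\<^sup>2 / 4)) * (of_real z / 2 * gauss_mellin \<theta> (of_real z) + gauss_mellin (\<theta> + 1) (of_real z)) / Gamma \<theta>" for z
    using deriv_parabolic_cylinder_eq_gauss_mellin [OF \<theta>, of "of_real z"] by (simp flip: exp_of_real)
  define g where "g = gauss_mellin ?q (of_real a)"
  define g' where "g' = gauss_mellin (?q + 1) (of_real a)"
  define f where "f = gauss_mellin ?q (of_real (- a))"
  define f' where "f' = gauss_mellin (?q + 1) (of_real (- a))"
  define t where "t = gauss_mellin \<theta> (of_real (- \<beta>))"
  define t' where "t' = gauss_mellin (\<theta> + 1) (of_real (- \<beta>))"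
  define S where "S = complex_of_real (sqrt \<eta>)"
  define e1 where "e1 = complex_of_real (exp (- a\<^sup>2 / 4))"
  define e2 where "e2 = complex_of_real (exp (- \<beta>\<^sup>2 / 4))"
  define GA where "GA = Gamma ?q"
  define GB where "GB = Gamma \<theta>"
  define G1 where "G1 = inverse GA"
  define G2 where "G2 = inverse GB"
  define c where "c = e1 * e2 * G1 * G2"
  have Sa: "complex_of_real \<beta> = S * of_real a" and S: "S \<noteq> 0"
    using sq by (simp_all add: S_def flip: of_real_mult)
  have L1: "Lambda1 \<eta> \<beta> \<theta> = c * (S * f' * t - f * t')"
    unfolding Lambda1_def args Dq Dq' Dt Dt'
    unfolding f_def [symmetric] f'_def [symmetric] t_def [symmetric] t'_def [symmetric] S_def [symmetric] power2_minus GA_def [symmetric] GB_def [symmetric]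
    unfolding e1_def [symmetric] e2_def [symmetric]
    unfolding of_real_minus Sa divide_inverse G1_def [symmetric] G2_def [symmetric]
    by (simp add: c_def algebra_simps)
  have L2: "Lambda2 \<eta> \<beta> \<theta> = c * (S * g' * t + g * t')"
    unfolding Lambda2_def args Dq Dq' Dt Dt'
    unfolding g_def [symmetric] g'_def [symmetric] t_def [symmetric] t'_def [symmetric] S_def [symmetric] power2_minus GA_def [symmetric] GB_def [symmetric]
    unfolding e1_def [symmetric] e2_def [symmetric]
    unfolding of_real_minus Sa divide_inverse G1_def [symmetric] G2_def [symmetric]
    by (simp add: c_def algebra_simps)
  have R: "limit_right y * (S * limit_wronskian) = (S * g' * t + g * t') * gauss_mellin ?q (of_real (- s)) + (S * f' * t - f * t') * gauss_mellin ?q (of_real s)"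
    unfolding limit_right_def args g_def [symmetric] g'_def [symmetric] f_def [symmetric] f'_def [symmetric] t_def [symmetric] t'_def [symmetric] S_def [symmetric]
    using S limit_wronskian_nonzero by (simp add: field_simps)
  have "Lambda_comb \<eta> \<beta> \<theta> y = c * of_real (exp (- s\<^sup>2 / 4)) / Gamma ?q * (limit_right y * (S * limit_wronskian))"
    unfolding Lambda_comb_def args Dq L1 L2 R by (simp add: algebra_simps add_divide_distrib diff_divide_distrib)
  also have "\<dots> = (c * of_real (exp (- s\<^sup>2 / 4)) / Gamma ?q * (S * limit_wronskian)) * limit_right y" by simp
  also have "c * of_real (exp (- s\<^sup>2 / 4)) / Gamma ?q * (S * limit_wronskian) =
      of_real (exp (- a\<^sup>2 / 4) * exp (- \<beta>\<^sup>2 / 4) * exp (- s\<^sup>2 / 4) * (sqrt \<eta> * sqrt (2 * pi)) * exp (a\<^sup>2 / 2)) / (Gamma ?q * Gamma \<theta>)"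
    unfolding limit_wronskian_eq args c_def S_def e1_def e2_def G1_def G2_def GA_def GB_def using Gamma_nonzero_of_Re_pos [OF Re_quotient_pos(1)] by (simp add: field_simps)
  also have "exp (- a\<^sup>2 / 4) * exp (- \<beta>\<^sup>2 / 4) * exp (- s\<^sup>2 / 4) * (sqrt \<eta> * sqrt (2 * pi)) * exp (a\<^sup>2 / 2)
     = exp (- (\<beta> * y / 2 + \<eta> * y\<^sup>2 / 4)) * exp (- \<beta>\<^sup>2 / 4) * sqrt (2 * pi * \<eta>)"
  proof -
    \<comment> \<open>The Wronskian factor exp (a^2/2) cancels the a^2 parts of both Gaussian
      factors, leaving the dependence on y.\<close>
    have "s\<^sup>2 = a\<^sup>2 + 2 * \<beta> * y + \<eta> * y\<^sup>2"
      using \<eta> by (simp add: a_def s_def power_divide) (simp add: field_simps power2_eq_square)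
    then have "- a\<^sup>2 / 4 + - s\<^sup>2 / 4 + a\<^sup>2 / 2 = - (\<beta> * y / 2 + \<eta> * y\<^sup>2 / 4)"
      by (simp add: field_simps)
    then have E: "exp (- a\<^sup>2 / 4) * exp (- s\<^sup>2 / 4) * exp (a\<^sup>2 / 2) = exp (- (\<beta> * y / 2 + \<eta> * y\<^sup>2 / 4))"
      by (simp only: exp_add [symmetric])
    have S: "sqrt \<eta> * sqrt (2 * pi) = sqrt (2 * pi * \<eta>)" by (simp add: real_sqrt_mult)
    have "exp (- a\<^sup>2 / 4) * exp (- \<beta>\<^sup>2 / 4) * exp (- s\<^sup>2 / 4) * (sqrt \<eta> * sqrt (2 * pi)) * exp (a\<^sup>2 / 2)
      = (exp (- a\<^sup>2 / 4) * exp (- s\<^sup>2 / 4) * exp (a\<^sup>2 / 2)) * exp (- \<beta>\<^sup>2 / 4) * (sqrt \<eta> * sqrt (2 * pi))"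
      by (simp only: mult_ac)
    then show ?thesis by (simp only: E S)
  qed
  finally show ?thesis .
qed

lemma limit_transform_right_eq:
  "limit_transform_right \<eta> \<beta> b \<theta> x = limit_right x / limit_right b"
proof -
  let ?E = "\<lambda>y. exp (- (\<beta> * y / 2 + \<eta> * y\<^sup>2 / 4))"
  define C where "C = of_real (exp (- \<beta>\<^sup>2 / 4) * sqrt (2 * pi * \<eta>)) / (Gamma (\<theta> / of_real \<eta>) * Gamma \<theta>)"
  have C: "C \<noteq> 0"
    using \<eta> Gamma_nonzero_of_Re_pos [OF Re_quotient_pos(1)] Gamma_nonzero_of_Re_pos [OF \<theta>] by (simp add: C_def)
  have L: "Lambda_comb \<eta> \<beta> \<theta> y = of_real (?E y) * C * limit_right y" for y
    unfolding Lambda_comb_eq C_def by simp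
  have "exp (\<beta> * (x - b) / 2) * exp (\<eta> * (x\<^sup>2 - b\<^sup>2) / 4) * ?E x = ?E b"
    unfolding exp_add [symmetric] by (simp add: field_simps)
  then have E: "complex_of_real (exp (\<beta> * (x - b) / 2) * exp (\<eta> * (x\<^sup>2 - b\<^sup>2) / 4)) * of_real (?E x) = of_real (?E b)"
    by (simp only: of_real_mult [symmetric])
  have "limit_transform_right \<eta> \<beta> b \<theta> x = (of_real (exp (\<beta> * (x - b) / 2) * exp (\<eta> * (x\<^sup>2 - b\<^sup>2) / 4)) * of_real (?E x)) * (C * limit_right x) / (of_real (?E b) * (C * limit_right b))"
    unfolding limit_transform_right_def L by (simp only: mult.assoc times_divide_eq_right)
  also have "\<dots> = limit_right x / limit_right b"
    unfolding E using C by simp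
  finally show ?thesis .
qed

text \<open>The constant sqrt (2 pi \<eta>) and Gamma (\<theta> / \<eta>) in the left branch cancel
  exactly against those in \<open>Lambda_comb_eq\<close>, and Gamma \<theta> against the
  normalisation of the parabolic cylinder function.\<close>

lemma limit_transform_left_eq:
  "limit_transform_left \<eta> \<beta> b \<theta> x = limit_left x / limit_right b"
proof -
  let ?E = "\<lambda>y. exp (- (\<beta> * y / 2 + \<eta> * y\<^sup>2 / 4))"
  let ?P = "exp (\<beta> * (x - b) / 2) * exp ((x\<^sup>2 - \<eta> * b\<^sup>2) / 4)"
  have G: "Gamma (\<theta> / of_real \<eta>) \<noteq> 0" "Gamma \<theta> \<noteq> 0"
    using Gamma_nonzero_of_Re_pos [OF Re_quotient_pos(1)] Gamma_nonzero_of_Re_pos [OF \<theta>] by simp_all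
  have D: "parabolic_cylinder (- \<theta>) (of_real (- \<beta> - x)) = of_real (exp (- (- \<beta> - x)\<^sup>2 / 4)) * limit_left x / Gamma \<theta>"
    unfolding limit_left_def parabolic_cylinder_eq_gauss_mellin [OF \<theta>] by (simp flip: exp_of_real)
  have E: "?P * exp (- (- \<beta> - x)\<^sup>2 / 4) = ?E b * exp (- \<beta>\<^sup>2 / 4)"
    unfolding exp_add [symmetric] by (simp add: field_simps power2_eq_square)
  define R where "R = complex_of_real (sqrt (2 * pi * \<eta>))"
  have R: "R \<noteq> 0" using \<eta> by (simp add: R_def)
  define X where "X = complex_of_real (?E b * exp (- \<beta>\<^sup>2 / 4))"
  have X: "X \<noteq> 0" by (simp add: X_def)
  have "limit_transform_left \<eta> \<beta> b \<theta> x = of_real (?P * exp (- (- \<beta> - x)\<^sup>2 / 4)) * R * limit_left x / Gamma \<theta>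
      / (Gamma (\<theta> / of_real \<eta>) * (X * R / (Gamma (\<theta> / of_real \<eta>) * Gamma \<theta>) * limit_right b))"
    unfolding limit_transform_left_def D Lambda_comb_eq R_def X_def by simp
  also have "\<dots> = X * R * limit_left x / Gamma \<theta>
      / (Gamma (\<theta> / of_real \<eta>) * (X * R / (Gamma (\<theta> / of_real \<eta>) * Gamma \<theta>) * limit_right b))"
    unfolding E X_def ..
  also have "\<dots> = limit_left x / limit_right b"
    using G R X by (simp add: field_simps)
  finally show ?thesis .
qed

end

theorem corollary7:
  fixes \<eta> \<beta> b x :: real and \<theta> :: complex
    and M :: "nat \<Rightarrow> 'a measure"
    and N :: "nat \<Rightarrow> real \<Rightarrow> 'a \<Rightarrow> nat"
    and n nstar :: "nat \<Rightarrow> nat"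
  assumes "\<eta> > 0" and "Re \<theta> > 0" and "0 < b" and "x < b"
    and "\<forall>\<^sub>F m in sequentially.
           erlang_a_process (M m) (N m) m (real m - sqrt (real m) * \<beta>) \<eta> \<and>
           measure (M m) {\<omega> \<in> space (M m). N m 0 \<omega> = n m} > 0"
    and "(\<lambda>m. (real (n m) - real m) / sqrt (real m)) \<longlonglongrightarrow> x"
    and "(\<lambda>m. (real (nstar m) - real m) / sqrt (real m)) \<longlonglongrightarrow> b"
  shows "(x \<le> 0 \<longrightarrow>
            (\<lambda>m. first_passage_laplace (M m) (N m) (nstar m) (n m) \<theta>)
              \<longlonglongrightarrow> limit_transform_left \<eta> \<beta> b \<theta> x) \<and>
         (0 \<le> x \<longrightarrow>
            (\<lambda>m. first_passage_laplace (M m) (N m) (nstar m) (n m) \<theta>)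
              \<longlonglongrightarrow> limit_transform_right \<eta> \<beta> b \<theta> x)"
proof -
  let ?U = "erlang_solution \<eta> \<beta> \<theta>"
  let ?F = "if x \<le> 0 then limit_left \<beta> \<theta> x else limit_right \<eta> \<beta> \<theta> x"
  have U_n: "(\<lambda>m. ?U m (n m)) \<longlonglongrightarrow> ?F"
    by (rule erlang_solution_tendsto [OF assms(1,2,6)])
  have U_nstar: "(\<lambda>m. ?U m (nstar m)) \<longlonglongrightarrow> limit_right \<eta> \<beta> \<theta> b"
    using erlang_solution_tendsto [OF assms(1,2,7)] assms(3) by simp
  have b0: "limit_right \<eta> \<beta> \<theta> b \<noteq> 0"
    using limit_nonzero [OF assms(1,2), where y = b and \<beta> = \<beta>] assms(3) by simp
  \<comment> \<open>A level strictly between the two limits separates the scaled states, so the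
    start eventually lies below the target.\<close>
  obtain c where c: "x < c" "c < b" using assms(4) dense by blast
  have "\<forall>\<^sub>F m in sequentially. (real (n m) - real m) / sqrt (real m) < c"
    using assms(6) c(1) by (rule order_tendstoD)
  moreover have "\<forall>\<^sub>F m in sequentially. c < (real (nstar m) - real m) / sqrt (real m)"
    using assms(7) c(2) by (rule order_tendstoD)
  ultimately have "\<forall>\<^sub>F m in sequentially. n m < nstar m"
    using eventually_gt_at_top [of 0]
  proof eventually_elim
    case (elim m)
    then have "(real (n m) - real m) / sqrt (real m) < (real (nstar m) - real m) / sqrt (real m)" by linarith
    then show ?case using elim by (simp add: divide_less_cancel)
  qed
  moreover have "\<forall>\<^sub>F m in sequentially. ?U m (nstar m) \<noteq> 0"
    using U_nstar b0 by (rule tendsto_imp_eventually_ne)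
  ultimately have "\<forall>\<^sub>F m in sequentially. ?U m (n m) / ?U m (nstar m) = first_passage_laplace (M m) (N m) (nstar m) (n m) \<theta>"
    using assms(5) eventually_erlang_recurrence [OF assms(1,2), where \<beta> = \<beta>]
  proof eventually_elim
    case (elim m)
    have "?U m (n m) = ?U m (nstar m) * first_passage_laplace (M m) (N m) (nstar m) (n m) \<theta>"
      using elim assms(2)
      by (intro first_passage_laplace_recurrence [where birth = "\<lambda>_. real m - sqrt (real m) * \<beta>" and death = "erlang_a_death_rate m \<eta>"])
        (auto simp: erlang_a_process_def)
    then show ?case using elim by simp
  qed
  with tendsto_divide [OF U_n U_nstar b0]
  have lim: "(\<lambda>m. first_passage_laplace (M m) (N m) (nstar m) (n m) \<theta>) \<longlonglongrightarrow> ?F / limit_right \<eta> \<beta> \<theta> b"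
    by (rule Lim_transform_eventually)
  have "?F = limit_right \<eta> \<beta> \<theta> x" if "0 \<le> x"
    using that limit_right_0 [OF assms(1,2)] by (cases "x = 0") auto
  then show ?thesis
    using lim limit_transform_left_eq [OF assms(1,2)] limit_transform_right_eq [OF assms(1,2)] by auto
qed

end
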